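(* Let $\kappa>0$. Let $\phi\in L^2(\mathbb R)$ vanish outside $[-\kappa,\kappa]$. Let $0<a<b<\infty$ and $\delta>0$ be such that $H_D$ has no eigenvalues in $[a-\delta,a]\cup[b,b+\delta]$, and let $\chi$ be a continuous function on $\mathbb R$ with $1_{[a,b]}\le\chi\le1_{[a-\delta,b+\delta]}$. Denote the eigenvalues of $H_D$ in the support of $\chi$ by $E_j$, $j=1,\dots,n$, and their corresponding normalized eigenfunctions by $\phi_j$. Then, given $\epsilon>0$, there is an $\eta_\epsilon>0$ so that for all $t\ge0$ and all $\eta$ with $0<\eta<\eta_\epsilon$, $$\Big|\langle\phi,e^{-itH_{\kappa,\eta}}\chi(H_{\kappa,\eta})\phi\rangle-\sum_{j=1}^n|\langle\phi,\phi_j\rangle|^2e^{-itz_j(\eta)}\Big|<\epsilon ,$$ where $z_j(\eta)$ is the resonance of $H_{\kappa,\eta}$ arising from the eigenvalue $E_j$.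
   Context: For $\kappa,\eta>0$, $H_{\kappa,\eta}=p^2+\frac1\eta(\delta_\kappa+\delta_{-\kappa})$, $p=-i\frac{d}{dx}$, is the self-adjoint operator in $L^2(\mathbb R)$ associated with the quadratic form $\int|u'|^2dx+\eta^{-1}(|u(\kappa)|^2+|u(-\kappa)|^2)$ on $H^1(\mathbb R)$. $H_D=-\frac{d^2}{dx^2}$ in $L^2((-\kappa,\kappa))$ with zero (Dirichlet) boundary conditions at $\pm\kappa$; its eigenvalues are $(n\pi/2\kappa)^2$, $n\ge1$, and its eigenfunctions are regarded as elements of $L^2(\mathbb R)$ by extension by zero. The resonances of $H_{\kappa,\eta}$ are the poles of the meromorphic continuation of the Green's functions $(H_{\kappa,\eta}-z)^{-1}(x,y)$ from the upper half plane, across the positive real axis, to the lower half plane. They are the zeros of $$D_0(z)=\frac{(2\eta\sqrt z+i)^2+e^{4i\kappa\sqrt z}}{4\eta^2z},$$ where $\sqrt z$ is continued from $\operatorname{Im}\sqrt z>0$ across the positive real axis (so $\operatorname{Re}\sqrt z>0$). The resonance $z_j(\eta)$ is specified as follows: choose closed disjoint disks $D_j$ centered at the eigenvalues $E_j$ of $H_D$ in $[a,b]$, each $D_j$ containing exactly one eigenvalue of $H_D$, namely $E_j$; for small enough $\eta$ there is exactly one resonance of $H_{\kappa,\eta}$ in $D_j$, and this is $z_j(\eta)$. *)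

theory Defs
  imports "HOL-Analysis.Analysis" "HOL-Complex_Analysis.Complex_Analysis"
begin

text \<open>
  Elements of $L^2(R)$ are represented by Borel functions; equality in $L^2(R)$ is equality
  almost everywhere. The inner product is linear in its second argument.
\<close>

definition L2 :: "(real \<Rightarrow> complex) set" where
  "L2 = {f \<in> borel_measurable lborel. integrable lborel (\<lambda>x. (cmod (f x))\<^sup>2)}"

definition l2_inner :: "(real \<Rightarrow> complex) \<Rightarrow> (real \<Rightarrow> complex) \<Rightarrow> complex" where
  "l2_inner f g = (LINT x|lborel. cnj (f x) * g x)"

definition l2_norm :: "(real \<Rightarrow> complex) \<Rightarrow> real" where
  "l2_norm f = sqrt (LINT x|lborel. (cmod (f x))\<^sup>2)"

definition l2_eq :: "(real \<Rightarrow> complex) \<Rightarrow> (real \<Rightarrow> complex) \<Rightarrow> bool" where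
  "l2_eq f g \<longleftrightarrow> (AE x in lborel. f x = g x)"

definition l2_tendsto :: "(nat \<Rightarrow> real \<Rightarrow> complex) \<Rightarrow> (real \<Rightarrow> complex) \<Rightarrow> bool" where
  "l2_tendsto F g \<longleftrightarrow> (\<lambda>n. l2_norm (\<lambda>x. F n x - g x)) \<longlonglongrightarrow> 0"

text \<open>
  An unbounded operator \<open>A\<close> in $L^2(R)$ is given by its graph: \<open>A f w\<close> means that \<open>f\<close> lies in
  the domain of \<open>A\<close> and \<open>A f = w\<close>.
\<close>

type_synonym l2_operator = "(real \<Rightarrow> complex) \<Rightarrow> (real \<Rightarrow> complex) \<Rightarrow> bool"

definition eigenfunction :: "l2_operator \<Rightarrow> complex \<Rightarrow> (real \<Rightarrow> complex) \<Rightarrow> bool" where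
  "eigenfunction A e f \<longleftrightarrow> f \<in> L2 \<and> \<not> l2_eq f (\<lambda>x. 0) \<and> A f (\<lambda>x. e * f x)"

definition eigenvalue :: "l2_operator \<Rightarrow> complex \<Rightarrow> bool" where
  "eigenvalue A e \<longleftrightarrow> (\<exists>f. eigenfunction A e f)"

text \<open>
  \<open>H1 u u'\<close>: \<open>u\<close> is the absolutely continuous representative of an element of the Sobolev space
  $H^1(R)$, with derivative \<open>u'\<close>. In particular \<open>u\<close> is continuous, so that its point values
  at \<open>\<kappa>\<close> and \<open>-\<kappa>\<close> are meaningful.
\<close>

definition H1 :: "(real \<Rightarrow> complex) \<Rightarrow> (real \<Rightarrow> complex) \<Rightarrow> bool" where
  "H1 u u' \<longleftrightarrow> u \<in> L2 \<and> u' \<in> L2 \<and>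
     (\<forall>x y. x \<le> y \<longrightarrow> u y - u x = (LINT s:{x..y}|lborel. u' s))"

text \<open>
  The sesquilinear form obtained by polarization from
  $\int |u'|^2 dx + \eta^{-1}(|u(\kappa)|^2 + |u(-\kappa)|^2)$.
\<close>

definition delta_form ::
    "real \<Rightarrow> real \<Rightarrow> (real \<Rightarrow> complex) \<Rightarrow> (real \<Rightarrow> complex) \<Rightarrow>
     (real \<Rightarrow> complex) \<Rightarrow> (real \<Rightarrow> complex) \<Rightarrow> complex" where
  "delta_form \<kappa> \<eta> v v' u u' =
     l2_inner v' u' + of_real (1 / \<eta>) * (cnj (v \<kappa>) * u \<kappa> + cnj (v (-\<kappa>)) * u (-\<kappa>))"

text \<open>
  The operator associated with this form on $H^1(R)$: the domain consists of those
  \<open>u\<close> in the form domain for which some \<open>w\<close> in $L^2(R)$ represents the form,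
  $q(v,u) = \langle v,w\rangle$ for all \<open>v\<close> in the form domain, and then \<open>w\<close> is the image of \<open>u\<close>.
\<close>

definition H_delta :: "real \<Rightarrow> real \<Rightarrow> l2_operator" where
  "H_delta \<kappa> \<eta> f w \<longleftrightarrow> f \<in> L2 \<and> w \<in> L2 \<and>
     (\<exists>u u'. l2_eq f u \<and> H1 u u' \<and>
        (\<forall>v v'. H1 v v' \<longrightarrow> delta_form \<kappa> \<eta> v v' u u' = l2_inner v w))"

text \<open>
  The Dirichlet operator $-d^2/dx^2$ in $L^2((-\kappa,\kappa))$, whose elements are regarded as
  elements of $L^2(R)$ vanishing outside the interval. Here \<open>u\<close> is the representative which is
  absolutely continuous on the closed interval together with its derivative \<open>u'\<close>.
\<close>

definition H_Dirichlet :: "real \<Rightarrow> l2_operator" where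
  "H_Dirichlet \<kappa> f w \<longleftrightarrow> f \<in> L2 \<and> w \<in> L2 \<and>
     (AE x in lborel. x \<notin> {-\<kappa><..<\<kappa>} \<longrightarrow> f x = 0 \<and> w x = 0) \<and>
     (\<exists>u u'. (AE x in lborel. x \<in> {-\<kappa><..<\<kappa>} \<longrightarrow> f x = u x) \<and>
        u (-\<kappa>) = 0 \<and> u \<kappa> = 0 \<and>
        (\<forall>x y. -\<kappa> \<le> x \<and> x \<le> y \<and> y \<le> \<kappa> \<longrightarrow>
           u y - u x = (LINT s:{x..y}|lborel. u' s) \<and>
           u' y - u' x = - (LINT s:{x..y}|lborel. w s)))"

text \<open>
  The functional calculus $h \mapsto h(A)$ on bounded Borel functions, given by the properties
  which determine it for a self-adjoint operator \<open>A\<close> (the functional calculus form of the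
  spectral theorem; Reed and Simon, Theorem VIII.5). By that theorem a self-adjoint operator has
  such a calculus, and it is unique up to equality almost everywhere of the values.
\<close>

definition bounded_borel :: "(real \<Rightarrow> complex) set" where
  "bounded_borel = {h \<in> borel_measurable borel. bounded (range h)}"

locale borel_functional_calculus =
  fixes A :: l2_operator
    and \<Phi> :: "(real \<Rightarrow> complex) \<Rightarrow> (real \<Rightarrow> complex) \<Rightarrow> (real \<Rightarrow> complex)"
  assumes in_L2: "h \<in> bounded_borel \<Longrightarrow> f \<in> L2 \<Longrightarrow> \<Phi> h f \<in> L2"
    and linear: "h \<in> bounded_borel \<Longrightarrow> f \<in> L2 \<Longrightarrow> g \<in> L2 \<Longrightarrow>
        l2_eq (\<Phi> h (\<lambda>x. c * f x + g x)) (\<lambda>x. c * \<Phi> h f x + \<Phi> h g x)"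
    and norm_le: "h \<in> bounded_borel \<Longrightarrow> f \<in> L2 \<Longrightarrow> (\<And>s. cmod (h s) \<le> C) \<Longrightarrow>
        l2_norm (\<Phi> h f) \<le> C * l2_norm f"
    and hom_linear: "h \<in> bounded_borel \<Longrightarrow> k \<in> bounded_borel \<Longrightarrow> f \<in> L2 \<Longrightarrow>
        l2_eq (\<Phi> (\<lambda>s. c * h s + k s) f) (\<lambda>x. c * \<Phi> h f x + \<Phi> k f x)"
    and hom_mult: "h \<in> bounded_borel \<Longrightarrow> k \<in> bounded_borel \<Longrightarrow> f \<in> L2 \<Longrightarrow>
        l2_eq (\<Phi> (\<lambda>s. h s * k s) f) (\<Phi> h (\<Phi> k f))"
    and hom_one: "f \<in> L2 \<Longrightarrow> l2_eq (\<Phi> (\<lambda>s. 1) f) f"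
    and hom_adjoint: "h \<in> bounded_borel \<Longrightarrow> f \<in> L2 \<Longrightarrow> g \<in> L2 \<Longrightarrow>
        l2_inner (\<Phi> (\<lambda>s. cnj (h s)) f) g = l2_inner f (\<Phi> h g)"
    and strongly_continuous: "(\<And>n. h' n \<in> bounded_borel) \<Longrightarrow> h \<in> bounded_borel \<Longrightarrow>
        (\<And>s. (\<lambda>n. h' n s) \<longlonglongrightarrow> h s) \<Longrightarrow> (\<And>n s. cmod (h' n s) \<le> C) \<Longrightarrow> f \<in> L2 \<Longrightarrow>
        l2_tendsto (\<lambda>n. \<Phi> (h' n) f) (\<Phi> h f)"
    and identity_limit: "(\<And>n. h' n \<in> bounded_borel) \<Longrightarrow>
        (\<And>s. (\<lambda>n. h' n s) \<longlonglongrightarrow> of_real s) \<Longrightarrow> (\<And>n s. cmod (h' n s) \<le> \<bar>s\<bar>) \<Longrightarrow> A f w \<Longrightarrow>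
        l2_tendsto (\<lambda>n. \<Phi> (h' n) f) w"

text \<open>
  The Green's function at \<open>z\<close> is the continuous integral kernel of $(A-z)^{-1}$: for every \<open>f\<close> in
  $L^2(R)$ the function $u(x) = \int G(x,y) f(y) dy$ is in the domain of \<open>A\<close> and satisfies
  $A u = f + z u$.
\<close>

definition green_kernel :: "l2_operator \<Rightarrow> complex \<Rightarrow> (real \<Rightarrow> real \<Rightarrow> complex) \<Rightarrow> bool" where
  "green_kernel A z G \<longleftrightarrow> continuous_on UNIV (\<lambda>(x, y). G x y) \<and>
     (\<forall>f\<in>L2. let u = (\<lambda>x. LINT y|lborel. G x y * f y) in A u (\<lambda>x. f x + z * u x))"

definition green_function :: "l2_operator \<Rightarrow> complex \<Rightarrow> real \<Rightarrow> real \<Rightarrow> complex" where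
  "green_function A z = (THE G. green_kernel A z G)"

text \<open>
  The continuation from the upper half plane across the positive real axis is a function on the
  plane slit along the nonpositive reals; a resonance is a point of the lower half plane at which
  this continuation has a pole for some \<open>x\<close>, \<open>y\<close>.
\<close>

definition resonance :: "l2_operator \<Rightarrow> complex \<Rightarrow> bool" where
  "resonance A z\<^sub>0 \<longleftrightarrow> Im z\<^sub>0 < 0 \<and>
     (\<exists>x y F. F meromorphic_on (- \<real>\<^sub>\<le>\<^sub>0) \<and>
        (\<forall>z. Im z > 0 \<longrightarrow> F z = green_function A z x y) \<and> is_pole F z\<^sub>0)"

definition resonance_in :: "l2_operator \<Rightarrow> complex set \<Rightarrow> complex" where
  "resonance_in A D = (THE z. z \<in> D \<and> resonance A z)"

end

theory Submission
  imports Defs "HOL-Probability.Probability" "HOL-Real_Asymp.Real_Asymp"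
begin

text \<open>
  The density of the spectral measure of \<open>\<phi>\<close> is \<open>Im M / \<pi>\<close> with
  \<open>M(z) = \<langle>\<phi>, inverse (H - z) \<phi>\<rangle>\<close>. Krein's formula gives
  \<open>M = edge_num / edge_wronskian\<close>, where both terms are entire in the momentum
  \<open>k = sqrt z\<close> and jointly continuous in \<open>(\<eta>, k)\<close> up to
  \<open>\<eta> = 0\<close>, where they describe the Dirichlet problem. Away from the Dirichlet eigenvalues the
  density therefore tends to \<open>0\<close> uniformly. Near \<open>E\<^sub>j\<close>, Hurwitz' theorem provides a
  simple pole \<open>z\<^sub>j(\<eta>)\<close> of \<open>M\<close>, with residue close to
  \<open>- |\<langle>\<phi>, \<phi>\<^sub>j\<rangle>|\<^sup>2\<close>, and the density is close in
  \<open>L\<^sup>1\<close> to \<open>|\<langle>\<phi>, \<phi>\<^sub>j\<rangle>|\<^sup>2\<close> times the Lorentzian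
  centred at \<open>Re z\<^sub>j\<close> of width \<open>- Im z\<^sub>j\<close>, whose Fourier transform is
  \<open>exp (- i t z\<^sub>j)\<close>. Closeness in \<open>L\<^sup>1\<close> makes the estimate uniform in
  \<open>t\<close>.
\<close>

subsection \<open>The space $L^2$ and the form domain\<close>

text \<open>All estimates stay on the real energy axis: \<chi> is merely continuous, so the contour
  cannot be deformed through it, and t is unbounded. Both sides of the claim involve \<phi> alone,
  so the diagonal element M determines everything, and an arbitrary functional calculus enters only
  through its resolvent. As \<eta> tends to 0 the coupling 1/\<eta> diverges and the widths of the
  resonances shrink to 0, so the density has no uniform limit near an eigenvalue. The first
  difficulty disappears once M is a quotient of quantities regular at \<eta> = 0; compactness then
  replaces expansions in \<eta>, and no rate of convergence enters. The second is not settled by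
  convergence of pole and residue: a residue with nonzero imaginary part adds an odd tail whose
  integral grows like the logarithm of the inverse width. Nonnegativity of the spectral density
  supplies the missing bound. Reflection symmetry separates even and odd states, and the two
  resulting resonance conditions multiply to the numerator of D_0.\<close>

lemma L2_measurable: "f \<in> L2 \<Longrightarrow> f \<in> borel_measurable borel"
  by (simp add: L2_def)

lemma L2_integrable_sq: "f \<in> L2 \<Longrightarrow> integrable lborel (\<lambda>x. (cmod (f x))\<^sup>2)"
  by (simp add: L2_def)

lemma L2_integrable_norm_mult:
  assumes "f \<in> L2" "g \<in> L2"
  shows "integrable lborel (\<lambda>x. cmod (f x) * cmod (g x))"
proof (rule Bochner_Integration.integrable_bound)
  show "integrable lborel (\<lambda>x. (cmod (f x))\<^sup>2 + (cmod (g x))\<^sup>2)"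
    using assms by (simp add: L2_integrable_sq)
  have "cmod (f x) * cmod (g x) \<le> (cmod (f x))\<^sup>2 + (cmod (g x))\<^sup>2" for x
  proof -
    have "0 \<le> cmod (f x) * cmod (g x)" by simp
    then show ?thesis
      using sum_squares_bound[of "cmod (f x)" "cmod (g x)"] by linarith
  qed
  then show "AE x in lborel. norm (cmod (f x) * cmod (g x)) \<le> norm ((cmod (f x))\<^sup>2 + (cmod (g x))\<^sup>2)"
    by (simp add: abs_mult)
qed (use assms[THEN L2_measurable] in measurable)

lemma L2_integrable_mult:
  assumes "f \<in> L2" "g \<in> L2"
  shows "integrable lborel (\<lambda>x. f x * g x)"
  by (rule Bochner_Integration.integrable_bound[OF L2_integrable_norm_mult[OF assms]])
     (use assms[THEN L2_measurable] in \<open>auto simp: norm_mult\<close>)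

lemma borel_measurable_cnj [measurable]: "cnj \<in> borel_measurable borel"
  by (intro borel_measurable_continuous_onI continuous_intros)

lemma L2_cnj: "f \<in> L2 \<Longrightarrow> (\<lambda>x. cnj (f x)) \<in> L2"
  using measurable_compose[OF L2_measurable borel_measurable_cnj, of f] by (simp add: L2_def)

lemma L2_integrable_inner:
  "f \<in> L2 \<Longrightarrow> g \<in> L2 \<Longrightarrow> integrable lborel (\<lambda>x. cnj (f x) * g x)"
  using L2_integrable_mult[OF L2_cnj] by blast

lemma L2_lincomb:
  assumes "f \<in> L2" "g \<in> L2"
  shows "(\<lambda>x. c * f x + g x) \<in> L2"
proof -
  have m: "(\<lambda>x. c * f x + g x) \<in> borel_measurable borel"
    using assms[THEN L2_measurable] by measurable
  have "integrable lborel (\<lambda>x. (cmod (c * f x + g x))\<^sup>2)"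
  proof (rule Bochner_Integration.integrable_bound)
    show "integrable lborel (\<lambda>x. 2 * (cmod c)\<^sup>2 * (cmod (f x))\<^sup>2 + 2 * (cmod (g x))\<^sup>2)"
      using assms by (simp add: L2_integrable_sq)
    have "(cmod (c * f x + g x))\<^sup>2 \<le> 2 * (cmod c)\<^sup>2 * (cmod (f x))\<^sup>2 + 2 * (cmod (g x))\<^sup>2" for x
    proof -
      have "(cmod (c * f x + g x))\<^sup>2 \<le> (cmod (c * f x) + cmod (g x))\<^sup>2"
        by (intro power_mono norm_triangle_ineq) auto
      also have "\<dots> \<le> 2 * (cmod (c * f x))\<^sup>2 + 2 * (cmod (g x))\<^sup>2"
        using sum_squares_bound[of "cmod (c * f x)" "cmod (g x)"] by (simp add: power2_sum)
      finally show ?thesis by (simp add: norm_mult power_mult_distrib)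
    qed
    then show "AE x in lborel. norm ((cmod (c * f x + g x))\<^sup>2)
        \<le> norm (2 * (cmod c)\<^sup>2 * (cmod (f x))\<^sup>2 + 2 * (cmod (g x))\<^sup>2)"
      by simp
  qed (use m in simp)
  with m show ?thesis by (simp add: L2_def)
qed

lemma L2_zero: "(\<lambda>x. 0) \<in> L2"
  by (simp add: L2_def)

lemma L2_cmult: "f \<in> L2 \<Longrightarrow> (\<lambda>x. c * f x) \<in> L2"
  using L2_lincomb[of f "\<lambda>x. 0" c] L2_zero by simp

lemma L2_diff: "f \<in> L2 \<Longrightarrow> g \<in> L2 \<Longrightarrow> (\<lambda>x. f x - g x) \<in> L2"
  using L2_lincomb[of g f "-1"] by simp

lemma L2_AE_cong:
  assumes "f \<in> L2" "g \<in> borel_measurable borel" "l2_eq f g"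
  shows "g \<in> L2"
proof -
  have "integrable lborel (\<lambda>x. (cmod (g x))\<^sup>2) \<longleftrightarrow> integrable lborel (\<lambda>x. (cmod (f x))\<^sup>2)"
    by (rule integrable_cong_AE) (use assms L2_measurable[OF assms(1)] in \<open>auto simp: l2_eq_def\<close>)
  with assms show ?thesis by (simp add: L2_def)
qed

lemma L2_set_integrable:
  assumes "f \<in> L2"
  shows "set_integrable lborel {x..y::real} f"
  unfolding set_integrable_def
proof (rule Bochner_Integration.integrable_bound)
  show "integrable lborel (\<lambda>s. indicator {x..y} s + (cmod (f s))\<^sup>2)"
    using assms by (intro Bochner_Integration.integrable_add L2_integrable_sq integrable_real_indicator)
      (auto simp: emeasure_lborel_Icc_eq)
  have "norm (indicator {x..y} s *\<^sub>R f s) \<le> norm (indicator {x..y} s + (cmod (f s))\<^sup>2)" for s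
  proof -
    have "cmod (f s) \<le> 1 + (cmod (f s))\<^sup>2"
      using sum_squares_bound[of "cmod (f s)" 1] norm_ge_zero[of "f s"] by (simp del: norm_ge_zero)
    then show ?thesis by (auto simp: indicator_def)
  qed
  then show "AE s in lborel. norm (indicator {x..y} s *\<^sub>R f s) \<le> norm (indicator {x..y} s + (cmod (f s))\<^sup>2)"
    by simp
qed (use L2_measurable[OF assms] in measurable)

lemma L2_indicator_Icc: "(\<lambda>x. indicator {a..b::real} x) \<in> L2"
proof -
  have "(\<lambda>x. (cmod (indicator {a..b} x))\<^sup>2) = (\<lambda>x. indicator {a..b} x :: real)"
    by (auto simp: fun_eq_iff indicator_def)
  moreover have "integrable lborel (\<lambda>x. indicator {a..b} x :: real)"
    by (intro integrable_real_indicator) (auto simp: emeasure_lborel_Icc_eq)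
  ultimately show ?thesis by (simp add: L2_def)
qed

lemma l2_inner_cong:
  assumes "f \<in> L2" "f' \<in> L2" "g \<in> L2" "g' \<in> L2" "l2_eq f f'" "l2_eq g g'"
  shows "l2_inner f g = l2_inner f' g'"
  unfolding l2_inner_def
proof (rule integral_cong_AE)
  show "AE x in lborel. cnj (f x) * g x = cnj (f' x) * g' x"
    using assms(5,6) unfolding l2_eq_def by eventually_elim simp
qed (use assms(1-4)[THEN L2_measurable] in measurable)

lemma l2_eq_refl [simp]: "l2_eq f f"
  by (simp add: l2_eq_def)

lemma l2_eq_sym: "l2_eq f g \<Longrightarrow> l2_eq g f"
  by (auto simp: l2_eq_def elim: eventually_mono)

lemma l2_inner_commute: "l2_inner g f = cnj (l2_inner f g)"
  unfolding l2_inner_def by (subst Bochner_Integration.integral_cnj[symmetric]) (simp add: mult.commute)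

lemma l2_inner_lincomb_right:
  assumes "f \<in> L2" "g \<in> L2" "h \<in> L2"
  shows "l2_inner f (\<lambda>x. c * g x + h x) = c * l2_inner f g + l2_inner f h"
proof -
  have "l2_inner f (\<lambda>x. c * g x + h x) = (LINT x|lborel. c * (cnj (f x) * g x) + cnj (f x) * h x)"
    unfolding l2_inner_def by (intro Bochner_Integration.integral_cong) (auto simp: algebra_simps)
  then show ?thesis
    using assms by (simp add: L2_integrable_inner l2_inner_def)
qed

lemma l2_inner_self: "l2_inner f f = of_real ((l2_norm f)\<^sup>2)"
proof -
  have "l2_inner f f = (LINT x|lborel. of_real ((cmod (f x))\<^sup>2))"
    unfolding l2_inner_def
    by (intro Bochner_Integration.integral_cong) (auto simp: complex_norm_square mult.commute simp del: of_real_power)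
  then show ?thesis by (simp add: l2_norm_def del: of_real_power)
qed

lemma l2_norm_nonneg [simp]: "0 \<le> l2_norm f"
  by (simp add: l2_norm_def)

lemma l2_norm_eq_0:
  assumes "f \<in> L2" "l2_norm f = 0"
  shows "l2_eq f (\<lambda>x. 0)"
proof -
  have "(LINT x|lborel. (cmod (f x))\<^sup>2) = 0"
    using assms by (simp add: l2_norm_def)
  then have "AE x in lborel. (cmod (f x))\<^sup>2 = 0"
    using integral_nonneg_eq_0_iff_AE[OF L2_integrable_sq[OF assms(1)]] by simp
  then show ?thesis by (simp add: l2_eq_def)
qed

lemma l2_inner_Cauchy_Schwarz:
  assumes "f \<in> L2" "g \<in> L2"
  shows "cmod (l2_inner f g) \<le> l2_norm f * l2_norm g"
proof -
  define A where "A = (LINT x|lborel. cmod (f x) * cmod (g x))"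
  have A0: "A \<ge> 0" by (simp add: A_def)
  have "(\<integral>\<^sup>+x. ennreal (cmod (f x)) * ennreal (cmod (g x)) \<partial>lborel)\<^sup>2
      \<le> (\<integral>\<^sup>+x. ennreal (cmod (f x)) ^ 2 \<partial>lborel) * (\<integral>\<^sup>+x. ennreal (cmod (g x)) ^ 2 \<partial>lborel)"
    using assms[THEN L2_measurable] by (intro Cauchy_Schwarz_nn_integral; measurable)
  moreover have "(\<integral>\<^sup>+x. ennreal (cmod (f x)) * ennreal (cmod (g x)) \<partial>lborel) = ennreal A"
    unfolding A_def
    by (subst nn_integral_eq_integral[symmetric])
       (use assms in \<open>auto simp: L2_integrable_norm_mult ennreal_mult\<close>)
  moreover have "(\<integral>\<^sup>+x. ennreal (cmod (h x)) ^ 2 \<partial>lborel) = ennreal ((l2_norm h)\<^sup>2)" if "h \<in> L2" for h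
    using nn_integral_eq_integral[OF L2_integrable_sq[OF that]]
    by (simp add: l2_norm_def ennreal_power)
  ultimately have "ennreal (A\<^sup>2) \<le> ennreal ((l2_norm f * l2_norm g)\<^sup>2)"
    using assms A0 by (simp add: ennreal_power power_mult_distrib flip: ennreal_mult)
  then have "A\<^sup>2 \<le> (l2_norm f * l2_norm g)\<^sup>2" by simp
  then have "A \<le> l2_norm f * l2_norm g"
    by (rule power2_le_imp_le) simp
  moreover have "cmod (l2_inner f g) \<le> A"
    unfolding l2_inner_def A_def
    by (rule order_trans[OF integral_norm_bound]) (simp add: norm_mult)
  ultimately show ?thesis by simp
qed

lemma l2_tendsto_inner:
  assumes "l2_tendsto F g" "\<And>n. F n \<in> L2" "g \<in> L2" "f \<in> L2"
  shows "(\<lambda>n. l2_inner f (F n)) \<longlonglongrightarrow> l2_inner f g"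
proof -
  have a: "(\<lambda>n. l2_norm f * l2_norm (\<lambda>x. F n x - g x)) \<longlonglongrightarrow> 0"
    using tendsto_mult_right_zero[OF assms(1)[unfolded l2_tendsto_def]] .
  have b: "norm (l2_inner f (F n) - l2_inner f g) \<le> l2_norm f * l2_norm (\<lambda>x. F n x - g x)" for n
  proof -
    have "l2_inner f (\<lambda>x. (-1) * g x + F n x) = (-1) * l2_inner f g + l2_inner f (F n)"
      by (rule l2_inner_lincomb_right[OF assms(4,3,2)])
    then have "l2_inner f (F n) - l2_inner f g = l2_inner f (\<lambda>x. F n x - g x)"
      by simp
    then show ?thesis
      using l2_inner_Cauchy_Schwarz[OF assms(4) L2_diff[OF assms(2,3)]] by simp
  qed
  have "(\<lambda>n. l2_inner f (F n) - l2_inner f g) \<longlonglongrightarrow> 0"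
    by (rule Lim_null_comparison[OF always_eventually[OF allI[OF b]] a])
  then show ?thesis by (rule LIM_zero_cancel)
qed

section \<open>The Sobolev space and the operator of the form\<close>

lemma H1_L2: "H1 u u' \<Longrightarrow> u \<in> L2" "H1 u u' \<Longrightarrow> u' \<in> L2"
  by (auto simp: H1_def)

lemma H1_increment: "H1 u u' \<Longrightarrow> x \<le> y \<Longrightarrow> u y - u x = (LINT s:{x..y}|lborel. u' s)"
  by (auto simp: H1_def)

lemma H1_lincomb:
  assumes "H1 u u'" "H1 v v'"
  shows "H1 (\<lambda>x. c * u x + v x) (\<lambda>x. c * u' x + v' x)"
  unfolding H1_def
proof (intro conjI allI impI)
  fix x y :: real assume xy: "x \<le> y"
  have i: "set_integrable lborel {x..y} (\<lambda>s. c * u' s)" "set_integrable lborel {x..y} v'"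
    by (intro L2_set_integrable L2_cmult H1_L2(2)[OF assms(1)] H1_L2(2)[OF assms(2)])+
  have "(LINT s:{x..y}|lborel. c * u' s + v' s) = c * (u y - u x) + (v y - v x)"
    using H1_increment[OF assms(1) xy] H1_increment[OF assms(2) xy] i by simp
  then show "c * u y + v y - (c * u x + v x) = (LINT s:{x..y}|lborel. c * u' s + v' s)"
    by (simp add: algebra_simps)
qed (intro L2_lincomb H1_L2[OF assms(1)] H1_L2[OF assms(2)])+

lemma H1_cnj:
  assumes "H1 u u'"
  shows "H1 (\<lambda>x. cnj (u x)) (\<lambda>x. cnj (u' x))"
  unfolding H1_def
proof (intro conjI allI impI)
  fix x y :: real assume xy: "x \<le> y"
  have "(LINT s:{x..y}|lborel. cnj (u' s)) = cnj (LINT s:{x..y}|lborel. u' s)"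
    unfolding set_lebesgue_integral_def
    by (subst Bochner_Integration.integral_cnj[symmetric]) simp
  then show "cnj (u y) - cnj (u x) = (LINT s:{x..y}|lborel. cnj (u' s))"
    using H1_increment[OF assms xy] by (metis complex_cnj_diff)
qed (intro L2_cnj H1_L2[OF assms])+

lemma delta_form_lincomb_right:
  assumes "H1 v v'" "H1 u u'" "H1 w w'"
  shows "delta_form \<kappa> \<eta> v v' (\<lambda>x. c * u x + w x) (\<lambda>x. c * u' x + w' x)
       = c * delta_form \<kappa> \<eta> v v' u u' + delta_form \<kappa> \<eta> v v' w w'"
  unfolding delta_form_def
  using l2_inner_lincomb_right[OF H1_L2(2)[OF assms(1)] H1_L2(2)[OF assms(2)] H1_L2(2)[OF assms(3)]]
  by (simp add: algebra_simps)

lemma H_delta_L2: "H_delta \<kappa> \<eta> f w \<Longrightarrow> f \<in> L2" "H_delta \<kappa> \<eta> f w \<Longrightarrow> w \<in> L2"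
  by (auto simp: H_delta_def)

lemma H_delta_diff:
  assumes "H_delta \<kappa> \<eta> f w" "H_delta \<kappa> \<eta> g x"
  shows "H_delta \<kappa> \<eta> (\<lambda>s. f s - g s) (\<lambda>s. w s - x s)"
proof -
  from assms obtain u u' v v' where
    u: "l2_eq f u" "H1 u u'" "\<And>y y'. H1 y y' \<Longrightarrow> delta_form \<kappa> \<eta> y y' u u' = l2_inner y w" and
    v: "l2_eq g v" "H1 v v'" "\<And>y y'. H1 y y' \<Longrightarrow> delta_form \<kappa> \<eta> y y' v v' = l2_inner y x"
    unfolding H_delta_def by blast
  have L: "f \<in> L2" "g \<in> L2" "w \<in> L2" "x \<in> L2"
    using assms H_delta_L2 by blast+
  have "H1 (\<lambda>s. (-1) * v s + u s) (\<lambda>s. (-1) * v' s + u' s)"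
    by (intro H1_lincomb u v)
  moreover have "l2_eq (\<lambda>s. f s - g s) (\<lambda>s. (-1) * v s + u s)"
    using u(1) v(1) unfolding l2_eq_def by eventually_elim simp
  moreover have "delta_form \<kappa> \<eta> y y' (\<lambda>s. (-1) * v s + u s) (\<lambda>s. (-1) * v' s + u' s)
      = l2_inner y (\<lambda>s. w s - x s)" if "H1 y y'" for y y'
    using delta_form_lincomb_right[OF that v(2) u(2), of \<kappa> \<eta> "-1"] u(3)[OF that] v(3)[OF that]
      l2_inner_lincomb_right[of y x w "-1"] L H1_L2(1)[OF that] by simp
  ultimately show ?thesis
    unfolding H_delta_def using L by (intro conjI exI[of _ "\<lambda>s. (-1) * v s + u s"] exI[of _ "\<lambda>s. (-1) * v' s + u' s"]) (auto intro: L2_diff)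
qed

lemma H_delta_symmetric:
  assumes "H_delta \<kappa> \<eta> f w"
  shows "Im (l2_inner f w) = 0"
proof -
  from assms obtain u u' where
    u: "l2_eq f u" "H1 u u'" "\<And>y y'. H1 y y' \<Longrightarrow> delta_form \<kappa> \<eta> y y' u u' = l2_inner y w"
    unfolding H_delta_def by blast
  have "l2_inner f w = l2_inner u w"
    by (rule l2_inner_cong) (use u(1) H_delta_L2[OF assms] H1_L2[OF u(2)] in auto)
  also have "\<dots> = delta_form \<kappa> \<eta> u u' u u'"
    using u by simp
  also have "Im \<dots> = 0"
    unfolding delta_form_def l2_inner_self by (simp add: Im_divide_of_real)
  finally show ?thesis .
qed

text \<open>Pair (H - z) u = f with u and use that the inner product of u with H u is real. The
  identity serves twice: f = 0 gives uniqueness of the resolvent, and Im z > 0 gives nonnegativity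
  of the spectral density.\<close>

lemma H_delta_resolvent_Im:
  assumes "H_delta \<kappa> \<eta> u (\<lambda>x. f x + z * u x)" "f \<in> L2"
  shows "Im (l2_inner f u) = Im z * (l2_norm u)\<^sup>2"
proof -
  have uL: "u \<in> L2" using assms H_delta_L2 by blast
  have "l2_inner u (\<lambda>x. z * u x + f x) = z * of_real ((l2_norm u)\<^sup>2) + l2_inner u f"
    using l2_inner_lincomb_right[of u u f z] uL assms by (simp add: l2_inner_self)
  moreover have "Im (l2_inner u (\<lambda>x. z * u x + f x)) = 0"
    using H_delta_symmetric[OF assms(1)] by (simp add: add.commute)
  ultimately show ?thesis
    using l2_inner_commute[of u f] by simp
qed

lemma H_delta_resolvent_unique:
  assumes "H_delta \<kappa> \<eta> u (\<lambda>x. f x + z * u x)" "H_delta \<kappa> \<eta> v (\<lambda>x. f x + z * v x)" "Im z \<noteq> 0"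
  shows "l2_eq u v"
proof -
  have "H_delta \<kappa> \<eta> (\<lambda>x. u x - v x) (\<lambda>x. 0 + z * (u x - v x))"
    using H_delta_diff[OF assms(1,2)] by (simp add: algebra_simps)
  from H_delta_resolvent_Im[OF this L2_zero] assms(3)
  have "l2_norm (\<lambda>x. u x - v x) = 0"
    by (simp add: l2_inner_def)
  then have "l2_eq (\<lambda>x. u x - v x) (\<lambda>x. 0)"
    using assms H_delta_L2 by (intro l2_norm_eq_0 L2_diff) blast+
  then show ?thesis by (simp add: l2_eq_def)
qed

subsection \<open>The Green's function\<close>

lemma exp_halfline_real:
  fixes \<beta> :: real assumes "\<beta> > 0"
  shows "set_integrable lborel {x<..} (\<lambda>s. exp (- \<beta> * s))"
proof -
  have "(\<integral>\<^sup>+s. ennreal (exp (- \<beta> * s)) * indicator {x..} s \<partial>lborel) = ennreal (0 - (- exp (- \<beta> * x) / \<beta>))"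
  proof (rule nn_integral_FTC_atLeast)
    show "((\<lambda>s. - exp (- \<beta> * s) / \<beta>) \<longlongrightarrow> 0) at_top"
      using assms by real_asymp
  qed (use assms in \<open>auto intro!: derivative_eq_intros\<close>)
  also have "(\<integral>\<^sup>+s. ennreal (exp (- \<beta> * s)) * indicator {x..} s \<partial>lborel)
      = (\<integral>\<^sup>+s. ennreal (norm (indicator {x..} s *\<^sub>R exp (- \<beta> * s))) \<partial>lborel)"
    by (intro nn_integral_cong) (auto simp: indicator_def)
  finally have "set_integrable lborel {x..} (\<lambda>s. exp (- \<beta> * s))"
    unfolding set_integrable_def by (intro integrableI_bounded) auto
  then show ?thesis by (rule set_integrable_subset) auto
qed

lemma exp_halfline:
  fixes a :: complex assumes "Re a < 0"
  shows "set_integrable lborel {x<..} (\<lambda>s. exp (a * of_real s))" (is ?A)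
    and "(LINT s:{x<..}|lborel. exp (a * of_real s)) = - exp (a * of_real x) / a" (is ?B)
proof -
  show A: ?A
    unfolding set_integrable_def
  proof (rule Bochner_Integration.integrable_bound)
    show "integrable lborel (\<lambda>s. indicator {x<..} s *\<^sub>R exp (- (- Re a) * s))"
      using exp_halfline_real[of "- Re a" x] assms by (simp add: set_integrable_def)
  qed (auto simp: indicator_def)
  have a0: "a \<noteq> 0" using assms by auto
  have "(LBINT s=ereal x..\<infinity>. exp (a * of_real s)) = 0 - exp (a * of_real x) / a"
  proof (rule interval_integral_FTC_integrable)
    show "((\<lambda>s. exp (a * of_real s) / a) has_vector_derivative exp (a * of_real s)) (at s)" for s
    proof -
      have "((\<lambda>s. exp (a * s) / a) has_field_derivative exp (a * of_real s)) (at (of_real s))"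
        using a0 by (auto intro!: derivative_eq_intros)
      from has_vector_derivative_real_field[OF this] show ?thesis by (simp add: o_def)
    qed
    show "set_integrable lborel (einterval (ereal x) \<infinity>) (\<lambda>s. exp (a * of_real s))"
      using A by (simp add: einterval_def greaterThan_def)
    show "(((\<lambda>s. exp (a * of_real s) / a) \<circ> real_of_ereal) \<longlongrightarrow> exp (a * of_real x) / a) (at_right (ereal x))"
      unfolding ereal_tendsto_simps1(2) using a0 by (intro tendsto_intros) auto
    show "(((\<lambda>s. exp (a * of_real s) / a) \<circ> real_of_ereal) \<longlongrightarrow> 0) (at_left \<infinity>)"
      unfolding ereal_tendsto_simps1
    proof (rule tendsto_norm_zero_cancel)
      have "((\<lambda>s. exp (- (- Re a) * s) / cmod a) \<longlongrightarrow> 0) at_top"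
        using assms a0 by real_asymp
      then show "((\<lambda>s. cmod (exp (a * of_real s) / a)) \<longlongrightarrow> 0) at_top"
        by (simp add: norm_divide)
    qed
  qed (auto intro!: continuous_intros)
  then show ?B by (simp add: interval_integral_to_infinity_eq)
qed

lemma L2_exp_halfline:
  assumes "Re a < 0"
  shows "(\<lambda>s. indicator {x<..} s *\<^sub>R exp (a * of_real s)) \<in> L2"
proof -
  have "integrable lborel (\<lambda>s. indicator {x<..} s *\<^sub>R exp (- (- 2 * Re a) * s))"
    using exp_halfline_real[of "- 2 * Re a" x] assms by (simp add: set_integrable_def)
  also have "(\<lambda>s. indicator {x<..} s *\<^sub>R exp (- (- 2 * Re a) * s))
      = (\<lambda>s. (cmod (indicator {x<..} s *\<^sub>R exp (a * of_real s)))\<^sup>2)"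
    by (auto simp: fun_eq_iff indicator_def mult_exp_exp power2_eq_square)
  finally show ?thesis by (auto simp: L2_def)
qed

lemma L2_affine:
  assumes "f \<in> L2" "c \<noteq> 0"
  shows "(\<lambda>x. f (a + c * x)) \<in> L2"
proof -
  have "(\<lambda>x. f (a + c * x)) \<in> borel_measurable borel"
    using L2_measurable[OF assms(1)] by measurable
  moreover have "integrable lborel (\<lambda>x. (cmod (f (a + c * x)))\<^sup>2)"
    using lborel_integrable_real_affine[OF L2_integrable_sq[OF assms(1)] assms(2)] .
  ultimately show ?thesis by (simp add: L2_def)
qed

lemma H1_shift:
  assumes "H1 u u'"
  shows "H1 (\<lambda>x. u (a + x)) (\<lambda>x. u' (a + x))"
  unfolding H1_def
proof (intro conjI allI impI)
  fix x y :: real assume xy: "x \<le> y"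
  have "(LINT s:{a+x..a+y}|lborel. u' s) = (LINT s:{x..y}|lborel. u' (a + s))"
    unfolding set_lebesgue_integral_def
    by (subst lborel_integral_real_affine[where c = 1 and t = a])
       (auto intro!: Bochner_Integration.integral_cong simp: indicator_def)
  then show "u (a + y) - u (a + x) = (LINT s:{x..y}|lborel. u' (a + s))"
    using H1_increment[OF assms, of "a + x" "a + y"] xy by simp
qed (use L2_affine[OF H1_L2(1)[OF assms], of 1 a] L2_affine[OF H1_L2(2)[OF assms], of 1 a] in auto)

lemma H1_reflect:
  assumes "H1 u u'"
  shows "H1 (\<lambda>x. u (- x)) (\<lambda>x. - u' (- x))"
  unfolding H1_def
proof (intro conjI allI impI)
  fix x y :: real assume xy: "x \<le> y"
  have "(LINT s:{-y..-x}|lborel. u' s) = (LINT s:{x..y}|lborel. u' (- s))"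
    unfolding set_lebesgue_integral_def
    by (subst lborel_integral_real_affine[where c = "-1" and t = 0])
       (auto intro!: Bochner_Integration.integral_cong simp: indicator_def)
  then show "u (- y) - u (- x) = (LINT s:{x..y}|lborel. - u' (- s))"
    using H1_increment[OF assms, of "- y" "- x"] xy
    by (simp add: set_lebesgue_integral_def algebra_simps)
qed (use L2_affine[OF H1_L2(1)[OF assms], of "-1" 0]
       L2_cmult[OF L2_affine[OF H1_L2(2)[OF assms], of "-1" 0], of "-1"] in auto)

text \<open>Writing \<open>exp (a x)\<close> as an integral over \<open>{x<..}\<close> and
  exchanging the order of integration avoids boundary terms at infinity.\<close>

lemma halfline_by_parts:
  fixes a :: complex
  assumes "Re a < 0" "H1 v v'"
  shows "(LINT s:{0<..}|lborel. v' s * exp (a * of_real s))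
       = - v 0 - a * (LINT s:{0<..}|lborel. v s * exp (a * of_real s))"
proof -
  have a0: "a \<noteq> 0" using assms by auto
  have vL: "v \<in> L2" "v' \<in> L2" using H1_L2[OF assms(2)] by auto
  note [measurable] = vL[THEN L2_measurable]
  define F where "F = (\<lambda>(x, s). (if 0 < x \<and> x < s then v' x * exp (a * of_real s) else 0))"
  have F_s: "(\<lambda>s. F (x, s)) = (\<lambda>s. (if 0 < x then v' x else 0) * (indicator {x<..} s *\<^sub>R exp (a * of_real s)))" for x
    by (auto simp: F_def fun_eq_iff indicator_def)
  have i_exp: "integrable lborel (\<lambda>s. indicator {x<..} s *\<^sub>R exp (a * of_real s))" for x
    using exp_halfline(1)[OF assms(1)] by (simp add: set_integrable_def)
  have i1: "integrable lborel (\<lambda>s. F (x, s))" for x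
    unfolding F_s by (intro integrable_mult_right i_exp)
  have "integrable lborel (\<lambda>x. v' x * (indicator {0<..} x *\<^sub>R exp (a * of_real x)))"
    by (intro L2_integrable_mult vL L2_exp_halfline assms)
  then have "integrable lborel (\<lambda>x. norm (v' x * (indicator {0<..} x *\<^sub>R exp (a * of_real x))) / (- Re a))"
    by (intro integrable_divide integrable_norm)
  also have "(\<lambda>x. norm (v' x * (indicator {0<..} x *\<^sub>R exp (a * of_real x))) / (- Re a))
      = (\<lambda>x. LINT s|lborel. norm (F (x, s)))"
  proof
    fix x
    have "(\<lambda>s. norm (F (x, s))) = (\<lambda>s. norm (if 0 < x then v' x else 0) * (indicator {x<..} s *\<^sub>R exp (Re a * s)))"
      by (auto simp: fun_eq_iff F_def norm_mult indicator_def)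
    then have "(LINT s|lborel. norm (F (x, s)))
        = norm (if 0 < x then v' x else 0) * (LINT s|lborel. indicator {x<..} s *\<^sub>R exp (Re a * s))"
      by simp
    also have "(LINT s|lborel. indicator {x<..} s *\<^sub>R exp (Re a * s)) = - exp (Re a * x) / Re a"
    proof -
      have "complex_of_real (LINT s|lborel. indicator {x<..} s *\<^sub>R exp (Re a * s))
          = (LINT s:{x<..}|lborel. exp (of_real (Re a) * of_real s))"
      proof -
        have "(\<lambda>s. indicator {x<..} s *\<^sub>R exp (of_real (Re a) * of_real s))
            = (\<lambda>s. complex_of_real (indicator {x<..} s *\<^sub>R exp (Re a * s)))"
          by (auto simp: fun_eq_iff indicator_def exp_of_real simp flip: of_real_mult)
        then show ?thesis unfolding set_lebesgue_integral_def by (simp only: integral_complex_of_real)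
      qed
      also have "\<dots> = - exp (of_real (Re a) * of_real x) / of_real (Re a)"
        using exp_halfline(2)[of "of_real (Re a)" x] assms by simp
      also have "\<dots> = of_real (- exp (Re a * x) / Re a)"
        by (simp add: exp_of_real flip: of_real_mult)
      finally show ?thesis using of_real_eq_iff by blast
    qed
    finally show "norm (v' x * (indicator {0<..} x *\<^sub>R exp (a * of_real x))) / (- Re a) = (LINT s|lborel. norm (F (x, s)))"
      by (auto simp: norm_mult indicator_def)
  qed
  finally have i2: "integrable lborel (\<lambda>x. LINT s|lborel. norm (F (x, s)))" .
  have "F \<in> borel_measurable (borel \<Otimes>\<^sub>M borel)"
    unfolding F_def by measurable
  then have "F \<in> borel_measurable (lborel \<Otimes>\<^sub>M lborel)"
    by (simp add: measurable_def space_pair_measure sets_pair_measure_cong[OF sets_lborel sets_lborel])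
  then have iF: "integrable (lborel \<Otimes>\<^sub>M lborel) F"
    using i1 i2 by (intro lborel_pair.Fubini_integrable) auto
  have "(LINT x|lborel. LINT s|lborel. F (x, s)) = (LINT s|lborel. LINT x|lborel. F (x, s))"
    using lborel_pair.Fubini_integral[of "\<lambda>x s. F (x, s)"] iF by simp
  also have "(\<lambda>x. LINT s|lborel. F (x, s)) = (\<lambda>x. (- 1 / a) * (indicator {0<..} x *\<^sub>R (v' x * exp (a * of_real x))))"
  proof
    fix x
    have "(LINT s|lborel. F (x, s)) = (if 0 < x then v' x else 0) * (LINT s:{x<..}|lborel. exp (a * of_real s))"
      unfolding F_s set_lebesgue_integral_def by (rule integral_mult_right_zero)
    then show "(LINT s|lborel. F (x, s)) = (- 1 / a) * (indicator {0<..} x *\<^sub>R (v' x * exp (a * of_real x)))"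
      unfolding exp_halfline(2)[OF assms(1)] by (auto simp: indicator_def)
  qed
  also have "(\<lambda>s. LINT x|lborel. F (x, s)) = (\<lambda>s. indicator {0<..} s *\<^sub>R (v s * exp (a * of_real s))
      - v 0 * (indicator {0<..} s *\<^sub>R exp (a * of_real s)))"
  proof
    fix s
    show "(LINT x|lborel. F (x, s)) = indicator {0<..} s *\<^sub>R (v s * exp (a * of_real s))
      - v 0 * (indicator {0<..} s *\<^sub>R exp (a * of_real s))"
    proof (cases "s > 0")
      case True
      have "(LINT x|lborel. F (x, s)) = (LINT x|lborel. (indicator {0..s} x *\<^sub>R v' x) * exp (a * of_real s))"
      proof (rule integral_cong_AE)
        show "AE x in lborel. F (x, s) = (indicator {0..s} x *\<^sub>R v' x) * exp (a * of_real s)"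
          using AE_lborel_singleton[of 0] AE_lborel_singleton[of s]
          by eventually_elim (auto simp: F_def indicator_def)
        show "(\<lambda>x. F (x, s)) \<in> borel_measurable lborel"
          unfolding F_def by simp
      qed simp
      also have "\<dots> = (LINT x:{0..s}|lborel. v' x) * exp (a * of_real s)"
        unfolding set_lebesgue_integral_def by (rule integral_mult_left_zero)
      also have "\<dots> = (v s - v 0) * exp (a * of_real s)"
        using H1_increment[OF assms(2), of 0 s] True by simp
      finally show ?thesis using True by (simp add: algebra_simps)
    next
      case False
      then have "(\<lambda>x. F (x, s)) = (\<lambda>x. 0)" by (auto simp: F_def fun_eq_iff)
      with False show ?thesis by simp
    qed
  qed
  also have "(LINT x|lborel. (- 1 / a) * (indicator {0<..} x *\<^sub>R (v' x * exp (a * of_real x))))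
     = (- 1 / a) * (LINT s:{0<..}|lborel. v' s * exp (a * of_real s))"
    unfolding set_lebesgue_integral_def by (rule integral_mult_right_zero)
  also have "(LINT s|lborel. indicator {0<..} s *\<^sub>R (v s * exp (a * of_real s))
      - v 0 * (indicator {0<..} s *\<^sub>R exp (a * of_real s)))
      = (LINT s:{0<..}|lborel. v s * exp (a * of_real s)) - v 0 * (LINT s:{0<..}|lborel. exp (a * of_real s))"
    unfolding set_lebesgue_integral_def
  proof (subst Bochner_Integration.integral_diff)
    have "integrable lborel (\<lambda>s. v s * (indicator {0<..} s *\<^sub>R exp (a * of_real s)))"
      by (intro L2_integrable_mult vL L2_exp_halfline assms)
    then show "integrable lborel (\<lambda>s. indicator {0<..} s *\<^sub>R (v s * exp (a * of_real s)))"
      by simp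
    show "integrable lborel (\<lambda>s. v 0 * (indicator {0<..} s *\<^sub>R exp (a * of_real s)))"
      by (intro integrable_mult_right i_exp)
  qed (simp only: integral_mult_right_zero)
  finally have eq: "(- 1 / a) * (LINT s:{0<..}|lborel. v' s * exp (a * of_real s))
      = (LINT s:{0<..}|lborel. v s * exp (a * of_real s)) - v 0 * (- 1 / a)"
    unfolding exp_halfline(2)[OF assms(1)] by simp
  have "(LINT s:{0<..}|lborel. v' s * exp (a * of_real s))
      = - a * ((- 1 / a) * (LINT s:{0<..}|lborel. v' s * exp (a * of_real s)))"
    using a0 by simp
  also have "\<dots> = - v 0 - a * (LINT s:{0<..}|lborel. v s * exp (a * of_real s))"
    unfolding eq using a0 by (simp add: algebra_simps)
  finally show ?thesis .
qed

lemma integral_split_at_0: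
  fixes h :: "real \<Rightarrow> complex"
  assumes "integrable lborel h"
  shows "(LINT x|lborel. h x) = (LINT x:{0<..}|lborel. h x) + (LINT x:{0<..}|lborel. h (- x))"
proof -
  have i: "integrable lborel (\<lambda>x. indicator {0<..} x *\<^sub>R h x)" "integrable lborel (\<lambda>x. indicator {..<0} x *\<^sub>R h x)"
    using assms by (intro integrable_mult_indicator; simp)+
  have "(LINT x|lborel. h x) = (LINT x|lborel. indicator {0<..} x *\<^sub>R h x + indicator {..<0} x *\<^sub>R h x)"
  proof (rule integral_cong_AE)
    show "AE x in lborel. h x = indicator {0<..} x *\<^sub>R h x + indicator {..<0} x *\<^sub>R h x"
      using AE_lborel_singleton[of "0::real"] by eventually_elim (auto simp: indicator_def)
  qed (use assms i in \<open>auto intro: borel_measurable_integrable\<close>)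
  also have "\<dots> = (LINT x:{0<..}|lborel. h x) + (LINT x|lborel. indicator {..<0} x *\<^sub>R h x)"
    using i by (simp add: set_lebesgue_integral_def)
  also have "(LINT x|lborel. indicator {..<0} x *\<^sub>R h x) = (LINT x:{0<..}|lborel. h (- x))"
    unfolding set_lebesgue_integral_def
    by (subst lborel_integral_real_affine[where c = "-1" and t = 0])
       (auto intro!: Bochner_Integration.integral_cong simp: indicator_def)
  finally show ?thesis .
qed

section \<open>The free resolvent kernel as a fundamental solution\<close>

definition free_green :: "complex \<Rightarrow> real \<Rightarrow> complex" where
  "free_green k x = \<i> / (2 * k) * exp (\<i> * k * of_real \<bar>x\<bar>)"

definition free_green' :: "complex \<Rightarrow> real \<Rightarrow> complex" where
  "free_green' k x = (if 0 \<le> x then - 1 / 2 else 1 / 2) * exp (\<i> * k * of_real \<bar>x\<bar>)"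

text \<open>Common profile of \<open>free_green k\<close> and \<open>free_green' k\<close>: with
  \<beta> = Im k the modulus of either is a constant times this function.\<close>

definition exp_kernel :: "real \<Rightarrow> real \<Rightarrow> real" where
  "exp_kernel \<beta> x = exp (- \<beta> * \<bar>x\<bar>)"

lemma exp_kernel_pos [simp]: "0 < exp_kernel \<beta> x" "0 \<le> exp_kernel \<beta> x"
  by (auto simp: exp_kernel_def)

lemma exp_kernel_measurable [measurable]: "exp_kernel \<beta> \<in> borel_measurable borel"
  unfolding exp_kernel_def by measurable

lemma continuous_on_free_green [continuous_intros]:
  "continuous_on S f \<Longrightarrow> continuous_on S (\<lambda>x. free_green k (f x))"
  unfolding free_green_def divide_inverse by (intro continuous_intros)

lemma free_green_measurable [measurable]: "free_green k \<in> borel_measurable borel"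
  by (intro borel_measurable_continuous_onI continuous_on_free_green continuous_on_id)

lemma free_green'_measurable [measurable]: "free_green' k \<in> borel_measurable borel"
  unfolding free_green'_def by measurable

lemma norm_free_green: "cmod (free_green k x) = 1 / (2 * cmod k) * exp_kernel (Im k) x"
  by (simp add: free_green_def exp_kernel_def norm_mult norm_divide)

lemma norm_free_green': "cmod (free_green' k x) = 1 / 2 * exp_kernel (Im k) x"
  by (simp add: free_green'_def exp_kernel_def norm_mult)

lemma exp_kernel_integrable:
  assumes "\<beta> > 0"
  shows "integrable lborel (\<lambda>x. exp_kernel \<beta> (x - a))"
proof -
  have 1: "integrable lborel (\<lambda>x. indicator {0<..} x *\<^sub>R exp (- \<beta> * x))"
    using exp_halfline_real[OF assms, of 0] by (simp add: set_integrable_def)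
  then have 2: "integrable lborel (\<lambda>x. indicator {0<..} (0 + (-1) * x) *\<^sub>R exp (- \<beta> * (0 + (-1) * x)))"
    by (rule lborel_integrable_real_affine) simp
  have "integrable lborel (\<lambda>x. indicator {0<..} x *\<^sub>R exp (- \<beta> * x) + indicator {0<..} (0 + (-1) * x) *\<^sub>R exp (- \<beta> * (0 + (-1) * x)))"
    using 1 2 by simp
  also have "?this \<longleftrightarrow> integrable lborel (exp_kernel \<beta>)"
  proof (rule integrable_cong_AE)
    show "AE x in lborel. indicator {0<..} x *\<^sub>R exp (- \<beta> * x) + indicator {0<..} (0 + (-1) * x) *\<^sub>R exp (- \<beta> * (0 + (-1) * x)) = exp_kernel \<beta> x"
      using AE_lborel_singleton[of "0::real"] by eventually_elim (auto simp: exp_kernel_def indicator_def)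
  qed auto
  finally have "integrable lborel (exp_kernel \<beta>)" .
  from lborel_integrable_real_affine[OF this, of 1 "- a"] show ?thesis by simp
qed

lemma exp_kernel_sq: "(exp_kernel \<beta> x)\<^sup>2 = exp_kernel (2 * \<beta>) x"
  by (simp add: exp_kernel_def power2_eq_square mult_exp_exp)

lemma L2_exp_kernel:
  assumes "\<beta> > 0" "f \<in> borel_measurable borel" "\<And>x. cmod (f x) \<le> C * exp_kernel \<beta> (x - a)"
  shows "f \<in> L2"
proof -
  have "integrable lborel (\<lambda>x. (cmod (f x))\<^sup>2)"
  proof (rule Bochner_Integration.integrable_bound)
    show "integrable lborel (\<lambda>x. C\<^sup>2 * exp_kernel (2 * \<beta>) (x - a))"
      using assms(1) by (intro integrable_mult_right exp_kernel_integrable) auto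
    have "(cmod (f x))\<^sup>2 \<le> C\<^sup>2 * exp_kernel (2 * \<beta>) (x - a)" for x
      using power_mono[OF assms(3), of x 2] by (simp add: power_mult_distrib exp_kernel_sq)
    then show "AE x in lborel. norm ((cmod (f x))\<^sup>2) \<le> norm (C\<^sup>2 * exp_kernel (2 * \<beta>) (x - a))"
      by (auto simp: abs_mult)
  qed (use assms(2) in measurable)
  with assms(2) show ?thesis by (simp add: L2_def)
qed

lemma L2_free_green:
  assumes "Im k > 0"
  shows "(\<lambda>x. free_green k (x - a)) \<in> L2" "(\<lambda>x. free_green' k (x - a)) \<in> L2"
  by (rule L2_exp_kernel[OF assms, where C = "1 / (2 * cmod k)" and a = a]; simp add: norm_free_green)
     (rule L2_exp_kernel[OF assms, where C = "1 / 2" and a = a]; simp add: norm_free_green')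

lemma H1_free_green:
  assumes "Im k > 0"
  shows "H1 (\<lambda>x. free_green k (x - a)) (\<lambda>x. free_green' k (x - a))"
  unfolding H1_def
proof (intro conjI allI impI L2_free_green assms)
  fix x y :: real assume xy: "x \<le> y"
  have k0: "k \<noteq> 0" using assms by auto
  \<comment> \<open>The kink of \<open>free_green\<close> at \<open>a\<close> is the exceptional
    point of the strong fundamental theorem; on each side of it the kernel is a single
    exponential.\<close>
  have "((\<lambda>s. free_green' k (s - a)) has_integral free_green k (y - a) - free_green k (x - a)) {x..y}"
  proof (rule fundamental_theorem_of_calculus_strong[where S = "{a}"])
    show "((\<lambda>s. free_green k (s - a)) has_vector_derivative free_green' k (s - a)) (at s)"
      if "s \<in> {x..y} - {a}" for s
    proof (cases "s > a")
      case True
      have "((\<lambda>s. \<i> / (2 * k) * exp (\<i> * k * (s - a))) has_field_derivative free_green' k (s - a)) (at (of_real s))"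
        using True k0 by (auto intro!: derivative_eq_intros simp: free_green'_def)
      from has_vector_derivative_real_field[OF this]
      show ?thesis
        by (rule has_vector_derivative_transform_within_open[where S = "{a<..}"])
           (use True in \<open>auto simp: free_green_def\<close>)
    next
      case False
      then have s: "s < a" using that by auto
      have "((\<lambda>s. \<i> / (2 * k) * exp (\<i> * k * (a - s))) has_field_derivative free_green' k (s - a)) (at (of_real s))"
        using s k0 by (auto intro!: derivative_eq_intros simp: free_green'_def)
      from has_vector_derivative_real_field[OF this]
      show ?thesis
        by (rule has_vector_derivative_transform_within_open[where S = "{..<a}"])
           (use s in \<open>auto simp: free_green_def\<close>)
    qed
  qed (use xy in \<open>auto intro!: continuous_intros\<close>)
  moreover have "set_integrable lborel {x..y} (\<lambda>s. free_green' k (s - a))"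
    by (intro L2_set_integrable L2_free_green assms)
  ultimately show "free_green k (y - a) - free_green k (x - a) = (LINT s:{x..y}|lborel. free_green' k (s - a))"
    using set_borel_integral_eq_integral(2) integral_unique by metis
qed

text \<open>Shift \<open>a\<close> to 0 and integrate by parts on each half line: each side
  contributes \<open>v a / 2\<close> at the origin, and the remaining integrals cancel because k^2
  times i/(2k) is ik/2. This is the weak form of (- d^2/dx^2 - k^2) G = delta at \<open>a\<close>,
  with H^1 functions as test functions.\<close>

lemma free_green_fundamental:
  assumes "Im k > 0" "H1 v v'"
  shows "(LINT x|lborel. v' x * free_green' k (x - a)) - k\<^sup>2 * (LINT x|lborel. v x * free_green k (x - a)) = v a"
proof -
  have k0: "k \<noteq> 0" using assms by auto
  define V where "V = (\<lambda>x. v (a + x))"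
  define V' where "V' = (\<lambda>x. v' (a + x))"
  have V: "H1 V V'" unfolding V_def V'_def by (rule H1_shift[OF assms(2)])
  have Vm: "H1 (\<lambda>x. V (- x)) (\<lambda>x. - V' (- x))" by (rule H1_reflect[OF V])
  have a: "Re (\<i> * k) < 0" using assms by simp
  define e where "e = (\<lambda>x::real. exp (\<i> * k * of_real x))"
  define P where "P = (LINT s:{0<..}|lborel. V s * e s)"
  define Q where "Q = (LINT s:{0<..}|lborel. V (- s) * e s)"
  have P': "(LINT s:{0<..}|lborel. V' s * e s) = - V 0 - \<i> * k * P"
    using halfline_by_parts[OF a V] by (simp add: P_def e_def)
  have Q': "(LINT s:{0<..}|lborel. - V' (- s) * e s) = - V 0 - \<i> * k * Q"
    using halfline_by_parts[OF a Vm] by (simp add: Q_def e_def)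
  have g0: "free_green' k \<in> L2" "free_green k \<in> L2" using L2_free_green[OF assms(1), of 0] by auto
  have "(LINT x|lborel. v' x * free_green' k (x - a)) = (LINT x|lborel. V' x * free_green' k x)"
    by (subst lborel_integral_real_affine[where c = 1 and t = a]) (auto simp: V'_def)
  also have "\<dots> = (LINT x:{0<..}|lborel. V' x * free_green' k x) + (LINT x:{0<..}|lborel. V' (- x) * free_green' k (- x))"
    by (intro integral_split_at_0 L2_integrable_mult H1_L2[OF V] g0)
  also have "(LINT x:{0<..}|lborel. V' x * free_green' k x) = (LINT x:{0<..}|lborel. (-1/2) * (V' x * e x))"
    by (intro set_lebesgue_integral_cong) (auto simp: free_green'_def e_def)
  also have "(LINT x:{0<..}|lborel. V' (- x) * free_green' k (- x)) = (LINT x:{0<..}|lborel. (-1/2) * (- V' (- x) * e x))"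
    by (intro set_lebesgue_integral_cong) (auto simp: free_green'_def e_def)
  finally have 1: "(LINT x|lborel. v' x * free_green' k (x - a)) = (-1/2) * (- V 0 - \<i> * k * P) + (-1/2) * (- V 0 - \<i> * k * Q)"
    by (simp only: set_integral_mult_right P' Q')
  have "(LINT x|lborel. v x * free_green k (x - a)) = (LINT x|lborel. V x * free_green k x)"
    by (subst lborel_integral_real_affine[where c = 1 and t = a]) (auto simp: V_def)
  also have "\<dots> = (LINT x:{0<..}|lborel. V x * free_green k x) + (LINT x:{0<..}|lborel. V (- x) * free_green k (- x))"
    by (intro integral_split_at_0 L2_integrable_mult H1_L2[OF V] g0)
  also have "(LINT x:{0<..}|lborel. V x * free_green k x) = (LINT x:{0<..}|lborel. (\<i> / (2 * k)) * (V x * e x))"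
    by (intro set_lebesgue_integral_cong) (auto simp: free_green_def e_def)
  also have "(LINT x:{0<..}|lborel. V (- x) * free_green k (- x)) = (LINT x:{0<..}|lborel. (\<i> / (2 * k)) * (V (- x) * e x))"
    by (intro set_lebesgue_integral_cong) (auto simp: free_green_def e_def)
  finally have 2: "(LINT x|lborel. v x * free_green k (x - a)) = (\<i> / (2 * k)) * P + (\<i> / (2 * k)) * Q"
    by (simp only: set_integral_mult_right P_def Q_def)
  have "k\<^sup>2 * (\<i> / (2 * k)) = \<i> * k / 2"
    using k0 by (simp add: power2_eq_square)
  then have "k\<^sup>2 * ((\<i> / (2 * k)) * P + (\<i> / (2 * k)) * Q) = \<i> * k / 2 * P + \<i> * k / 2 * Q"
    by (metis (no_types, lifting) distrib_left mult.assoc)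
  then show ?thesis unfolding 1 2 by (simp add: V_def algebra_simps)
qed

section \<open>Convolution with exponentially bounded kernels\<close>

lemma exp_kernel_integral:
  assumes "\<beta> > 0"
  shows "(\<integral>\<^sup>+x. ennreal (exp_kernel \<beta> (x - a)) \<partial>lborel) = ennreal (LINT x|lborel. exp_kernel \<beta> x)"
proof -
  have "(\<integral>\<^sup>+x. ennreal (exp_kernel \<beta> (x - a)) \<partial>lborel) = ennreal (LINT x|lborel. exp_kernel \<beta> (x - a))"
    by (rule nn_integral_eq_integral[OF exp_kernel_integrable[OF assms]]) simp
  also have "(LINT x|lborel. exp_kernel \<beta> (x - a)) = (LINT x|lborel. exp_kernel \<beta> x)"
    by (subst lborel_integral_real_affine[where c = 1 and t = a]) auto
  finally show ?thesis .
qed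

lemma exp_kernel_minus: "exp_kernel \<beta> (x - y) = exp_kernel \<beta> (y - x)"
  by (simp add: exp_kernel_def abs_minus_commute)

lemma borel_lborel_pair: "f \<in> borel_measurable (borel \<Otimes>\<^sub>M borel) \<Longrightarrow> f \<in> borel_measurable (lborel \<Otimes>\<^sub>M lborel)"
  by (simp add: measurable_def space_pair_measure sets_pair_measure_cong[OF sets_lborel sets_lborel])

text \<open>Tonelli: integrating over x first, the kernel gives a finite constant independent of
  y.\<close>

lemma exp_kernel_L2_bound:
  assumes "\<beta> > 0" "f \<in> L2"
  shows "(\<integral>\<^sup>+x. (\<integral>\<^sup>+y. ennreal (exp_kernel \<beta> (x - y)) * ennreal ((cmod (f y))\<^sup>2) \<partial>lborel) \<partial>lborel) < \<infinity>"
proof -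
  note [measurable] = L2_measurable[OF assms(2)]
  have "(\<integral>\<^sup>+x. (\<integral>\<^sup>+y. ennreal (exp_kernel \<beta> (x - y)) * ennreal ((cmod (f y))\<^sup>2) \<partial>lborel) \<partial>lborel)
      = (\<integral>\<^sup>+y. (\<integral>\<^sup>+x. ennreal (exp_kernel \<beta> (x - y)) * ennreal ((cmod (f y))\<^sup>2) \<partial>lborel) \<partial>lborel)"
    by (intro lborel_pair.Fubini'[symmetric] borel_lborel_pair) measurable
  also have "\<dots> = (\<integral>\<^sup>+y. ennreal (LINT x|lborel. exp_kernel \<beta> x) * ennreal ((cmod (f y))\<^sup>2) \<partial>lborel)"
    by (intro nn_integral_cong) (simp add: nn_integral_multc exp_kernel_integral[OF assms(1)])
  also have "\<dots> = ennreal (LINT x|lborel. exp_kernel \<beta> x) * (\<integral>\<^sup>+y. ennreal ((cmod (f y))\<^sup>2) \<partial>lborel)"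
    by (intro nn_integral_cmult) measurable
  also have "\<dots> < \<infinity>"
    using nn_integral_eq_integral[OF L2_integrable_sq[OF assms(2)]] by (simp add: ennreal_mult_less_top)
  finally show ?thesis .
qed

text \<open>Isolates what the kernel and its derivative share, so that boundedness on L^2 and the
  exchange of integrals are proved once and used for both.\<close>

locale exp_bounded_kernel =
  fixes K :: "real \<Rightarrow> complex" and C \<beta> :: real
  assumes meas [measurable]: "K \<in> borel_measurable borel"
    and beta: "\<beta> > 0"
    and bound: "\<And>x. cmod (K x) \<le> C * exp_kernel \<beta> x"
begin

lemma C_nonneg: "0 \<le> C"
  using order_trans[OF norm_ge_zero bound[of 0]] by (simp add: exp_kernel_def)

lemma L2_kernel: "(\<lambda>y. K (x - y)) \<in> L2"
  by (rule L2_exp_kernel[OF beta, where C = C and a = x])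
     (use bound in \<open>auto simp: exp_kernel_minus[of _ _ x]\<close>)

text \<open>The product of |v x| and |f y| is at most the sum of their squares, and each square
  against the exponential profile is finite by Tonelli, once with the roles of x and y
  interchanged.\<close>

lemma integrable_pairing:
  assumes "v \<in> L2" "f \<in> L2"
  shows "integrable (lborel \<Otimes>\<^sub>M lborel) (\<lambda>(x, y). v x * K (x - y) * f y)"
proof (rule integrableI_bounded)
  note [measurable] = L2_measurable[OF assms(1)] L2_measurable[OF assms(2)]
  show m: "(\<lambda>(x, y). v x * K (x - y) * f y) \<in> borel_measurable (lborel \<Otimes>\<^sub>M lborel)"
    by (intro borel_lborel_pair) measurable
  let ?k = "\<lambda>x y. ennreal (exp_kernel \<beta> (x - y))"
  have "ennreal (norm (v x * K (x - y) * f y))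
      \<le> ennreal C * (?k y x * ennreal ((cmod (v x))\<^sup>2) + ?k x y * ennreal ((cmod (f y))\<^sup>2))" for x y
  proof -
    have "cmod (v x) * cmod (f y) \<le> (cmod (v x))\<^sup>2 + (cmod (f y))\<^sup>2"
    proof -
      have "0 \<le> cmod (v x) * cmod (f y)" by simp
      then show ?thesis using sum_squares_bound[of "cmod (v x)" "cmod (f y)"] by linarith
    qed
    then have "cmod (K (x - y)) * (cmod (v x) * cmod (f y)) \<le> (C * exp_kernel \<beta> (x - y)) * ((cmod (v x))\<^sup>2 + (cmod (f y))\<^sup>2)"
      by (intro mult_mono bound) (use C_nonneg in auto)
    then have "norm (v x * K (x - y) * f y) \<le> C * (exp_kernel \<beta> (y - x) * (cmod (v x))\<^sup>2 + exp_kernel \<beta> (x - y) * (cmod (f y))\<^sup>2)"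
      by (simp add: norm_mult algebra_simps exp_kernel_minus[of _ y x])
    then have "ennreal (norm (v x * K (x - y) * f y)) \<le> ennreal (C * (exp_kernel \<beta> (y - x) * (cmod (v x))\<^sup>2 + exp_kernel \<beta> (x - y) * (cmod (f y))\<^sup>2))"
      by (rule ennreal_leI)
    also have "\<dots> = ennreal C * (?k y x * ennreal ((cmod (v x))\<^sup>2) + ?k x y * ennreal ((cmod (f y))\<^sup>2))"
      using C_nonneg by (simp add: ennreal_mult ennreal_plus)
    finally show ?thesis .
  qed
  then have "(\<integral>\<^sup>+p. ennreal (norm (case p of (x, y) \<Rightarrow> v x * K (x - y) * f y)) \<partial>(lborel \<Otimes>\<^sub>M lborel))
      \<le> (\<integral>\<^sup>+p. (case p of (x, y) \<Rightarrow> ennreal C * (?k y x * ennreal ((cmod (v x))\<^sup>2) + ?k x y * ennreal ((cmod (f y))\<^sup>2))) \<partial>(lborel \<Otimes>\<^sub>M lborel))"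
    by (intro nn_integral_mono) (auto split: prod.split)
  also have "\<dots> = (\<integral>\<^sup>+x. (\<integral>\<^sup>+y. ennreal C * (?k y x * ennreal ((cmod (v x))\<^sup>2) + ?k x y * ennreal ((cmod (f y))\<^sup>2)) \<partial>lborel) \<partial>lborel)"
    by (subst lborel.nn_integral_fst[symmetric]) (auto intro!: borel_lborel_pair)
  also have "\<dots> = (\<integral>\<^sup>+x. ennreal C * ((\<integral>\<^sup>+y. ?k y x * ennreal ((cmod (v x))\<^sup>2) \<partial>lborel) + (\<integral>\<^sup>+y. ?k x y * ennreal ((cmod (f y))\<^sup>2) \<partial>lborel)) \<partial>lborel)"
    by (simp add: nn_integral_cmult nn_integral_add)
  also have "\<dots> = ennreal C * ((\<integral>\<^sup>+x. (\<integral>\<^sup>+y. ?k y x * ennreal ((cmod (v x))\<^sup>2) \<partial>lborel) \<partial>lborel)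
      + (\<integral>\<^sup>+x. (\<integral>\<^sup>+y. ?k x y * ennreal ((cmod (f y))\<^sup>2) \<partial>lborel) \<partial>lborel))"
    by (subst nn_integral_cmult nn_integral_add; measurable)+
  also have "(\<integral>\<^sup>+x. (\<integral>\<^sup>+y. ?k y x * ennreal ((cmod (v x))\<^sup>2) \<partial>lborel) \<partial>lborel)
      = (\<integral>\<^sup>+y. (\<integral>\<^sup>+x. ?k y x * ennreal ((cmod (v x))\<^sup>2) \<partial>lborel) \<partial>lborel)"
    by (intro lborel_pair.Fubini'[symmetric] borel_lborel_pair) measurable
  finally show "(\<integral>\<^sup>+p. ennreal (norm (case p of (x, y) \<Rightarrow> v x * K (x - y) * f y)) \<partial>(lborel \<Otimes>\<^sub>M lborel)) < \<infinity>"
    using exp_kernel_L2_bound[OF beta assms(1)] exp_kernel_L2_bound[OF beta assms(2)]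
    by (auto elim!: order_le_less_trans simp: ennreal_mult_less_top ennreal_add_less_top)
qed

definition conv :: "(real \<Rightarrow> complex) \<Rightarrow> real \<Rightarrow> complex" where
  "conv f x = (LINT y|lborel. K (x - y) * f y)"

lemma integrable_conv: "f \<in> L2 \<Longrightarrow> integrable lborel (\<lambda>y. K (x - y) * f y)"
  by (intro L2_integrable_mult L2_kernel)

text \<open>Young's inequality by hand: the exponential profile is split into two equal factors of
  rate \<beta>/2, and Cauchy-Schwarz puts one of them into a constant and leaves the other with
  f.\<close>

lemma conv_L2:
  assumes "f \<in> L2"
  shows "conv f \<in> L2"
proof -
  note [measurable] = L2_measurable[OF assms]
  have m: "conv f \<in> borel_measurable borel"
    unfolding conv_def by measurable
  define c where "c = (LINT x|lborel. exp_kernel \<beta> x)"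
  let ?k = "\<lambda>x y. ennreal (exp_kernel \<beta> (x - y))"
  let ?h = "\<lambda>x y. ennreal (exp_kernel (\<beta> / 2) (x - y))"
  have hh: "?h x y ^ 2 = ?k x y" for x y
    by (simp add: ennreal_power exp_kernel_sq)
  have "ennreal ((cmod (conv f x))\<^sup>2) \<le> ennreal (C\<^sup>2) * (ennreal c * (\<integral>\<^sup>+y. ?k x y * ennreal ((cmod (f y))\<^sup>2) \<partial>lborel))" for x
  proof -
    have "ennreal (cmod (conv f x)) \<le> (\<integral>\<^sup>+y. ennreal (cmod (K (x - y) * f y)) \<partial>lborel)"
      unfolding conv_def by (intro integral_norm_bound_ennreal integrable_conv assms)
    also have "\<dots> \<le> (\<integral>\<^sup>+y. ennreal C * (?h x y * (?h x y * ennreal (cmod (f y)))) \<partial>lborel)"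
    proof (intro nn_integral_mono)
      fix y
      have "cmod (K (x - y) * f y) \<le> (C * exp_kernel \<beta> (x - y)) * cmod (f y)"
        unfolding norm_mult by (intro mult_right_mono bound) auto
      also have "\<dots> = C * (exp_kernel (\<beta>/2) (x - y) * (exp_kernel (\<beta>/2) (x - y) * cmod (f y)))"
        using exp_kernel_sq[of "\<beta>/2" "x - y"] by (simp add: power2_eq_square)
      finally have "ennreal (cmod (K (x - y) * f y)) \<le> ennreal (C * (exp_kernel (\<beta>/2) (x - y) * (exp_kernel (\<beta>/2) (x - y) * cmod (f y))))"
        by (rule ennreal_leI)
      then show "ennreal (cmod (K (x - y) * f y)) \<le> ennreal C * (?h x y * (?h x y * ennreal (cmod (f y))))"
        using C_nonneg by (simp add: ennreal_mult)
    qed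
    also have "\<dots> = ennreal C * (\<integral>\<^sup>+y. ?h x y * (?h x y * ennreal (cmod (f y))) \<partial>lborel)"
      by (intro nn_integral_cmult) measurable
    finally have "ennreal (cmod (conv f x))^2 \<le> (ennreal C * (\<integral>\<^sup>+y. ?h x y * (?h x y * ennreal (cmod (f y))) \<partial>lborel))^2"
      by (intro power_mono) auto
    also have "\<dots> = ennreal C ^ 2 * (\<integral>\<^sup>+y. ?h x y * (?h x y * ennreal (cmod (f y))) \<partial>lborel)^2"
      by (simp add: power_mult_distrib)
    also have "\<dots> \<le> ennreal C ^ 2 * ((\<integral>\<^sup>+y. ?h x y ^ 2 \<partial>lborel) * (\<integral>\<^sup>+y. (?h x y * ennreal (cmod (f y)))^2 \<partial>lborel))"
      by (intro mult_left_mono Cauchy_Schwarz_nn_integral; simp)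
    also have "(\<integral>\<^sup>+y. ?h x y ^ 2 \<partial>lborel) = ennreal c"
      unfolding hh c_def by (subst exp_kernel_minus) (rule exp_kernel_integral[OF beta])
    also have "(\<integral>\<^sup>+y. (?h x y * ennreal (cmod (f y)))^2 \<partial>lborel) = (\<integral>\<^sup>+y. ?k x y * ennreal ((cmod (f y))\<^sup>2) \<partial>lborel)"
      by (simp add: power_mult_distrib hh[symmetric] ennreal_power)
    finally show ?thesis using C_nonneg by (simp add: ennreal_power)
  qed
  then have "(\<integral>\<^sup>+x. ennreal ((cmod (conv f x))\<^sup>2) \<partial>lborel)
     \<le> (\<integral>\<^sup>+x. ennreal (C\<^sup>2) * (ennreal c * (\<integral>\<^sup>+y. ?k x y * ennreal ((cmod (f y))\<^sup>2) \<partial>lborel)) \<partial>lborel)"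
    by (intro nn_integral_mono)
  also have "\<dots> = ennreal (C\<^sup>2) * (ennreal c * (\<integral>\<^sup>+x. (\<integral>\<^sup>+y. ?k x y * ennreal ((cmod (f y))\<^sup>2) \<partial>lborel) \<partial>lborel))"
    by (subst nn_integral_cmult; measurable)+
  also have "\<dots> < \<infinity>"
    using exp_kernel_L2_bound[OF beta assms] by (simp add: ennreal_mult_less_top)
  finally have "integrable lborel (\<lambda>x. (cmod (conv f x))\<^sup>2)"
    using m by (intro integrableI_bounded) auto
  with m show ?thesis by (simp add: L2_def)
qed

lemma conv_pairing:
  assumes "v \<in> L2" "f \<in> L2"
  shows "(LINT x|lborel. v x * conv f x) = (LINT y|lborel. f y * (LINT x|lborel. v x * K (x - y)))"
    and "integrable lborel (\<lambda>y. f y * (LINT x|lborel. v x * K (x - y)))"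
proof -
  note i = integrable_pairing[OF assms]
  have "(LINT x|lborel. v x * conv f x) = (LINT x|lborel. LINT y|lborel. v x * K (x - y) * f y)"
    unfolding conv_def by (simp add: mult.assoc)
  also have "\<dots> = (LINT y|lborel. LINT x|lborel. v x * K (x - y) * f y)"
    using lborel_pair.Fubini_integral[OF i] by simp
  also have "\<dots> = (LINT y|lborel. f y * (LINT x|lborel. v x * K (x - y)))"
    by (simp add: mult.commute)
  finally show "(LINT x|lborel. v x * conv f x) = (LINT y|lborel. f y * (LINT x|lborel. v x * K (x - y)))" .
  have "integrable lborel (\<lambda>y. LINT x|lborel. v x * K (x - y) * f y)"
    using lborel_pair.integrable_snd[OF i] .
  then show "integrable lborel (\<lambda>y. f y * (LINT x|lborel. v x * K (x - y)))"
    by (simp add: mult.commute)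
qed

end

lemma free_green_kernel:
  assumes "Im k > 0"
  shows "exp_bounded_kernel (free_green k) (1 / (2 * cmod k)) (Im k)"
    and "exp_bounded_kernel (free_green' k) (1 / 2) (Im k)"
  by (standard; use assms in \<open>simp add: norm_free_green norm_free_green'\<close>)+

definition free_resolvent :: "complex \<Rightarrow> (real \<Rightarrow> complex) \<Rightarrow> real \<Rightarrow> complex" where
  "free_resolvent k f x = (LINT y|lborel. free_green k (x - y) * f y)"

definition free_resolvent' :: "complex \<Rightarrow> (real \<Rightarrow> complex) \<Rightarrow> real \<Rightarrow> complex" where
  "free_resolvent' k f x = (LINT y|lborel. free_green' k (x - y) * f y)"

text \<open>Integrating the candidate derivative over an interval is a pairing with an indicator
  function; Fubini reduces it to the increment formula of the kernel itself.\<close>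

lemma H1_free_resolvent:
  assumes k: "Im k > 0" and f: "f \<in> L2"
  shows "H1 (free_resolvent k f) (free_resolvent' k f)"
proof -
  interpret G: exp_bounded_kernel "free_green k" "1 / (2 * cmod k)" "Im k"
    by (rule free_green_kernel[OF k])
  interpret G': exp_bounded_kernel "free_green' k" "1 / 2" "Im k"
    by (rule free_green_kernel[OF k])
  have eq: "free_resolvent k f = G.conv f" "free_resolvent' k f = G'.conv f"
    by (auto simp: fun_eq_iff free_resolvent_def free_resolvent'_def G.conv_def G'.conv_def)
  show ?thesis
    unfolding H1_def
  proof (intro conjI allI impI)
    show "free_resolvent k f \<in> L2" "free_resolvent' k f \<in> L2"
      unfolding eq by (intro G.conv_L2 G'.conv_L2 f)+
    fix a b :: real assume ab: "a \<le> b"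
    have "(LINT s:{a..b}|lborel. free_resolvent' k f s) = (LINT s|lborel. indicator {a..b} s * G'.conv f s)"
      unfolding set_lebesgue_integral_def eq
      by (intro Bochner_Integration.integral_cong) (auto simp: indicator_def)
    also have "\<dots> = (LINT y|lborel. f y * (LINT s|lborel. indicator {a..b} s * free_green' k (s - y)))"
      by (rule G'.conv_pairing(1)[OF L2_indicator_Icc f])
    also have "\<dots> = (LINT y|lborel. free_green k (b - y) * f y - free_green k (a - y) * f y)"
    proof (intro Bochner_Integration.integral_cong refl)
      fix y
      have "(LINT s|lborel. indicator {a..b} s * free_green' k (s - y)) = (LINT s:{a..b}|lborel. free_green' k (s - y))"
        unfolding set_lebesgue_integral_def
        by (intro Bochner_Integration.integral_cong) (auto simp: indicator_def)
      also have "\<dots> = free_green k (b - y) - free_green k (a - y)"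
        using H1_increment[OF H1_free_green[OF k] ab] by simp
      finally have e: "(LINT s|lborel. indicator {a..b} s * free_green' k (s - y)) = free_green k (b - y) - free_green k (a - y)" .
      show "f y * (LINT s|lborel. indicator {a..b} s * free_green' k (s - y))
          = free_green k (b - y) * f y - free_green k (a - y) * f y"
        unfolding e by (simp add: algebra_simps)
    qed
    also have "\<dots> = free_resolvent k f b - free_resolvent k f a"
      unfolding free_resolvent_def by (intro Bochner_Integration.integral_diff G.integrable_conv f)
    finally show "free_resolvent k f b - free_resolvent k f a = (LINT s:{a..b}|lborel. free_resolvent' k f s)" ..
  qed
qed

text \<open>Fubini moves the form onto the kernel with source at y, where
  \<open>free_green_fundamental\<close>, applied to the conjugate of v, evaluates it to
  \<open>cnj (v y)\<close>.\<close>

lemma free_resolvent_form: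
  assumes k: "Im k > 0" and f: "f \<in> L2" and v: "H1 v v'"
  shows "l2_inner v' (free_resolvent' k f) - k\<^sup>2 * l2_inner v (free_resolvent k f) = l2_inner v f"
proof -
  interpret G: exp_bounded_kernel "free_green k" "1 / (2 * cmod k)" "Im k"
    by (rule free_green_kernel[OF k])
  interpret G': exp_bounded_kernel "free_green' k" "1 / 2" "Im k"
    by (rule free_green_kernel[OF k])
  note V = H1_cnj[OF v]
  note VL = H1_L2[OF V]
  have eq: "free_resolvent k f = G.conv f" "free_resolvent' k f = G'.conv f"
    by (auto simp: fun_eq_iff free_resolvent_def free_resolvent'_def G.conv_def G'.conv_def)
  have "l2_inner v' (free_resolvent' k f) - k\<^sup>2 * l2_inner v (free_resolvent k f)
    = (LINT y|lborel. f y * (LINT x|lborel. cnj (v' x) * free_green' k (x - y)))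
     - k\<^sup>2 * (LINT y|lborel. f y * (LINT x|lborel. cnj (v x) * free_green k (x - y)))"
    unfolding l2_inner_def eq G.conv_pairing(1)[OF VL(1) f] G'.conv_pairing(1)[OF VL(2) f] ..
  also have "\<dots> = (LINT y|lborel. f y * (LINT x|lborel. cnj (v' x) * free_green' k (x - y))
     - k\<^sup>2 * (f y * (LINT x|lborel. cnj (v x) * free_green k (x - y))))"
    using G.conv_pairing(2)[OF VL(1) f] G'.conv_pairing(2)[OF VL(2) f] by simp
  also have "\<dots> = (LINT y|lborel. f y * ((LINT x|lborel. cnj (v' x) * free_green' k (x - y))
     - k\<^sup>2 * (LINT x|lborel. cnj (v x) * free_green k (x - y))))"
    by (simp add: algebra_simps)
  also have "\<dots> = (LINT y|lborel. cnj (v y) * f y)"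
    unfolding free_green_fundamental[OF k V] by (simp add: mult.commute)
  finally show ?thesis by (simp add: l2_inner_def)
qed

lemma free_green_form:
  assumes k: "Im k > 0" and v: "H1 v v'"
  shows "l2_inner v' (\<lambda>x. free_green' k (x - a)) - k\<^sup>2 * l2_inner v (\<lambda>x. free_green k (x - a)) = cnj (v a)"
  using free_green_fundamental[OF k H1_cnj[OF v]] by (simp add: l2_inner_def)

section \<open>Krein's formula for the two delta interactions\<close>

definition edge_green :: "real \<Rightarrow> complex \<Rightarrow> complex \<Rightarrow> real \<Rightarrow> complex" where
  "edge_green \<kappa> k \<sigma> x = free_green k (x - \<kappa>) + \<sigma> * free_green k (x + \<kappa>)"

text \<open>For \<sigma> = 1 and \<sigma> = -1 these are the eigenvalues of the 2 by 2 matrix with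
  entries \<eta> times the identity plus \<open>free_green\<close> between the points \<kappa> and
  -\<kappa>. The eigenvectors are the even and the odd vector, which give the two versions of
  \<open>edge_green\<close>.\<close>

definition edge_factor :: "real \<Rightarrow> real \<Rightarrow> complex \<Rightarrow> complex \<Rightarrow> complex" where
  "edge_factor \<kappa> \<eta> k \<sigma> = of_real \<eta> + free_green k 0 + \<sigma> * free_green k (2 * \<kappa>)"

text \<open>Krein's formula with the inverse of that matrix written in its eigenbasis; the division
  by 2 normalises the vectors (1, 1) and (1, -1).\<close>

definition delta_green :: "real \<Rightarrow> real \<Rightarrow> complex \<Rightarrow> real \<Rightarrow> real \<Rightarrow> complex" where
  "delta_green \<kappa> \<eta> k x y = free_green k (x - y)
     - (edge_green \<kappa> k 1 x * edge_green \<kappa> k 1 y / edge_factor \<kappa> \<eta> k 1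
      + edge_green \<kappa> k (-1) x * edge_green \<kappa> k (-1) y / edge_factor \<kappa> \<eta> k (-1)) / 2"

text \<open>\<open>edge_factor\<close> multiplied by 2k, which makes it entire in k. The product
  over \<sigma> = 1 and \<sigma> = -1 is (2 \<eta> k + i)^2 + exp(4 i \<kappa> k), the numerator of
  D_0.\<close>

definition resonance_factor :: "real \<Rightarrow> real \<Rightarrow> complex \<Rightarrow> complex \<Rightarrow> complex" where
  "resonance_factor \<kappa> \<eta> k \<sigma> = 2 * of_real \<eta> * k + \<i> * (1 + \<sigma> * exp (2 * \<i> * of_real \<kappa> * k))"

lemma edge_factor_resonance_factor:
  assumes "k \<noteq> 0" "\<kappa> > 0"
  shows "edge_factor \<kappa> \<eta> k \<sigma> = resonance_factor \<kappa> \<eta> k \<sigma> / (2 * k)"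
  using assms by (simp add: edge_factor_def resonance_factor_def free_green_def field_simps)

text \<open>A zero would make the moduli of exp(2 i \<kappa> k) and 2 \<eta> k + i equal; for Im k
  nonnegative and k nonzero the former is at most 1 and the latter exceeds 1. On the real axis this
  excludes embedded singularities, so M extends continuously to it.\<close>

lemma resonance_factor_nonzero:
  assumes "0 \<le> Im k" "k \<noteq> 0" "\<kappa> > 0" "\<eta> > 0" "\<sigma> \<in> {1, -1}"
  shows "resonance_factor \<kappa> \<eta> k \<sigma> \<noteq> 0"
proof
  assume "resonance_factor \<kappa> \<eta> k \<sigma> = 0"
  then have "\<i> * (\<sigma> * exp (2 * \<i> * of_real \<kappa> * k)) - (- (2 * of_real \<eta> * k) - \<i>) = 0"
    by (simp add: resonance_factor_def algebra_simps)
  then have "\<i> * (\<sigma> * exp (2 * \<i> * of_real \<kappa> * k)) = - (2 * of_real \<eta> * k) - \<i>"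
    by (simp only: right_minus_eq)
  then have "cmod (\<i> * (\<sigma> * exp (2 * \<i> * of_real \<kappa> * k))) = cmod (- (2 * of_real \<eta> * k) - \<i>)"
    by simp
  also have "- (2 * of_real \<eta> * k) - \<i> = - (2 * of_real \<eta> * k + \<i>)" by simp
  finally have eq: "exp (- 2 * \<kappa> * Im k) = cmod (2 * of_real \<eta> * k + \<i>)"
    using assms(5) unfolding norm_minus_cancel by (auto simp: norm_mult)
  have "exp (- 2 * \<kappa> * Im k) \<le> 1" using assms by simp
  moreover have "1 < cmod (2 * of_real \<eta> * k + \<i>)"
  proof -
    have "1 < (2 * \<eta> * Re k)\<^sup>2 + (2 * \<eta> * Im k + 1)\<^sup>2"
    proof (cases "Im k = 0")
      case True
      then have "Re k \<noteq> 0" using assms(2) by (auto simp: complex_eq_iff)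
      with True show ?thesis using assms(4) by simp
    next
      case False
      then have "1 < 2 * \<eta> * Im k + 1" using assms by simp
      then have "1\<^sup>2 < (2 * \<eta> * Im k + 1)\<^sup>2" by (intro power_strict_mono) auto
      then show ?thesis unfolding power_one using zero_le_power2[of "2 * \<eta> * Re k"] by linarith
    qed
    then show ?thesis by (simp add: cmod_def)
  qed
  ultimately show False using eq by linarith
qed

lemma free_green_0_minus: "free_green k (- x) = free_green k x"
  by (simp add: free_green_def)

text \<open>The function \<open>u\<close> is the free resolvent \<open>V\<close> plus sources of
  strength \<open>A\<close> at \<kappa> and \<open>B\<close> at -\<kappa>. In the form identity the
  sources leave point evaluations of the test function, and these cancel the delta terms exactly
  when \<eta> A = - u(\<kappa>) and \<eta> B = - u(-\<kappa>). The sum and the difference of these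
  conditions are the scalar equations with coefficients \<open>edge_factor\<close>.\<close>

theorem delta_green_resolvent:
  assumes k: "Im k > 0" and par: "\<kappa> > 0" "\<eta> > 0" and f: "f \<in> L2"
  defines "u \<equiv> \<lambda>x. LINT y|lborel. delta_green \<kappa> \<eta> k x y * f y"
  shows "H_delta \<kappa> \<eta> u (\<lambda>x. f x + k\<^sup>2 * u x)"
proof -
  interpret G: exp_bounded_kernel "free_green k" "1 / (2 * cmod k)" "Im k"
    by (rule free_green_kernel[OF k])
  have k0: "k \<noteq> 0" using k by auto
  define V where "V = free_resolvent k f"
  define V' where "V' = free_resolvent' k f"
  have V: "H1 V V'" unfolding V_def V'_def by (rule H1_free_resolvent[OF k f])
  have int: "integrable lborel (\<lambda>y. free_green k (y - a) * f y)" for a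
    by (intro L2_integrable_mult L2_free_green k f)
  have edge_int: "integrable lborel (\<lambda>y. edge_green \<kappa> k \<sigma> y * f y)" for \<sigma>
  proof -
    have "integrable lborel (\<lambda>y. free_green k (y - \<kappa>) * f y + \<sigma> * (free_green k (y - (-\<kappa>)) * f y))"
      by (intro Bochner_Integration.integrable_add integrable_mult_right int)
    then show ?thesis by (simp add: edge_green_def algebra_simps)
  qed
  have Vval: "V a = (LINT y|lborel. free_green k (y - a) * f y)" for a
    unfolding V_def free_resolvent_def by (subst free_green_0_minus[symmetric]) simp
  have edge_val: "(LINT y|lborel. edge_green \<kappa> k \<sigma> y * f y) = V \<kappa> + \<sigma> * V (-\<kappa>)" for \<sigma>
  proof -
    have "V \<kappa> + \<sigma> * V (-\<kappa>) = (LINT y|lborel. free_green k (y - \<kappa>) * f y + \<sigma> * (free_green k (y - (-\<kappa>)) * f y))"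
      unfolding Vval using int[of \<kappa>] int[of "-\<kappa>"]
      by (simp only: Bochner_Integration.integral_add integrable_mult_right integral_mult_right_zero)
    then show ?thesis by (simp add: edge_green_def algebra_simps)
  qed
  \<comment> \<open>\<open>cp\<close> and \<open>cm\<close> are the strengths in the even and odd
    channels, that is \<open>A + B\<close> and \<open>A - B\<close>.\<close>
  define cp where "cp = - (V \<kappa> + V (-\<kappa>)) / edge_factor \<kappa> \<eta> k 1"
  define cm where "cm = - (V \<kappa> - V (-\<kappa>)) / edge_factor \<kappa> \<eta> k (-1)"
  have nz: "edge_factor \<kappa> \<eta> k 1 \<noteq> 0" "edge_factor \<kappa> \<eta> k (-1) \<noteq> 0"
    using resonance_factor_nonzero[of k \<kappa> \<eta>] k k0 par by (auto simp: edge_factor_resonance_factor)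
  define A where "A = (cp + cm) / 2"
  define B where "B = (cp - cm) / 2"
  have u: "u = (\<lambda>x. B * free_green k (x - (-\<kappa>)) + (A * free_green k (x - \<kappa>) + V x))"
  proof
    fix x
    have "u x = (LINT y|lborel. free_green k (x - y) * f y
        - (edge_green \<kappa> k 1 x / edge_factor \<kappa> \<eta> k 1 / 2) * (edge_green \<kappa> k 1 y * f y)
        - (edge_green \<kappa> k (-1) x / edge_factor \<kappa> \<eta> k (-1) / 2) * (edge_green \<kappa> k (-1) y * f y))"
      unfolding u_def delta_green_def
      by (intro Bochner_Integration.integral_cong refl) (simp add: algebra_simps add_divide_distrib)
    also have "\<dots> = V x - (edge_green \<kappa> k 1 x / edge_factor \<kappa> \<eta> k 1 / 2) * (V \<kappa> + V (-\<kappa>))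
        - (edge_green \<kappa> k (-1) x / edge_factor \<kappa> \<eta> k (-1) / 2) * (V \<kappa> - V (-\<kappa>))"
      using edge_int edge_val[of 1] edge_val[of "-1"] G.integrable_conv[OF f]
      by (simp add: V_def free_resolvent_def)
    also have "\<dots> = V x + edge_green \<kappa> k 1 x * cp / 2 + edge_green \<kappa> k (-1) x * cm / 2"
    proof -
      have "a - (p / c / 2) * s - (q / d / 2) * t = a + p * (- s / c) / 2 + q * (- t / d) / 2"
        for a p q s t c d :: complex
        by simp
      then show ?thesis unfolding cp_def cm_def .
    qed
    also have "\<dots> = B * free_green k (x - (-\<kappa>)) + (A * free_green k (x - \<kappa>) + V x)"
    proof -
      have "v + (p + 1 * q) * r / 2 + (p + (-1) * q) * s / 2 = (r - s) / 2 * q + ((r + s) / 2 * p + v)" for v p q r s :: complex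
        by (simp add: field_simps)
      then show ?thesis unfolding edge_green_def A_def B_def by simp
    qed
    finally show "u x = B * free_green k (x - (-\<kappa>)) + (A * free_green k (x - \<kappa>) + V x)" .
  qed
  define u' where "u' = (\<lambda>x. B * free_green' k (x - (-\<kappa>)) + (A * free_green' k (x - \<kappa>) + V' x))"
  have Hu: "H1 u u'" unfolding u u'_def by (intro H1_lincomb H1_free_green k V)
  have L: "u \<in> L2" using H1_L2[OF Hu] by simp
  have ep: "edge_factor \<kappa> \<eta> k 1 * cp = - (V \<kappa> + V (-\<kappa>))" and em: "edge_factor \<kappa> \<eta> k (-1) * cm = - (V \<kappa> - V (-\<kappa>))"
    using nz by (simp_all add: cp_def cm_def)
  have cpAB: "cp = A + B" "cm = A - B" by (auto simp: A_def B_def field_simps)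
  define g0 where "g0 = free_green k 0"
  define g2 where "g2 = free_green k (2 * \<kappa>)"
  have s: "(\<eta> + g0 + g2) * (A + B) = - (V \<kappa> + V (-\<kappa>))" "(\<eta> + g0 - g2) * (A - B) = - (V \<kappa> - V (-\<kappa>))"
    using ep em unfolding edge_factor_def cpAB g0_def g2_def by simp_all
  have uk: "u \<kappa> = B * g2 + (A * g0 + V \<kappa>)" "u (-\<kappa>) = B * g0 + (A * g2 + V (-\<kappa>))"
    using free_green_0_minus[of k "2 * \<kappa>"] by (simp_all add: u g0_def g2_def)
  have eA: "\<eta> * A = - u \<kappa>"
  proof -
    have "2 * (\<eta> * A + u \<kappa>) = ((\<eta> + g0 + g2) * (A + B) + (V \<kappa> + V (-\<kappa>))) + ((\<eta> + g0 - g2) * (A - B) + (V \<kappa> - V (-\<kappa>)))"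
      unfolding uk by (simp add: algebra_simps)
    also have "\<dots> = 0" unfolding s by simp
    finally have "\<eta> * A + u \<kappa> = 0" unfolding mult_eq_0_iff by simp
    then show ?thesis by (simp only: add_eq_0_iff2)
  qed
  have eB: "\<eta> * B = - u (-\<kappa>)"
  proof -
    have "2 * (\<eta> * B + u (-\<kappa>)) = ((\<eta> + g0 + g2) * (A + B) + (V \<kappa> + V (-\<kappa>))) - ((\<eta> + g0 - g2) * (A - B) + (V \<kappa> - V (-\<kappa>)))"
      unfolding uk by (simp add: algebra_simps)
    also have "\<dots> = 0" unfolding s by simp
    finally have "\<eta> * B + u (-\<kappa>) = 0" unfolding mult_eq_0_iff by simp
    then show ?thesis by (simp only: add_eq_0_iff2)
  qed
  have form: "delta_form \<kappa> \<eta> v v' u u' = l2_inner v (\<lambda>x. f x + k\<^sup>2 * u x)" if v: "H1 v v'" for v v'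
  proof -
    note vL = H1_L2[OF v]
    note gL = L2_free_green[OF k]
    have "l2_inner v' u' = B * l2_inner v' (\<lambda>x. free_green' k (x - (-\<kappa>))) + (A * l2_inner v' (\<lambda>x. free_green' k (x - \<kappa>)) + l2_inner v' V')"
      unfolding u'_def
      by (subst l2_inner_lincomb_right[OF vL(2) gL(2) L2_lincomb[OF gL(2) H1_L2(2)[OF V]]],
          subst l2_inner_lincomb_right[OF vL(2) gL(2) H1_L2(2)[OF V]]) simp
    moreover have "l2_inner v u = B * l2_inner v (\<lambda>x. free_green k (x - (-\<kappa>))) + (A * l2_inner v (\<lambda>x. free_green k (x - \<kappa>)) + l2_inner v V)"
      unfolding u
      by (subst l2_inner_lincomb_right[OF vL(1) gL(1) L2_lincomb[OF gL(1) H1_L2(1)[OF V]]],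
          subst l2_inner_lincomb_right[OF vL(1) gL(1) H1_L2(1)[OF V]]) simp
    ultimately have "l2_inner v' u' - k\<^sup>2 * l2_inner v u
      = B * (l2_inner v' (\<lambda>x. free_green' k (x - (-\<kappa>))) - k\<^sup>2 * l2_inner v (\<lambda>x. free_green k (x - (-\<kappa>))))
      + A * (l2_inner v' (\<lambda>x. free_green' k (x - \<kappa>)) - k\<^sup>2 * l2_inner v (\<lambda>x. free_green k (x - \<kappa>)))
      + (l2_inner v' V' - k\<^sup>2 * l2_inner v V)"
      by (simp add: algebra_simps)
    also have "\<dots> = B * cnj (v (-\<kappa>)) + A * cnj (v \<kappa>) + l2_inner v f"
      unfolding V_def V'_def free_green_form[OF k v] free_resolvent_form[OF k f v] ..
    finally have 1: "l2_inner v' u' = k\<^sup>2 * l2_inner v u + B * cnj (v (-\<kappa>)) + A * cnj (v \<kappa>) + l2_inner v f"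
      by (simp add: algebra_simps)
    have "of_real (1 / \<eta>) * u \<kappa> = - A" "of_real (1 / \<eta>) * u (-\<kappa>) = - B"
      using eA eB par by (simp_all add: field_simps)
    moreover have "of_real (1 / \<eta>) * (cnj (v \<kappa>) * u \<kappa> + cnj (v (-\<kappa>)) * u (-\<kappa>))
        = (of_real (1 / \<eta>) * u \<kappa>) * cnj (v \<kappa>) + (of_real (1 / \<eta>) * u (-\<kappa>)) * cnj (v (-\<kappa>))"
      by (simp only: distrib_left mult_ac)
    ultimately have 2: "of_real (1 / \<eta>) * (cnj (v \<kappa>) * u \<kappa> + cnj (v (-\<kappa>)) * u (-\<kappa>)) = - A * cnj (v \<kappa>) - B * cnj (v (-\<kappa>))"
      by simp
    have "l2_inner v (\<lambda>x. k\<^sup>2 * u x + f x) = k\<^sup>2 * l2_inner v u + l2_inner v f"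
      by (rule l2_inner_lincomb_right[OF vL(1) L f])
    then have 3: "l2_inner v (\<lambda>x. f x + k\<^sup>2 * u x) = k\<^sup>2 * l2_inner v u + l2_inner v f"
      by (simp add: add.commute)
    show ?thesis unfolding delta_form_def 1 2 3 by (simp add: algebra_simps)
  qed
  have "(\<lambda>x. f x + k\<^sup>2 * u x) \<in> L2"
    using L2_lincomb[OF L f, of "k\<^sup>2"] by (simp add: add.commute)
  with L Hu form show ?thesis
    unfolding H_delta_def by (intro conjI exI[of _ u] exI[of _ u']) auto
qed

section \<open>Uniqueness of the continuous resolvent kernel\<close>

lemma continuous_on_delta_green:
  "continuous_on UNIV (\<lambda>(x, y). delta_green \<kappa> \<eta> k x y)"
proof -
  have "continuous_on UNIV (\<lambda>p. delta_green \<kappa> \<eta> k (fst p) (snd p))"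
    unfolding delta_green_def edge_green_def divide_inverse by (intro continuous_intros)
  then show ?thesis by (simp add: case_prod_beta)
qed

lemma AE_eq_continuous_imp_eq:
  fixes f g :: "real \<Rightarrow> complex"
  assumes "AE x in lborel. f x = g x" "continuous_on UNIV f" "continuous_on UNIV g"
  shows "f x = g x"
proof (rule ccontr)
  assume ne: "f x \<noteq> g x"
  have "open {x. f x \<noteq> g x}"
    using assms by (intro open_Collect_neq)
  then obtain e where e: "e > 0" "ball x e \<subseteq> {x. f x \<noteq> g x}"
    using ne open_contains_ball by blast
  have "AE y in lborel. y \<notin> ball x e"
    using assms(1) by eventually_elim (use e(2) in auto)
  then have "emeasure lborel (ball x e) = 0"
    by (subst (asm) AE_iff_measurable[where N = "ball x e"]) auto
  moreover have "emeasure lborel {x - e<..<x + e} = ennreal (2 * e)"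
    using e(1) by simp
  ultimately show False using e(1) by (simp add: ball_eq_greaterThanLessThan)
qed

lemma integral_indicator_Icc_continuous:
  assumes "continuous_on UNIV (\<lambda>(x, y). G x y :: complex)"
  shows "(LINT y|lborel. G x y * indicator {a..b::real} y) = integral {a..b} (G x)"
    and "continuous_on UNIV (\<lambda>x. integral {a..b} (G x))"
proof -
  have c: "continuous_on {a..b} (G x)" for x
    by (rule continuous_on_compose2[OF assms, of "{a..b}" "\<lambda>y. (x, y)", simplified])
       (auto intro!: continuous_intros)
  have "(LINT y|lborel. G x y * indicator {a..b::real} y) = (LINT y:{a..b}|lborel. G x y)"
    unfolding set_lebesgue_integral_def
    by (intro Bochner_Integration.integral_cong) (auto simp: indicator_def)
  also have "\<dots> = integral {a..b} (G x)"
    by (rule set_borel_integral_eq_integral(2)) (rule borel_integrable_atLeastAtMost', rule c)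
  finally show "(LINT y|lborel. G x y * indicator {a..b::real} y) = integral {a..b} (G x)" .
  have "continuous_on UNIV (\<lambda>x. integral (cbox a b) (G x))"
    by (rule integral_continuous_on_param, rule continuous_on_subset[OF assms]) auto
  then show "continuous_on UNIV (\<lambda>x. integral {a..b} (G x))" by simp
qed

text \<open>Apply both kernels to indicators of intervals. The images agree almost everywhere by
  uniqueness of the resolvent, hence everywhere by continuity; differentiating the integral over
  {y..b} at b = y recovers the kernel at (x, y).\<close>

lemma green_kernel_unique:
  assumes "green_kernel (H_delta \<kappa> \<eta>) z G" "green_kernel (H_delta \<kappa> \<eta>) z G'" "Im z \<noteq> 0"
  shows "G = G'"
proof (intro ext)
  fix x y
  have c: "continuous_on UNIV (\<lambda>(x, y). G x y)" "continuous_on UNIV (\<lambda>(x, y). G' x y)"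
    using assms by (auto simp: green_kernel_def)
  have eq: "integral {a..b} (G x) = integral {a..b} (G' x)" for a b
  proof -
    have "H_delta \<kappa> \<eta> (\<lambda>x. integral {a..b} (G x)) (\<lambda>x. indicator {a..b} x + z * integral {a..b} (G x))"
      using assms(1) L2_indicator_Icc[of a b] integral_indicator_Icc_continuous(1)[OF c(1)]
      by (auto simp: green_kernel_def Let_def)
    moreover have "H_delta \<kappa> \<eta> (\<lambda>x. integral {a..b} (G' x)) (\<lambda>x. indicator {a..b} x + z * integral {a..b} (G' x))"
      using assms(2) L2_indicator_Icc[of a b] integral_indicator_Icc_continuous(1)[OF c(2)]
      by (auto simp: green_kernel_def Let_def)
    ultimately have "l2_eq (\<lambda>x. integral {a..b} (G x)) (\<lambda>x. integral {a..b} (G' x))"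
      using assms(3) by (rule H_delta_resolvent_unique)
    then show ?thesis
      unfolding l2_eq_def using integral_indicator_Icc_continuous(2)[OF c(1)] integral_indicator_Icc_continuous(2)[OF c(2)]
      by (rule AE_eq_continuous_imp_eq)
  qed
  have cx: "continuous_on S (G x)" "continuous_on S (G' x)" for S
    by (rule continuous_on_compose2[OF c(1), of S "\<lambda>y. (x, y)", simplified]
             continuous_on_compose2[OF c(2), of S "\<lambda>y. (x, y)", simplified];
        auto intro!: continuous_intros)+
  have d: "((\<lambda>b. integral {y..b} (g x)) has_vector_derivative g x y) (at y within {y..y+1})"
    if "\<And>S. continuous_on S (g x)" for g :: "real \<Rightarrow> real \<Rightarrow> complex"
    by (rule integral_has_vector_derivative[OF that]) auto
  have "((\<lambda>b. integral {y..b} (G x)) has_vector_derivative G' x y) (at y within {y..y+1})"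
    using d[of G', OF cx(2)] unfolding eq .
  with d[of G, OF cx(1)] show "G x y = G' x y"
    by (intro vector_derivative_unique_within[of y "{y..y+1}"]) (simp_all add: at_within_Icc_at_right)
qed

section \<open>The branch of the square root and the resonances\<close>

lemma Im_csqrt_pos:
  assumes "Im z > 0"
  shows "Im (csqrt z) > 0"
proof -
  obtain k where k: "k = csqrt z" by simp
  have "k\<^sup>2 = z" by (simp add: k)
  then have "Im z = 2 * Re k * Im k" by (metis Im_power2)
  moreover have "0 \<le> Re k" using csqrt_principal[of z] unfolding k by linarith
  ultimately have "Im k > 0" using assms by (auto simp: zero_less_mult_iff)
  then show ?thesis by (simp add: k)
qed

theorem green_function_delta:
  assumes "Im z > 0" "\<kappa> > 0" "\<eta> > 0"
  shows "green_function (H_delta \<kappa> \<eta>) z = delta_green \<kappa> \<eta> (csqrt z)"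
proof -
  have k: "Im (csqrt z) > 0" by (rule Im_csqrt_pos[OF assms(1)])
  have "green_kernel (H_delta \<kappa> \<eta>) z (delta_green \<kappa> \<eta> (csqrt z))"
    unfolding green_kernel_def Let_def
    using continuous_on_delta_green delta_green_resolvent[OF k assms(2,3)] by simp
  moreover have "Im z \<noteq> 0" using assms by simp
  ultimately show ?thesis
    unfolding green_function_def by (intro the_equality) (auto intro: green_kernel_unique)
qed

text \<open>On this set \<open>csqrt\<close> is holomorphic with positive real part, and its
  imaginary part is positive over the upper half plane. It is therefore the branch continued across
  the positive axis.\<close>

definition slit_plane :: "complex set" where "slit_plane = - \<real>\<^sub>\<le>\<^sub>0"

lemma slit_plane_eq: "slit_plane = - (complex_of_real ` {..0})"
  by (auto simp: slit_plane_def nonpos_Reals_def)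

lemma open_slit_plane: "open slit_plane"
  by (simp add: slit_plane_def open_Compl)

lemma connected_slit_plane: "connected slit_plane"
  unfolding slit_plane_eq by (intro starlike_imp_connected starlike_slotted_complex_plane_left)

lemma Im_nonzero_slit_plane: "Im z \<noteq> 0 \<Longrightarrow> z \<in> slit_plane"
  by (auto simp: slit_plane_def complex_nonpos_Reals_iff)

lemma csqrt_nonzero_slit_plane: "z \<in> slit_plane \<Longrightarrow> csqrt z \<noteq> 0"
  by (auto simp: slit_plane_def)

lemma holomorphic_csqrt_slit_plane: "csqrt holomorphic_on slit_plane"
  unfolding slit_plane_def by (rule holomorphic_on_csqrt)

lemma holomorphic_free_green:
  "(\<lambda>z. free_green (csqrt z) x) holomorphic_on slit_plane"
  unfolding free_green_def
  by (intro holomorphic_intros holomorphic_csqrt_slit_plane) (auto dest: csqrt_nonzero_slit_plane)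

lemma holomorphic_edge:
  "(\<lambda>z. edge_green \<kappa> (csqrt z) \<sigma> x) holomorphic_on slit_plane"
  "(\<lambda>z. edge_factor \<kappa> \<eta> (csqrt z) \<sigma>) holomorphic_on slit_plane"
  unfolding edge_green_def edge_factor_def
  by (intro holomorphic_intros holomorphic_free_green)+

lemma meromorphic_delta_green:
  "(\<lambda>z. delta_green \<kappa> \<eta> (csqrt z) x y) meromorphic_on slit_plane"
  unfolding delta_green_def
  by (intro meromorphic_intros analytic_on_imp_meromorphic_on)
     (auto simp: analytic_on_open[OF open_slit_plane] intro!: holomorphic_free_green holomorphic_edge)

lemma edge_factor_eq_0_iff:
  "z \<in> slit_plane \<Longrightarrow> \<kappa> > 0 \<Longrightarrow>
    edge_factor \<kappa> \<eta> (csqrt z) \<sigma> = 0 \<longleftrightarrow> resonance_factor \<kappa> \<eta> (csqrt z) \<sigma> = 0"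
  using csqrt_nonzero_slit_plane by (auto simp: edge_factor_resonance_factor)

text \<open>The two factors differ by a nonzero multiple of an exponential. At a resonance only one
  parity channel is singular, so the other cannot cancel its pole.\<close>

lemma resonance_factor_not_both:
  assumes "\<sigma> \<in> {1, -1}" "resonance_factor \<kappa> \<eta> k \<sigma> = 0"
  shows "resonance_factor \<kappa> \<eta> k (- \<sigma>) \<noteq> 0"
proof
  assume "resonance_factor \<kappa> \<eta> k (- \<sigma>) = 0"
  then have "resonance_factor \<kappa> \<eta> k \<sigma> - resonance_factor \<kappa> \<eta> k (- \<sigma>) = 0"
    using assms by simp
  then have "2 * \<i> * \<sigma> * exp (2 * \<i> * of_real \<kappa> * k) = 0"
    by (simp add: resonance_factor_def algebra_simps)
  then show False using assms(1) by auto
qed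

lemma holomorphic_isCont_slit_plane:
  "f holomorphic_on slit_plane \<Longrightarrow> z \<in> slit_plane \<Longrightarrow> isCont f z"
  using continuous_on_interior[OF holomorphic_on_imp_continuous_on] open_slit_plane
  by (simp add: interior_open)

theorem resonance_H_delta_iff:
  assumes par: "\<kappa> > 0" "\<eta> > 0" and z0: "Im z0 < 0"
  shows "resonance (H_delta \<kappa> \<eta>) z0 \<longleftrightarrow> (\<exists>\<sigma>\<in>{1, -1}. resonance_factor \<kappa> \<eta> (csqrt z0) \<sigma> = 0)"
proof
  have z0S: "z0 \<in> slit_plane" using z0 by (intro Im_nonzero_slit_plane) simp
  \<comment> \<open>The point i is the anchor in the upper half plane: the identity theorem starts
    from it, and the factors do not vanish there, so their zeros are isolated.\<close>
  have iS: "\<i> \<in> slit_plane" by (intro Im_nonzero_slit_plane) simp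
  have iF: "edge_factor \<kappa> \<eta> (csqrt \<i>) \<sigma> \<noteq> 0" if "\<sigma> \<in> {1, -1}" for \<sigma>
    unfolding edge_factor_eq_0_iff[OF iS par(1)]
    using resonance_factor_nonzero[OF _ csqrt_nonzero_slit_plane[OF iS] par that]
      Im_csqrt_pos[of \<i>] by simp
  {
    assume "resonance (H_delta \<kappa> \<eta>) z0"
    then obtain x y F where F: "F meromorphic_on slit_plane" "\<And>z. Im z > 0 \<Longrightarrow> F z = green_function (H_delta \<kappa> \<eta>) z x y" "is_pole F z0"
      unfolding resonance_def slit_plane_def by blast
    let ?G = "\<lambda>z. delta_green \<kappa> \<eta> (csqrt z) x y"
    have D: "(\<lambda>z. F z - ?G z) meromorphic_on slit_plane"
      by (intro meromorphic_intros F(1) meromorphic_delta_green)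
    have "eventually (\<lambda>z. F z - ?G z = 0) (cosparse slit_plane) \<or> eventually (\<lambda>z. F z - ?G z \<noteq> 0) (cosparse slit_plane)"
      by (rule meromorphic_imp_constant_or_avoid[OF D open_slit_plane connected_slit_plane])
    moreover have "\<not> eventually (\<lambda>z. F z - ?G z \<noteq> 0) (cosparse slit_plane)"
    proof
      assume "eventually (\<lambda>z. F z - ?G z \<noteq> 0) (cosparse slit_plane)"
      then have 1: "eventually (\<lambda>z. F z - ?G z \<noteq> 0) (at \<i>)"
        using iS by (simp add: eventually_cosparse_open_eq[OF open_slit_plane])
      have "eventually (\<lambda>z. z \<in> {z. Im z > 0}) (at \<i>)"
        by (intro eventually_at_in_open' open_halfspace_Im_gt) simp
      then have 2: "eventually (\<lambda>z. F z - ?G z = 0) (at \<i>)"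
        by eventually_elim (simp add: F(2) green_function_delta[OF _ par])
      from 1 2 have "eventually (\<lambda>z. False) (at \<i>)" by eventually_elim simp
      then show False by simp
    qed
    ultimately have ev: "eventually (\<lambda>z. F z = ?G z) (at z0)"
      using z0S by (auto simp: eventually_cosparse_open_eq[OF open_slit_plane])
    have pole: "is_pole ?G z0"
      using is_pole_transform[OF F(3) ev] by simp
    show "\<exists>\<sigma>\<in>{1, -1}. resonance_factor \<kappa> \<eta> (csqrt z0) \<sigma> = 0"
    proof (rule ccontr)
      assume "\<not> ?thesis"
      then have nz: "edge_factor \<kappa> \<eta> (csqrt z0) 1 \<noteq> 0" "edge_factor \<kappa> \<eta> (csqrt z0) (-1) \<noteq> 0"
        by (auto simp: edge_factor_eq_0_iff[OF z0S par(1)])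
      have "isCont ?G z0"
        unfolding delta_green_def
        by (intro continuous_intros holomorphic_isCont_slit_plane[OF holomorphic_free_green z0S]
              holomorphic_isCont_slit_plane[OF holomorphic_edge(1) z0S]
              holomorphic_isCont_slit_plane[OF holomorphic_edge(2) z0S] nz) auto
      then have "(?G \<longlongrightarrow> ?G z0) (at z0)" by (simp add: isCont_def)
      then show False
        using not_tendsto_and_filterlim_at_infinity[of "at z0" ?G] pole by (auto simp: is_pole_def)
    qed
  }
  assume "\<exists>\<sigma>\<in>{1, -1}. resonance_factor \<kappa> \<eta> (csqrt z0) \<sigma> = 0"
  then obtain \<sigma> where \<sigma>: "\<sigma> \<in> {1, -1}" "resonance_factor \<kappa> \<eta> (csqrt z0) \<sigma> = 0" by blast
  define g where "g = (\<lambda>z. edge_factor \<kappa> \<eta> (csqrt z) \<sigma>)"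
  define h where "h = (\<lambda>z. edge_factor \<kappa> \<eta> (csqrt z) (- \<sigma>))"
  define e where "e = (\<lambda>\<tau> z. edge_green \<kappa> (csqrt z) \<tau> \<kappa>)"
  let ?G = "\<lambda>z. delta_green \<kappa> \<eta> (csqrt z) \<kappa> \<kappa>"
  have hol: "g holomorphic_on slit_plane" "h holomorphic_on slit_plane" "\<And>\<tau>. e \<tau> holomorphic_on slit_plane"
    unfolding g_def h_def e_def by (rule holomorphic_edge)+
  have g0: "g z0 = 0" using \<sigma>(2) by (simp add: g_def edge_factor_eq_0_iff[OF z0S par(1)])
  have h0: "h z0 \<noteq> 0"
    using resonance_factor_not_both[OF \<sigma>] by (simp add: h_def edge_factor_eq_0_iff[OF z0S par(1)])
  have eg: "e \<tau> z = edge_factor \<kappa> \<eta> (csqrt z) \<tau> - of_real \<eta>" for \<tau> z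
    by (simp add: e_def edge_green_def edge_factor_def)
  have e0: "e \<sigma> z0 = - of_real \<eta>" using g0 by (simp add: eg g_def)
  \<comment> \<open>The kernel at (\<kappa>, \<kappa>) with the vanishing factor \<open>g\<close>
    brought to a common denominator. At \<open>z0\<close> only the last term survives, and it equals
    - \<eta>^2 / 2.\<close>
  define N where "N = (\<lambda>z. (free_green (csqrt z) 0 - (e (- \<sigma>) z)\<^sup>2 / h z / 2) * g z - (e \<sigma> z)\<^sup>2 / 2)"
  obtain r where r: "0 < r" "ball z0 r \<subseteq> slit_plane" "\<And>z. z \<in> ball z0 r - {z0} \<Longrightarrow> g z \<noteq> 0"
    using isolated_zeros[OF hol(1) open_slit_plane connected_slit_plane z0S g0 iS] iF[OF \<sigma>(1)]
    by (auto simp: g_def)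
  have evg: "eventually (\<lambda>z. g z \<noteq> 0) (at z0)"
    unfolding eventually_at using r by (intro exI[of _ r]) (auto simp: dist_commute)
  have "is_pole (\<lambda>z. N z / g z) z0"
  proof (rule is_pole_divide)
    show "isCont N z0"
      unfolding N_def
      by (intro continuous_intros holomorphic_isCont_slit_plane[OF holomorphic_free_green z0S]
            holomorphic_isCont_slit_plane[OF hol(1) z0S] holomorphic_isCont_slit_plane[OF hol(2) z0S]
            holomorphic_isCont_slit_plane[OF hol(3) z0S] h0) auto
    show "N z0 \<noteq> 0" using par by (simp add: N_def g0 e0)
    show "filterlim g (at 0) (at z0)"
      using holomorphic_isCont_slit_plane[OF hol(1) z0S] evg g0
      by (simp add: filterlim_at isCont_def)
  qed
  moreover have "eventually (\<lambda>z. N z / g z = ?G z) (at z0)"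
    using evg
  proof eventually_elim
    case (elim z)
    have "N z / g z = free_green (csqrt z) 0 - ((e \<sigma> z)\<^sup>2 / g z + (e (- \<sigma>) z)\<^sup>2 / h z) / 2"
      using elim by (simp add: N_def diff_divide_distrib add_divide_distrib)
    also have "\<dots> = ?G z"
      using \<sigma>(1) by (auto simp: delta_green_def e_def g_def h_def power2_eq_square add.commute)
    finally show ?case .
  qed
  ultimately have "is_pole ?G z0" by (rule is_pole_transform) simp
  then show "resonance (H_delta \<kappa> \<eta>) z0"
    unfolding resonance_def using z0 meromorphic_delta_green[of \<kappa> \<eta> \<kappa> \<kappa>]
    by (auto simp: slit_plane_def green_function_delta[OF _ par] intro!: exI[of _ \<kappa>] exI[of _ ?G])
qed

subsection \<open>The Wronskian of the edge solutions\<close>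

text \<open>Its purpose is the expression \<open>of_real a * csinc (k * of_real a)\<close>, which is
  sin(k a)/k continued analytically to k = 0.\<close>

definition csinc :: "complex \<Rightarrow> complex" where
  "csinc z = (if z = 0 then 1 else sin z / z)"

lemma csinc_mult: "z * csinc z = sin z"
  by (simp add: csinc_def)

lemma csinc_0 [simp]: "csinc 0 = 1"
  by (simp add: csinc_def)

lemma csinc_minus [simp]: "csinc (- z) = csinc z"
  by (simp add: csinc_def)

lemma csinc_eq_0_iff: "csinc z = 0 \<longleftrightarrow> z \<noteq> 0 \<and> sin z = 0"
  by (simp add: csinc_def)

lemma cnj_csinc: "cnj (csinc z) = csinc (cnj z)"
  by (simp add: csinc_def cnj_sin)

text \<open>Riemann's theorem on removable singularities; continuity at 0 is the derivative of the
  sine there.\<close>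

lemma holomorphic_csinc: "csinc holomorphic_on A"
proof -
  have "csinc holomorphic_on UNIV"
  proof (rule no_isolated_singularity[where K = "{0}"])
    have "(\<lambda>z. sin z / z :: complex) holomorphic_on UNIV - {0}"
      by (intro holomorphic_intros) auto
    then show "csinc holomorphic_on UNIV - {0}"
      by (rule holomorphic_transform) (auto simp: csinc_def)
    then have "continuous_on (UNIV - {0}) csinc"
      by (rule holomorphic_on_imp_continuous_on)
    then have "isCont csinc z" if "z \<noteq> 0" for z
      using that by (simp add: continuous_on_eq_continuous_at open_delete)
    moreover have "isCont csinc 0"
    proof -
      have "((\<lambda>z. (sin z - sin 0) / (z - 0)) \<longlongrightarrow> cos 0) (at (0::complex))"
        using DERIV_sin[of "0::complex"] unfolding has_field_derivative_iff by simp
      then have "((\<lambda>z. sin z / z) \<longlongrightarrow> 1) (at (0::complex))" by simp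
      then have "(csinc \<longlongrightarrow> 1) (at 0)"
        by (rule Lim_transform_eventually) (auto simp: csinc_def eventually_at_filter)
      then show ?thesis by (simp add: isCont_def)
    qed
    ultimately show "continuous_on UNIV csinc"
      by (metis continuous_at_imp_continuous_on)
  qed auto
  then show ?thesis by (rule holomorphic_on_subset) auto
qed

lemma holomorphic_csinc' [holomorphic_intros]:
  "f holomorphic_on A \<Longrightarrow> (\<lambda>z. csinc (f z)) holomorphic_on A"
  using holomorphic_on_compose[OF _ holomorphic_csinc, of f A] by (simp add: o_def)

lemma continuous_on_csinc [continuous_intros]:
  "continuous_on A f \<Longrightarrow> continuous_on A (\<lambda>z. csinc (f z))"
  by (rule continuous_on_compose2[OF holomorphic_on_imp_continuous_on[OF holomorphic_csinc[of UNIV]]]) auto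

text \<open>Up to the factor \<open>1 - i \<eta> k\<close>, \<open>edge_sol \<eta> k (x + \<kappa>)\<close> and \<open>edge_sol \<eta> k (\<kappa> - x)\<close> are the
  solutions of \<open>- u'' = k\<^sup>2 u\<close> in the interval which satisfy the matching conditions at its left
  and right end, and \<open>edge_wronskian\<close> is their Wronskian. Nothing here is singular
  at \<open>\<eta> = 0\<close>, which is the Dirichlet case, or at \<open>k = 0\<close>.\<close>

definition edge_sol :: "real \<Rightarrow> complex \<Rightarrow> real \<Rightarrow> complex" where
  "edge_sol \<eta> k a = of_real \<eta> * cos (k * of_real a)
     + (1 - \<i> * of_real \<eta> * k) * (of_real a * csinc (k * of_real a))"

definition edge_wronskian :: "real \<Rightarrow> real \<Rightarrow> complex \<Rightarrow> complex" where
  "edge_wronskian \<kappa> \<eta> k = 2 * of_real \<eta> * (1 - \<i> * of_real \<eta> * k) * cos (k * of_real (2 * \<kappa>))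
     + (1 - 2 * \<i> * of_real \<eta> * k - 2 * (of_real \<eta>)\<^sup>2 * k\<^sup>2) * (of_real (2 * \<kappa>) * csinc (k * of_real (2 * \<kappa>)))"

text \<open>In exponential form the edge solution, the Wronskian and Krein's formula all become
  rational functions of a few exponentials and of \<open>m\<close>, so that they can be compared by
  pure algebra.\<close>

lemma edge_sol_exp:
  fixes k :: complex and \<eta> a :: real
  assumes "k \<noteq> 0"
  defines "m \<equiv> 2 * \<i> * of_real \<eta> * k - 1" and "p \<equiv> exp (\<i> * k * of_real a)"
  shows "edge_sol \<eta> k a = (p + m / p) / (2 * \<i> * k)"
proof -
  have s: "of_real a * csinc (k * of_real a) = sin (k * of_real a) / k"
    using csinc_mult[of "k * of_real a"] assms(1) by (simp add: field_simps)
  have p: "p \<noteq> 0" "exp (- (\<i> * (k * of_real a))) = 1 / p" "exp (\<i> * (k * of_real a)) = p"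
    by (auto simp: p_def exp_minus field_simps)
  have "edge_sol \<eta> k a = of_real \<eta> * ((p + 1 / p) / 2) + (1 - \<i> * of_real \<eta> * k) * ((p - 1 / p) / (2 * \<i>) / k)"
    unfolding edge_sol_def s cos_exp_eq sin_exp_eq p(2,3) by simp
  also have "\<dots> = (p + m / p) / (2 * \<i> * k)"
    using assms(1) p(1) unfolding m_def by (simp add: divide_simps) (simp add: algebra_simps)
  finally show ?thesis .
qed

lemma edge_wronskian_exp:
  fixes k :: complex and \<eta> \<kappa> :: real
  assumes "k \<noteq> 0"
  defines "m \<equiv> 2 * \<i> * of_real \<eta> * k - 1" and "w \<equiv> exp (2 * \<i> * of_real \<kappa> * k)"
  shows "edge_wronskian \<kappa> \<eta> k = \<i> * (m\<^sup>2 - w\<^sup>2) / (2 * w * k)"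
proof -
  have s: "of_real (2 * \<kappa>) * csinc (k * of_real (2 * \<kappa>)) = sin (k * of_real (2 * \<kappa>)) / k"
    using csinc_mult[of "k * of_real (2 * \<kappa>)"] assms(1) by (simp add: field_simps)
  have p: "w \<noteq> 0" "exp (- (\<i> * (k * of_real (2 * \<kappa>)))) = 1 / w" "exp (\<i> * (k * of_real (2 * \<kappa>))) = w"
    by (auto simp: w_def exp_minus field_simps)
  have "edge_wronskian \<kappa> \<eta> k = 2 * of_real \<eta> * (1 - \<i> * of_real \<eta> * k) * ((w + 1 / w) / 2)
     + (1 - 2 * \<i> * of_real \<eta> * k - 2 * (of_real \<eta>)\<^sup>2 * k\<^sup>2) * ((w - 1 / w) / (2 * \<i>) / k)"
    unfolding edge_wronskian_def s cos_exp_eq sin_exp_eq p(2,3) ..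
  also have "\<dots> = \<i> * (m\<^sup>2 - w\<^sup>2) / (2 * w * k)"
    using assms(1) p(1) unfolding m_def
    by (simp add: divide_simps) (simp add: algebra_simps power2_eq_square)
  finally show ?thesis .
qed

lemma resonance_factor_alt:
  "resonance_factor \<kappa> \<eta> k \<sigma> = \<i> * (\<sigma> * exp (2 * \<i> * of_real \<kappa> * k) - (2 * \<i> * of_real \<eta> * k - 1))"
  by (simp add: resonance_factor_def algebra_simps)

text \<open>Both sides are multiples of m^2 - w^2, which factors into the odd and even channels.
  Away from k = 0 the zeros of the Wronskian are therefore those of D_0.\<close>

lemma edge_wronskian_factor:
  assumes "k \<noteq> 0"
  shows "2 * k * exp (2 * \<i> * of_real \<kappa> * k) * edge_wronskian \<kappa> \<eta> k
    = - \<i> * resonance_factor \<kappa> \<eta> k 1 * resonance_factor \<kappa> \<eta> k (-1)"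
  unfolding edge_wronskian_exp[OF assms] resonance_factor_alt using assms
  by (simp add: field_simps power2_eq_square)

lemma edge_wronskian_eq_0_iff:
  assumes "k \<noteq> 0"
  shows "edge_wronskian \<kappa> \<eta> k = 0 \<longleftrightarrow> (\<exists>\<sigma>\<in>{1, -1}. resonance_factor \<kappa> \<eta> k \<sigma> = 0)"
  using edge_wronskian_factor[OF assms, of \<kappa> \<eta>] assms by auto

text \<open>The identity behind \<open>delta_green_edge_sol\<close> without the prefactor i/(2k): on
  the left Krein's formula, on the right a product of two edge solutions over the Wronskian.\<close>

lemma Krein_algebra:
  fixes p r w m :: complex
  assumes "p \<noteq> 0" "r \<noteq> 0" "w - m \<noteq> 0" "w + m \<noteq> 0"
  shows "w / (p * r) - ((w / p + p) * (r + w / r) / (w - m) - (w / p - p) * (r - w / r) / (w + m)) / 2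
    = w * (p + m / p) * (r + m / r) / (m\<^sup>2 - w\<^sup>2)"
proof -
  have 1: "m\<^sup>2 - w\<^sup>2 = - ((w - m) * (w + m))" by (simp add: algebra_simps power2_eq_square)
  have "m * 2 + w * 2 = 2 * (w + m)" by simp
  then have 2: "m * 2 + w * 2 \<noteq> 0" using assms(4) by (metis mult_eq_0_iff zero_neq_numeral)
  show ?thesis unfolding 1 using assms 2
    by (simp add: divide_simps) (simp add: algebra_simps power2_eq_square)
qed

text \<open>Inside the interval the kernel is of Sturm-Liouville type: the solution adapted to the
  left end at the smaller point, the one adapted to the right end at the larger point, divided by
  their Wronskian. This form remains meaningful in the limit \<eta> = 0.\<close>

lemma delta_green_edge_sol:
  assumes "k \<noteq> 0" "\<kappa> > 0" "\<bar>x\<bar> \<le> \<kappa>" "\<bar>y\<bar> \<le> \<kappa>"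
    and nz: "resonance_factor \<kappa> \<eta> k 1 \<noteq> 0" "resonance_factor \<kappa> \<eta> k (-1) \<noteq> 0"
  shows "delta_green \<kappa> \<eta> k x y
    = edge_sol \<eta> k (min x y + \<kappa>) * edge_sol \<eta> k (\<kappa> - max x y) / edge_wronskian \<kappa> \<eta> k"
proof -
  have *: "delta_green \<kappa> \<eta> k x y
    = edge_sol \<eta> k (x + \<kappa>) * edge_sol \<eta> k (\<kappa> - y) / edge_wronskian \<kappa> \<eta> k"
    if "x \<le> y" "- \<kappa> \<le> x" "y \<le> \<kappa>" for x y
  proof -
    define m where "m = 2 * \<i> * of_real \<eta> * k - 1"
    define w where "w = exp (2 * \<i> * of_real \<kappa> * k)"
    define p where "p = exp (\<i> * k * of_real (x + \<kappa>))"
    define r where "r = exp (\<i> * k * of_real (\<kappa> - y))"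
    have pr0: "p \<noteq> 0" "r \<noteq> 0" "w \<noteq> 0" by (auto simp: p_def r_def w_def)
    have wm: "w - m \<noteq> 0" "w + m \<noteq> 0"
    proof -
      have "resonance_factor \<kappa> \<eta> k 1 = \<i> * (w - m)" "resonance_factor \<kappa> \<eta> k (-1) = - (\<i> * (w + m))"
        unfolding resonance_factor_alt w_def m_def by (simp_all add: algebra_simps)
      then show "w - m \<noteq> 0" "w + m \<noteq> 0" using nz by auto
    qed
    \<comment> \<open>With x to the left of y and both in the interval, every absolute value has a
      known sign, and all distances are combinations of 2\<kappa>, x + \<kappa> and \<kappa> -
      y.\<close>
    have e: "exp (\<i> * k * of_real \<bar>x - y\<bar>) = w / (p * r)" "exp (\<i> * k * of_real \<bar>x - \<kappa>\<bar>) = w / p"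
        "exp (\<i> * k * of_real \<bar>x + \<kappa>\<bar>) = p" "exp (\<i> * k * of_real \<bar>y - \<kappa>\<bar>) = r"
        "exp (\<i> * k * of_real \<bar>y + \<kappa>\<bar>) = w / r"
      using that unfolding w_def p_def r_def
      by (simp_all add: exp_add[symmetric] exp_diff[symmetric] algebra_simps)
    have dist: "c * a + \<sigma> * (c * b) = c * (a + \<sigma> * b)" for a b c \<sigma> :: complex
      by (simp add: algebra_simps)
    have ex: "edge_green \<kappa> k \<sigma> x = \<i> / (2 * k) * (w / p + \<sigma> * p)" for \<sigma>
      unfolding edge_green_def free_green_def e by (rule dist)
    have ey: "edge_green \<kappa> k \<sigma> y = \<i> / (2 * k) * (r + \<sigma> * (w / r))" for \<sigma>
      unfolding edge_green_def free_green_def e by (rule dist)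
    have ef: "edge_factor \<kappa> \<eta> k \<sigma> = \<i> * (\<sigma> * w - m) / (2 * k)" for \<sigma>
      unfolding edge_factor_resonance_factor[OF assms(1,2)] resonance_factor_alt w_def m_def ..
    have t: "(\<i> / (2 * k) * a) * (\<i> / (2 * k) * b) / (\<i> * c / (2 * k)) = \<i> / (2 * k) * (a * b / c)"
      for a b c :: complex using assms(1) by (cases "c = 0") (simp_all add: divide_simps)
    have "delta_green \<kappa> \<eta> k x y = \<i> / (2 * k) * (w / (p * r)
       - ((w / p + p) * (r + w / r) / (w - m) + (w / p + (-1) * p) * (r + (-1) * (w / r)) / ((-1) * w - m)) / 2)"
    proof -
      have lin: "c * a - (c * b + c * d) / 2 = c * (a - (b + d) / 2)" for a b c d :: complex
        by (simp add: field_simps)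
      show ?thesis
        unfolding delta_green_def ex ey ef t unfolding free_green_def e mult_1_left by (rule lin)
    qed
    also have "(w / p + (-1) * p) * (r + (-1) * (w / r)) / ((-1) * w - m) = - ((w / p - p) * (r - w / r) / (w + m))"
    proof -
      have "(-1) * w - m = - (w + m)" by simp
      then show ?thesis by (simp only: divide_minus_right) simp
    qed
    also have "w / (p * r) - ((w / p + p) * (r + w / r) / (w - m) + - ((w / p - p) * (r - w / r) / (w + m))) / 2
       = w * (p + m / p) * (r + m / r) / (m\<^sup>2 - w\<^sup>2)"
      using Krein_algebra[OF pr0(1,2) wm] by simp
    also have "\<i> / (2 * k) * (w * (p + m / p) * (r + m / r) / (m\<^sup>2 - w\<^sup>2))
       = ((p + m / p) / (2 * \<i> * k)) * ((r + m / r) / (2 * \<i> * k)) / (\<i> * (m\<^sup>2 - w\<^sup>2) / (2 * w * k))"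
    proof -
      have "m\<^sup>2 - w\<^sup>2 \<noteq> 0" using wm by (simp add: power2_eq_square square_diff_square_factored add.commute)
      moreover have "\<i> / (2 * k) * (w * a * b / c) = (a / (2 * \<i> * k)) * (b / (2 * \<i> * k)) / (\<i> * c / (2 * w * k))"
        if "c \<noteq> 0" for a b c
        using that pr0(3) assms(1) by (simp add: divide_simps) (simp add: mult_ac)
      ultimately show ?thesis by blast
    qed
    also have "\<dots> = edge_sol \<eta> k (x + \<kappa>) * edge_sol \<eta> k (\<kappa> - y) / edge_wronskian \<kappa> \<eta> k"
      unfolding edge_sol_exp[OF assms(1)] edge_wronskian_exp[OF assms(1)] m_def w_def p_def r_def ..
    finally show ?thesis .
  qed
  have sym: "delta_green \<kappa> \<eta> k x y = delta_green \<kappa> \<eta> k y x" for x y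
    by (simp add: delta_green_def free_green_def abs_minus_commute mult.commute)
  show ?thesis
    using *[of x y] *[of y x] sym[of x y] assms(3,4) by (cases "x \<le> y") (auto simp: min_def max_def)
qed

subsection \<open>The Dirichlet operator\<close>

text \<open>The integral equations make u twice differentiable with - u'' = k^2 u. Two combinations
  of (u, u') with the sine and cosine solutions are constant, and solving for u by the Pythagorean
  identity leaves a multiple of the sine solution; the condition at the right end is the second
  conclusion.\<close>

lemma Dirichlet_solution:
  fixes k :: complex
  assumes \<kappa>: "\<kappa> > 0" and H: "H_Dirichlet \<kappa> f (\<lambda>x. k\<^sup>2 * f x)"
  obtains B where "AE x in lborel. f x = B * (indicator {-\<kappa>..\<kappa>} x * (of_real (x + \<kappa>) * csinc (k * of_real (x + \<kappa>))))"
    and "B * csinc (k * of_real (2 * \<kappa>)) = 0"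
proof -
  let ?I = "{-\<kappa>..\<kappa>}"
  let ?w = "\<lambda>x. k\<^sup>2 * f x"
  from H obtain u u' where fL: "f \<in> L2" "?w \<in> L2"
    and out: "AE x in lborel. x \<notin> {-\<kappa><..<\<kappa>} \<longrightarrow> f x = 0 \<and> ?w x = 0"
    and fu: "AE x in lborel. x \<in> {-\<kappa><..<\<kappa>} \<longrightarrow> f x = u x"
    and bc: "u (-\<kappa>) = 0" "u \<kappa> = 0"
    and inc: "\<And>x y. -\<kappa> \<le> x \<Longrightarrow> x \<le> y \<Longrightarrow> y \<le> \<kappa> \<Longrightarrow> u y - u x = (LINT s:{x..y}|lborel. u' s)"
      "\<And>x y. -\<kappa> \<le> x \<Longrightarrow> x \<le> y \<Longrightarrow> y \<le> \<kappa> \<Longrightarrow> u' y - u' x = - (LINT s:{x..y}|lborel. ?w s)"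
    unfolding H_Dirichlet_def by blast
  have u'_eq: "u' y = u' (-\<kappa>) - integral {-\<kappa>..y} ?w" if "y \<in> ?I" for y
  proof -
    have "u' y - u' (-\<kappa>) = - integral {-\<kappa>..y} ?w"
      unfolding set_borel_integral_eq_integral(2)[OF L2_set_integrable[OF fL(2), of "-\<kappa>" y], symmetric]
      by (rule inc(2)) (use that in auto)
    then show ?thesis by (simp only: diff_eq_eq) simp
  qed
  have "continuous_on ?I (\<lambda>y. integral {-\<kappa>..y} ?w)"
    using set_borel_integral_eq_integral(1)[OF L2_set_integrable[OF fL(2)]] by (rule indefinite_integral_continuous_1)
  then have "continuous_on ?I (\<lambda>y. u' (-\<kappa>) - integral {-\<kappa>..y} ?w)" by (intro continuous_intros)
  then have cu': "continuous_on ?I u'" by (rule continuous_on_eq) (rule u'_eq[symmetric])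
  have u_eq: "u y = integral {-\<kappa>..y} u'" if "y \<in> ?I" for y
  proof -
    have "continuous_on {-\<kappa>..y} u'" by (rule continuous_on_subset[OF cu']) (use that in auto)
    then have "set_integrable lborel {-\<kappa>..y} u'" by (rule borel_integrable_atLeastAtMost')
    then show ?thesis using inc(1)[of "-\<kappa>" y] that bc set_borel_integral_eq_integral(2)[of "{-\<kappa>..y}" u'] by simp
  qed
  have du: "(u has_vector_derivative u' x) (at x within ?I)" if "x \<in> ?I" for x
    by (rule has_vector_derivative_transform[OF that u_eq integral_has_vector_derivative[OF cu' that]])
  then have cu: "continuous_on ?I u"
    unfolding continuous_on_eq_continuous_within by (intro ballI has_vector_derivative_continuous[OF du])
  have w_eq: "integral {-\<kappa>..y} ?w = integral {-\<kappa>..y} (\<lambda>x. k\<^sup>2 * u x)" if "y \<in> ?I" for y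
  proof -
    have c: "continuous_on {-\<kappa>..y} (\<lambda>x. k\<^sup>2 * u x)"
      by (intro continuous_intros continuous_on_subset[OF cu]) (use that in auto)
    have "(LINT s:{-\<kappa>..y}|lborel. ?w s) = (LINT s:{-\<kappa>..y}|lborel. k\<^sup>2 * u s)"
      unfolding set_lebesgue_integral_def
    proof (rule integral_cong_AE)
      show "AE x in lborel. indicator {-\<kappa>..y} x *\<^sub>R ?w x = indicator {-\<kappa>..y} x *\<^sub>R (k\<^sup>2 * u x)"
        using fu AE_lborel_singleton[of "-\<kappa>"] AE_lborel_singleton[of \<kappa>]
        by eventually_elim (use that in \<open>auto simp: indicator_def\<close>)
      show "(\<lambda>x. indicator {-\<kappa>..y} x *\<^sub>R ?w x) \<in> borel_measurable lborel"
        using L2_set_integrable[OF fL(2), of "-\<kappa>" y] unfolding set_integrable_def by (rule borel_measurable_integrable)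
      show "(\<lambda>x. indicator {-\<kappa>..y} x *\<^sub>R (k\<^sup>2 * u x)) \<in> borel_measurable lborel"
        using borel_integrable_atLeastAtMost'[OF c] unfolding set_integrable_def by (rule borel_measurable_integrable)
    qed
    then show ?thesis
      by (simp only: set_borel_integral_eq_integral(2)[OF L2_set_integrable[OF fL(2), of "-\<kappa>" y]]
        set_borel_integral_eq_integral(2)[OF borel_integrable_atLeastAtMost'[OF c]])
  qed
  have du': "(u' has_vector_derivative - (k\<^sup>2 * u x)) (at x within ?I)" if "x \<in> ?I" for x
  proof (rule has_vector_derivative_transform[OF that])
    show "u' y = u' (-\<kappa>) - integral {-\<kappa>..y} (\<lambda>x. k\<^sup>2 * u x)" if "y \<in> ?I" for y
      using u'_eq[OF that] w_eq[OF that] by simp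
    have c: "continuous_on ?I (\<lambda>x. k\<^sup>2 * u x)" by (intro continuous_intros cu)
    show "((\<lambda>y. u' (-\<kappa>) - integral {-\<kappa>..y} (\<lambda>x. k\<^sup>2 * u x)) has_vector_derivative - (k\<^sup>2 * u x)) (at x within ?I)"
      using has_vector_derivative_diff[OF has_vector_derivative_const integral_has_vector_derivative[OF c that]] by simp
  qed
  \<comment> \<open>\<open>s\<close> and \<open>c\<close> solve the equation with data (0, 1) and
    (1, 0) at the left end; the sine is divided by k through \<open>csinc\<close>, so k = 0 is
    included.\<close>
  define s where "s = (\<lambda>x::real. of_real (x + \<kappa>) * csinc (k * of_real (x + \<kappa>)))"
  define c where "c = (\<lambda>x::real. cos (k * of_real (x + \<kappa>)))"
  have ks: "k * s x = sin (k * of_real (x + \<kappa>))" for x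
    using csinc_mult[of "k * of_real (x + \<kappa>)"] by (simp add: s_def mult_ac)
  have ds: "(s has_vector_derivative c x) (at x within ?I)" for x
  proof (cases "k = 0")
    case True
    have "((\<lambda>x. complex_of_real (x + \<kappa>)) has_vector_derivative 1) (at x within ?I)"
      by (auto intro!: derivative_eq_intros has_vector_derivative_of_real)
    then show ?thesis using True by (simp add: s_def c_def)
  next
    case False
    have "((\<lambda>z. sin (k * (z + of_real \<kappa>)) / k) has_field_derivative c x) (at (of_real x))"
      using False by (auto intro!: derivative_eq_intros simp: c_def)
    from has_vector_derivative_real_field[OF this]
    have "((\<lambda>x. sin (k * (of_real x + of_real \<kappa>)) / k) has_vector_derivative c x) (at x within ?I)" .
    moreover have "s = (\<lambda>x. sin (k * (of_real x + of_real \<kappa>)) / k)"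
      using ks False by (auto simp: fun_eq_iff field_simps)
    ultimately show ?thesis by simp
  qed
  have dc: "(c has_vector_derivative - (k\<^sup>2 * s x)) (at x within ?I)" for x
  proof -
    have "((\<lambda>z. cos (k * (z + of_real \<kappa>))) has_field_derivative - (k * sin (k * of_real (x + \<kappa>)))) (at (of_real x))"
      by (auto intro!: derivative_eq_intros)
    from has_vector_derivative_real_field[OF this]
    have "((\<lambda>x. cos (k * (of_real x + of_real \<kappa>))) has_vector_derivative - (k * sin (k * of_real (x + \<kappa>)))) (at x within ?I)" .
    then show ?thesis by (simp add: c_def power2_eq_square mult.assoc ks)
  qed
  \<comment> \<open>This first integral is the Wronskian of u and \<open>s\<close>, up to sign; the
    one in \<open>z2\<close> is the Wronskian of u and \<open>c\<close>, up to sign.\<close>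
  have z1: "((\<lambda>x. u x * c x - u' x * s x) has_vector_derivative 0) (at x within ?I)" if x: "x \<in> ?I" for x
      by (rule has_vector_derivative_eq_rhs[OF has_vector_derivative_diff[OF
            has_vector_derivative_mult[OF du[OF x] dc] has_vector_derivative_mult[OF du'[OF x] ds]]])
         (simp add: algebra_simps)
  obtain C1 where C1: "\<And>x. x \<in> ?I \<Longrightarrow> u x * c x - u' x * s x = C1"
    by (rule has_vector_derivative_zero_constant[OF convex_real_interval(5) z1]) auto
  have W1: "u x * c x - u' x * s x = 0" if "x \<in> ?I" for x
    using C1[OF that] C1[of "-\<kappa>"] bc \<kappa> by (simp add: s_def)
  have z2: "((\<lambda>x. u x * (k\<^sup>2 * s x) + u' x * c x) has_vector_derivative 0) (at x within ?I)" if x: "x \<in> ?I" for x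
      by (rule has_vector_derivative_eq_rhs[OF has_vector_derivative_add[OF
            has_vector_derivative_mult[OF du[OF x] has_vector_derivative_mult[OF has_vector_derivative_const ds]]
            has_vector_derivative_mult[OF du'[OF x] dc]]])
         (simp add: algebra_simps)
  obtain C2 where C2: "\<And>x. x \<in> ?I \<Longrightarrow> u x * (k\<^sup>2 * s x) + u' x * c x = C2"
    by (rule has_vector_derivative_zero_constant[OF convex_real_interval(5) z2]) auto
  have W2: "u x * (k\<^sup>2 * s x) + u' x * c x = u' (-\<kappa>)" if "x \<in> ?I" for x
    using C2[OF that] C2[of "-\<kappa>"] bc \<kappa> by (simp add: c_def)
  have us: "u x = u' (-\<kappa>) * s x" if "x \<in> ?I" for x
  proof -
    have "(c x)\<^sup>2 + (k * s x)\<^sup>2 = 1" unfolding ks c_def by simp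
    then have "u x = u x * ((c x)\<^sup>2 + (k * s x)\<^sup>2)" by simp
    also have "\<dots> = c x * (u x * c x - u' x * s x) + s x * (u x * (k\<^sup>2 * s x) + u' x * c x)"
      by (simp add: power2_eq_square algebra_simps)
    also have "\<dots> = u' (-\<kappa>) * s x" unfolding W1[OF that] W2[OF that] by simp
    finally show ?thesis .
  qed
  show thesis
  proof (rule that[of "u' (-\<kappa>)"])
    show "AE x in lborel. f x = u' (-\<kappa>) * (indicator ?I x * (of_real (x + \<kappa>) * csinc (k * of_real (x + \<kappa>))))"
      using fu out AE_lborel_singleton[of "-\<kappa>"] AE_lborel_singleton[of \<kappa>]
    proof eventually_elim
      case (elim x)
      show ?case
      proof (cases "x \<in> {-\<kappa><..<\<kappa>}")
        case True
        then show ?thesis using elim us[of x] by (simp add: s_def)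
      qed (use elim in \<open>auto simp: indicator_def\<close>)
    qed
    have "u' (-\<kappa>) * s \<kappa> = 0" using us[of \<kappa>] bc \<kappa> by simp
    then show "u' (-\<kappa>) * csinc (k * of_real (2 * \<kappa>)) = 0" using \<kappa> by (auto simp: s_def)
  qed
qed

text \<open>The eigenfunction before normalisation when \<open>sin (k * (2 * \<kappa>)) = 0\<close>.
  Its squared norm is then \<kappa>, the origin of the factor 1/\<kappa> in the
  coefficients.\<close>

definition box_sin :: "real \<Rightarrow> real \<Rightarrow> real \<Rightarrow> complex" where
  "box_sin \<kappa> k x = indicator {-\<kappa>..\<kappa>} x * of_real (sin (k * (x + \<kappa>)))"

lemma box_sin_L2: "box_sin \<kappa> k \<in> L2"
proof -
  have m: "box_sin \<kappa> k \<in> borel_measurable borel" unfolding box_sin_def by measurable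
  have "integrable lborel (\<lambda>x. (cmod (box_sin \<kappa> k x))\<^sup>2)"
  proof (rule Bochner_Integration.integrable_bound)
    show "integrable lborel (indicator {-\<kappa>..\<kappa>} :: real \<Rightarrow> real)"
      by (intro integrable_real_indicator) (auto simp: emeasure_lborel_Icc_eq)
    show "AE x in lborel. norm ((cmod (box_sin \<kappa> k x))\<^sup>2) \<le> norm (indicator {-\<kappa>..\<kappa>} x :: real)"
      by (auto simp: box_sin_def norm_mult indicator_def abs_square_le_1)
  qed (use m in measurable)
  then show ?thesis using m by (simp add: L2_def)
qed

lemma box_sin_norm:
  assumes "\<kappa> > 0" "k > 0" "sin (k * (2 * \<kappa>)) = 0"
  shows "(l2_norm (box_sin \<kappa> k))\<^sup>2 = \<kappa>"
proof -
  have "(l2_norm (box_sin \<kappa> k))\<^sup>2 = (LINT x:{-\<kappa>..\<kappa>}|lborel. (sin (k * (x + \<kappa>)))\<^sup>2)"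
    unfolding l2_norm_def set_lebesgue_integral_def
    by (simp, intro Bochner_Integration.integral_cong) (auto simp: box_sin_def norm_mult indicator_def)
  also have "\<dots> = integral {-\<kappa>..\<kappa>} (\<lambda>x. (sin (k * (x + \<kappa>)))\<^sup>2)"
    by (intro set_borel_integral_eq_integral(2) borel_integrable_atLeastAtMost' continuous_intros)
  also have "\<dots> = (\<kappa> / 2 - sin (2 * (k * (\<kappa> + \<kappa>))) / (4 * k)) - (-\<kappa> / 2 - sin (2 * (k * (-\<kappa> + \<kappa>))) / (4 * k))"
  proof (rule integral_unique, rule fundamental_theorem_of_calculus)
    show "((\<lambda>x. x / 2 - sin (2 * (k * (x + \<kappa>))) / (4 * k)) has_vector_derivative (sin (k * (x + \<kappa>)))\<^sup>2) (at x within {-\<kappa>..\<kappa>})" for x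
    proof -
      have "((\<lambda>x. x / 2 - sin (2 * (k * (x + \<kappa>))) / (4 * k)) has_real_derivative (1 / 2 - cos (2 * (k * (x + \<kappa>))) * (2 * k) / (4 * k))) (at x within {-\<kappa>..\<kappa>})"
        using assms(2) by (auto intro!: derivative_eq_intros)
      also have "1 / 2 - cos (2 * (k * (x + \<kappa>))) * (2 * k) / (4 * k) = (sin (k * (x + \<kappa>)))\<^sup>2"
        using assms(2) unfolding cos_double_sin by (simp add: diff_divide_distrib)
      finally show ?thesis by (simp add: has_real_derivative_iff_has_vector_derivative)
    qed
  qed (use assms in simp)
  also have "\<dots> = \<kappa>"
  proof -
    have "k * (\<kappa> + \<kappa>) = k * (2 * \<kappa>)" by simp
    then have "sin (2 * (k * (\<kappa> + \<kappa>))) = 0" by (simp only: sin_double assms(3); simp)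
    then show ?thesis by (simp only:; simp)
  qed
  finally show ?thesis .
qed

text \<open>A nontrivial solution needs a zero of \<open>csinc\<close>. The zeros of the complex
  sine are real and \<open>csinc 0 = 1\<close>, so k is real and nonzero; this excludes E = 0 and
  negative E.\<close>

lemma Dirichlet_eigenfunction:
  assumes \<kappa>: "\<kappa> > 0" and f: "eigenfunction (H_Dirichlet \<kappa>) (of_real E) f"
  shows "E > 0" "sin (sqrt E * (2 * \<kappa>)) = 0" "\<exists>B. l2_eq f (\<lambda>x. B * box_sin \<kappa> (sqrt E) x)"
proof -
  define k where "k = csqrt (of_real E)"
  have k2: "k\<^sup>2 = of_real E" by (simp add: k_def)
  have nz: "\<not> l2_eq f (\<lambda>x. 0)" and H: "H_Dirichlet \<kappa> f (\<lambda>x. k\<^sup>2 * f x)"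
    using f by (auto simp: eigenfunction_def k2)
  obtain B where B: "AE x in lborel. f x = B * (indicator {-\<kappa>..\<kappa>} x * (of_real (x + \<kappa>) * csinc (k * of_real (x + \<kappa>))))"
    "B * csinc (k * of_real (2 * \<kappa>)) = 0"
    using Dirichlet_solution[OF \<kappa> H] .
  have "B \<noteq> 0" using B(1) nz by (auto simp: l2_eq_def)
  then have "csinc (k * of_real (2 * \<kappa>)) = 0" using B(2) by simp
  then have s0: "k * of_real (2 * \<kappa>) \<noteq> 0" "sin (k * of_real (2 * \<kappa>)) = 0" by (auto simp: csinc_eq_0_iff)
  from s0(2) obtain m :: int where m: "k * of_real (2 * \<kappa>) = of_real (real_of_int m * pi)"
    by (auto simp: sin_eq_0)
  then have "k = of_real (real_of_int m * pi / (2 * \<kappa>))" using \<kappa> by (simp add: field_simps)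
  then obtain k' where k': "k = of_real k'" by blast
  have "k' \<noteq> 0" using s0(1) k' by auto
  moreover have "E = k'\<^sup>2" using k2 unfolding k' by (metis of_real_eq_iff of_real_power)
  ultimately show E0: "E > 0" by simp
  have k: "k = of_real (sqrt E)" using E0 by (simp add: k_def flip: of_real_sqrt)
  have "complex_of_real (sin (sqrt E * (2 * \<kappa>))) = 0" using s0(2) unfolding k by (simp flip: sin_of_real)
  then show "sin (sqrt E * (2 * \<kappa>)) = 0" by (simp only: of_real_eq_0_iff)
  have "of_real (x + \<kappa>) * csinc (k * of_real (x + \<kappa>)) = of_real (sin (sqrt E * (x + \<kappa>))) / k" for x
  proof -
    have "k * (of_real (x + \<kappa>) * csinc (k * of_real (x + \<kappa>))) = sin (k * of_real (x + \<kappa>))"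
      using csinc_mult[of "k * of_real (x + \<kappa>)"] by (simp add: mult_ac)
    also have "\<dots> = of_real (sin (sqrt E * (x + \<kappa>)))" unfolding k by (simp flip: sin_of_real)
    finally show ?thesis using s0(1) by (auto simp: field_simps)
  qed
  then have "l2_eq f (\<lambda>x. (B / k) * box_sin \<kappa> (sqrt E) x)"
    using B(1) by (simp add: l2_eq_def box_sin_def mult_ac)
  then show "\<exists>B. l2_eq f (\<lambda>x. B * box_sin \<kappa> (sqrt E) x)" by blast
qed

text \<open>Eigenvalues are simple, so a normalised eigenfunction is a multiple of
  \<open>box_sin\<close> with a coefficient of squared modulus 1/\<kappa>. Its phase drops out of
  the squared modulus.\<close>

lemma Dirichlet_coefficient:
  assumes \<kappa>: "\<kappa> > 0" and f: "eigenfunction (H_Dirichlet \<kappa>) (of_real E) f" "l2_norm f = 1" and \<phi>: "\<phi> \<in> L2"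
  shows "(cmod (l2_inner \<phi> f))\<^sup>2 = (cmod (l2_inner \<phi> (box_sin \<kappa> (sqrt E))))\<^sup>2 / \<kappa>"
proof -
  note E = Dirichlet_eigenfunction[OF \<kappa> f(1)]
  obtain B where B: "l2_eq f (\<lambda>x. B * box_sin \<kappa> (sqrt E) x)" using E(3) by blast
  let ?b = "\<lambda>x. B * box_sin \<kappa> (sqrt E) x"
  have fL: "f \<in> L2" "?b \<in> L2" using f(1) by (auto simp: eigenfunction_def intro: L2_cmult box_sin_L2)
  have "l2_inner f f = l2_inner ?b ?b" by (rule l2_inner_cong[OF fL fL B B])
  also have "\<dots> = cnj B * B * l2_inner (box_sin \<kappa> (sqrt E)) (box_sin \<kappa> (sqrt E))"
    unfolding l2_inner_def by (subst integral_mult_right_zero[symmetric]) (simp add: mult_ac)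
  finally have "1 = cnj B * B * of_real \<kappa>"
    using f(2) box_sin_norm[OF \<kappa> _ E(2)] E(1) by (simp add: l2_inner_self)
  then have "complex_of_real 1 = of_real ((cmod B)\<^sup>2 * \<kappa>)" 
    by (simp add: complex_norm_square mult.commute del: of_real_power)
  then have nB: "(cmod B)\<^sup>2 = 1 / \<kappa>" using \<kappa> by (simp only: of_real_eq_iff) (simp add: field_simps)
  have "l2_inner \<phi> f = l2_inner \<phi> ?b" by (rule l2_inner_cong[OF \<phi> \<phi> fL]) (use B in auto)
  also have "\<dots> = B * l2_inner \<phi> (box_sin \<kappa> (sqrt E))"
    unfolding l2_inner_def by (subst integral_mult_right_zero[symmetric]) (simp add: mult_ac)
  finally show ?thesis by (simp add: norm_mult power_mult_distrib nB)
qed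

text \<open>The converse direction, through which assumptions about eigenvalues exclude zeros of the
  Wronskian at \<eta> = 0.\<close>

lemma Dirichlet_eigenvalue:
  assumes \<kappa>: "\<kappa> > 0" and k: "k > 0" "sin (k * (2 * \<kappa>)) = 0"
  shows "eigenvalue (H_Dirichlet \<kappa>) (of_real (k\<^sup>2))"
proof -
  let ?f = "box_sin \<kappa> k"
  let ?w = "\<lambda>x. of_real (k\<^sup>2) * ?f x"
  let ?u = "\<lambda>x. complex_of_real (sin (k * (x + \<kappa>)))"
  let ?u' = "\<lambda>x. complex_of_real (k * cos (k * (x + \<kappa>)))"
  have wL: "?w \<in> L2" by (intro L2_cmult box_sin_L2)
  have FTC: "of_real (F y) - of_real (F x) = (LINT s:{x..y}|lborel. complex_of_real (F' s))"
    if "x \<le> y" "\<And>x. (F has_real_derivative F' x) (at x)" "\<And>S. continuous_on S F'" for F F' :: "real \<Rightarrow> real" and x y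
  proof -
    have "(F' has_integral (F y - F x)) {x..y}"
      using that(1,2) by (intro fundamental_theorem_of_calculus)
        (auto simp: has_real_derivative_iff_has_vector_derivative[symmetric] intro: has_field_derivative_at_within)
    moreover have i: "set_integrable lborel {x..y} F'" by (intro borel_integrable_atLeastAtMost' that(3))
    ultimately have "(LINT s:{x..y}|lborel. F' s) = F y - F x"
      using set_borel_integral_eq_integral(2)[OF i] integral_unique by metis
    moreover have "(LINT s:{x..y}|lborel. complex_of_real (F' s)) = of_real (LINT s:{x..y}|lborel. F' s)"
      unfolding set_lebesgue_integral_def
      by (subst integral_complex_of_real[symmetric]) (auto intro!: Bochner_Integration.integral_cong simp: indicator_def)
    ultimately show ?thesis by simp
  qed
  have out: "AE x in lborel. x \<notin> {-\<kappa><..<\<kappa>} \<longrightarrow> ?f x = 0 \<and> ?w x = 0"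
    using AE_lborel_singleton[of "-\<kappa>"] AE_lborel_singleton[of \<kappa>]
    by eventually_elim (auto simp: box_sin_def indicator_def)
  have "H_Dirichlet \<kappa> ?f ?w"
    unfolding H_Dirichlet_def
  proof (rule conjI[OF box_sin_L2 conjI[OF wL conjI[OF out]]], rule exI[of _ ?u], rule exI[of _ ?u'],
      intro conjI allI impI)
    show "AE x in lborel. x \<in> {-\<kappa><..<\<kappa>} \<longrightarrow> ?f x = ?u x"
      by (auto simp: box_sin_def indicator_def)
    have "k * (\<kappa> + \<kappa>) = k * (2 * \<kappa>)" by simp
    then show "?u \<kappa> = 0" by (simp only: k(2) of_real_0)
    fix x y assume xy: "- \<kappa> \<le> x \<and> x \<le> y \<and> y \<le> \<kappa>"
    show "?u y - ?u x = (LINT s:{x..y}|lborel. ?u' s)"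
      by (rule FTC) (use xy in \<open>auto intro!: derivative_eq_intros continuous_intros\<close>)
    have "?u' y - ?u' x = (LINT s:{x..y}|lborel. complex_of_real (- (k\<^sup>2 * sin (k * (s + \<kappa>)))))"
      by (rule FTC) (use xy in \<open>auto intro!: derivative_eq_intros continuous_intros simp: power2_eq_square\<close>)
    also have "\<dots> = (LINT s:{x..y}|lborel. - ?w s)"
      by (rule set_lebesgue_integral_cong) (use xy in \<open>auto simp: box_sin_def indicator_def\<close>)
    also have "\<dots> = - (LINT s:{x..y}|lborel. ?w s)"
      unfolding set_lebesgue_integral_def scaleR_minus_right by (rule Bochner_Integration.integral_minus)
    finally show "?u' y - ?u' x = - (LINT s:{x..y}|lborel. ?w s)" .
  qed simp
  moreover have "\<not> l2_eq ?f (\<lambda>x. 0)"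
  proof
    assume "l2_eq ?f (\<lambda>x. 0)"
    then have "l2_inner ?f ?f = l2_inner (\<lambda>x. 0) (\<lambda>x. 0)"
      by (intro l2_inner_cong box_sin_L2 L2_zero)
    then show False using box_sin_norm[OF \<kappa> k] \<kappa> by (simp add: l2_inner_self) (simp add: l2_norm_def)
  qed
  ultimately show ?thesis unfolding eigenvalue_def eigenfunction_def using box_sin_L2 by blast
qed

subsection \<open>Stone's formula\<close>

text \<open>A functional known only to be linear and continuous under bounded pointwise limits is
  exchanged with an integral by way of finite sums; this lemma provides them.\<close>

lemma riemann_sum_tendsto:
  fixes F :: "real \<Rightarrow> complex"
  assumes cont: "continuous_on {p..q} F" and pq: "p \<le> q"
  shows "(\<lambda>N. \<Sum>i<N. of_real ((q - p) / real N) * F (p + real i * ((q - p) / real N))) \<longlonglongrightarrow> integral {p..q} F"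
proof (rule LIMSEQ_I)
  fix e :: real assume e: "e > 0"
  \<comment> \<open>The added 1 keeps the denominator positive when p = q.\<close>
  define e' where "e' = e / (2 * (q - p + 1))"
  have e': "e' > 0" using e pq by (simp add: e'_def)
  have "uniformly_continuous_on {p..q} F"
    by (intro compact_uniformly_continuous cont) simp
  then obtain d where d: "d > 0" "\<And>x y. x \<in> {p..q} \<Longrightarrow> y \<in> {p..q} \<Longrightarrow> dist y x < d \<Longrightarrow> dist (F y) (F x) < e'"
    using e' unfolding uniformly_continuous_on_def by metis
  obtain N0 :: nat where N0: "(q - p) / d < real N0" using reals_Archimedean2 by blast
  show "\<exists>no. \<forall>N\<ge>no. norm ((\<Sum>i<N. of_real ((q - p) / real N) * F (p + real i * ((q - p) / real N))) - integral {p..q} F) < e"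
  proof (intro exI allI impI)
    \<comment> \<open>N is at least 1 so that N times the mesh is q - p; division by zero would give
      mesh 0.\<close>
    fix N assume N: "max 1 N0 \<le> N"
    define h where "h = (q - p) / real N"
    have h0: "h \<ge> 0" using pq by (simp add: h_def)
    have hd: "h < d"
    proof -
      have "q - p < d * real N0" using N0 d(1) by (simp add: field_simps)
      also have "\<dots> \<le> d * real N" using N d(1) by (intro mult_left_mono) auto
      finally show ?thesis using N by (simp add: h_def field_simps)
    qed
    have hN: "real N * h = q - p" using N by (simp add: h_def)
    have "n \<le> N \<Longrightarrow> norm ((\<Sum>i<n. of_real h * F (p + real i * h)) - integral {p..p + real n * h} F) \<le> real n * (e' * h)" for n
    proof (induction n)
      case (Suc n)
      let ?x = "p + real n * h"
      let ?y = "p + real (Suc n) * h"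
      have y: "?y = ?x + h" by (simp add: algebra_simps)
      have "real (Suc n) * h \<le> real N * h" using Suc.prems h0 by (intro mult_right_mono) auto
      then have yq: "?y \<le> q" using hN by simp
      have px: "p \<le> ?x" using h0 by simp
      have cy: "continuous_on {p..?y} F" by (rule continuous_on_subset[OF cont]) (use yq in auto)
      have cxy: "continuous_on {?x..?y} F" by (rule continuous_on_subset[OF cont]) (use yq px in auto)
      have comb: "integral {p..?y} F = integral {p..?x} F + integral {?x..?y} F"
        by (rule Henstock_Kurzweil_Integration.integral_combine[symmetric])
           (use px h0 y cy in \<open>auto intro: integrable_continuous_real\<close>)
      have "norm (integral {?x..?y} (\<lambda>t. F t - F ?x)) \<le> e' * (?y - ?x)"
      proof (rule integral_bound)
        show "?x \<le> ?y" using y h0 by simp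
        show "continuous_on {?x..?y} (\<lambda>t. F t - F ?x)" by (intro continuous_intros cxy)
        show "norm (F t - F ?x) \<le> e'" if "t \<in> {?x..?y}" for t
        proof -
          have t: "?x \<le> t" "t \<le> ?y" using that by (simp_all only: atLeastAtMost_iff)
          have "dist t ?x < d" using t y hd by (simp add: dist_real_def)
          moreover have "t \<in> {p..q}" using t px yq unfolding atLeastAtMost_iff by linarith
          moreover have "?x \<in> {p..q}" using t px yq unfolding atLeastAtMost_iff by linarith
          ultimately have "dist (F t) (F ?x) < e'" by (intro d(2))
          then show ?thesis by (simp add: dist_norm)
        qed
      qed
      moreover have "integral {?x..?y} (\<lambda>t. F t - F ?x) = integral {?x..?y} F - of_real h * F ?x"
        using integrable_continuous_real[OF cxy] y h0
        by (subst Henstock_Kurzweil_Integration.integral_diff) (auto simp: scaleR_conv_of_real)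
      ultimately have 1: "norm (integral {?x..?y} F - of_real h * F ?x) \<le> e' * h"
        using y by simp
      have 2: "norm ((\<Sum>i<n. of_real h * F (p + real i * h)) - integral {p..?x} F) \<le> real n * (e' * h)"
        by (rule Suc.IH) (use Suc.prems in simp)
      have "(\<Sum>i<Suc n. of_real h * F (p + real i * h)) - integral {p..?y} F
        = ((\<Sum>i<n. of_real h * F (p + real i * h)) - integral {p..?x} F) - (integral {?x..?y} F - of_real h * F ?x)"
        unfolding comb by simp
      also have "norm \<dots> \<le> real n * (e' * h) + e' * h"
        by (rule order_trans[OF norm_triangle_ineq4 add_mono[OF 2 1]])
      finally show ?case by (simp add: algebra_simps)
    qed simp
    from this[of N] have "norm ((\<Sum>i<N. of_real h * F (p + real i * h)) - integral {p..q} F) \<le> e' * (q - p)"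
      using hN by (simp add: mult.left_commute)
    also have "\<dots> < e"
    proof -
      have aux: "e / (2 * x) * x = e / 2" if "x \<noteq> 0" for x :: real using that by simp
      have "e' * (q - p) \<le> e' * (q - p + 1)" using e' by simp
      also have "\<dots> = e / 2" unfolding e'_def by (rule aux) (use pq in simp)
      finally show ?thesis using e by simp
    qed
    finally show "norm ((\<Sum>i<N. of_real ((q - p) / real N) * F (p + real i * ((q - p) / real N))) - integral {p..q} F) < e"
      by (simp add: h_def)
  qed
qed

section \<open>Poisson kernels as approximate identity\<close>

definition cauchy_density :: "real \<Rightarrow> real" where
  "cauchy_density x = 1 / (pi * (1 + x\<^sup>2))"

lemma cauchy_density_pos: "0 < cauchy_density x"
  by (simp add: cauchy_density_def add_pos_nonneg)

lemma continuous_on_cauchy_density [continuous_intros]: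
  "continuous_on A f \<Longrightarrow> continuous_on A (\<lambda>x. cauchy_density (f x))"
  unfolding cauchy_density_def
  by (intro continuous_intros) (auto simp: add_nonneg_eq_0_iff)

lemma cauchy_density_measurable [measurable]: "cauchy_density \<in> borel_measurable borel"
  unfolding cauchy_density_def by measurable

lemma cauchy_density_integrable: "integrable lborel cauchy_density"
  and cauchy_density_integral: "(LINT x|lborel. cauchy_density x) = 1"
proof -
  have e: "einterval (-\<infinity>) \<infinity> = UNIV" by (auto simp: einterval_def)
  have i: "integrable lborel (\<lambda>x::real. inverse (1 + x^2))"
    using integrable_inverse_1_plus_square unfolding e by (simp add: set_integrable_def)
  have v: "(LINT x|lborel. inverse (1 + x^2)) = pi"
    using LBINT_inverse_1_plus_square
    unfolding interval_lebesgue_integral_def e by (simp add: set_lebesgue_integral_def)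
  have c: "cauchy_density = (\<lambda>x. (1 / pi) * inverse (1 + x^2))"
    by (auto simp: cauchy_density_def fun_eq_iff divide_simps)
  show "integrable lborel cauchy_density" unfolding c by (intro integrable_mult_right i)
  show "(LINT x|lborel. cauchy_density x) = 1" unfolding c by (simp add: v)
qed

text \<open>It has two roles: a smoothing kernel with scale tending to 0 in Stone's formula, and the
  line shape of a resonance with scale minus the imaginary part of the resonance.\<close>

definition poisson :: "real \<Rightarrow> real \<Rightarrow> real" where
  "poisson \<epsilon> x = cauchy_density (x / \<epsilon>) / \<epsilon>"

lemma poisson_alt: "\<epsilon> > 0 \<Longrightarrow> poisson \<epsilon> x = \<epsilon> / (pi * (x\<^sup>2 + \<epsilon>\<^sup>2))"
  by (simp add: poisson_def cauchy_density_def divide_simps add_nonneg_eq_0_iff)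
     (simp add: power2_eq_square algebra_simps)

lemma poisson_pos: "\<epsilon> > 0 \<Longrightarrow> 0 < poisson \<epsilon> x"
  by (simp add: poisson_def cauchy_density_pos)

lemma poisson_bound:
  assumes "\<epsilon> > 0" shows "poisson \<epsilon> x \<le> 1 / (pi * \<epsilon>)"
proof -
  have "cauchy_density y \<le> 1 / pi" for y
    unfolding cauchy_density_def by (intro divide_left_mono) (auto simp: add_pos_nonneg)
  from divide_right_mono[OF this, of \<epsilon> "x / \<epsilon>"] show ?thesis using assms by (simp add: poisson_def)
qed

lemma continuous_on_poisson [continuous_intros]:
  "continuous_on A f \<Longrightarrow> continuous_on A (\<lambda>x. poisson \<epsilon> (f x))"
  unfolding poisson_def divide_inverse by (intro continuous_intros)

lemma poisson_measurable [measurable]: "poisson \<epsilon> \<in> borel_measurable borel"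
  unfolding poisson_def by measurable

lemma poisson_integral_subst:
  fixes g :: "real \<Rightarrow> complex"
  assumes "\<epsilon> > 0"
  shows "(LINT l|lborel. g l * of_real (poisson \<epsilon> (s - l))) = (LINT x|lborel. g (s + \<epsilon> * x) * of_real (cauchy_density x))"
proof -
  have "(LINT l|lborel. g l * of_real (poisson \<epsilon> (s - l)))
      = \<epsilon> *\<^sub>R (LINT x|lborel. g (s + \<epsilon> * x) * of_real (poisson \<epsilon> (s - (s + \<epsilon> * x))))"
    using assms by (subst lborel_integral_real_affine[where c = \<epsilon> and t = s]) auto
  also have "\<dots> = (LINT x|lborel. \<epsilon> *\<^sub>R (g (s + \<epsilon> * x) * of_real (poisson \<epsilon> (s - (s + \<epsilon> * x)))))"
    by (rule integral_scaleR_right[symmetric])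
  also have "\<dots> = (LINT x|lborel. g (s + \<epsilon> * x) * of_real (cauchy_density x))"
    using assms by (intro Bochner_Integration.integral_cong refl)
      (simp add: poisson_def cauchy_density_def scaleR_conv_of_real)
  finally show ?thesis .
qed

lemma poisson_approx_identity:
  fixes g :: "real \<Rightarrow> complex"
  assumes g: "continuous_on UNIV g" "\<And>x. norm (g x) \<le> C"
    and e: "\<And>n. e n > 0" "e \<longlonglongrightarrow> 0"
  shows "(\<lambda>n. LINT l|lborel. g l * of_real (poisson (e n) (s - l))) \<longlonglongrightarrow> g s"
    and "norm (LINT l|lborel. g l * of_real (poisson (e n) (s - l))) \<le> C"
proof -
  have [measurable]: "g \<in> borel_measurable borel" using g(1) by (rule borel_measurable_continuous_onI)
  have b: "norm (g x * of_real (cauchy_density y)) \<le> C * cauchy_density y" for x y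
    using g(2)[of x] cauchy_density_pos[of y] by (simp add: norm_mult)
  have i: "integrable lborel (\<lambda>x. C * cauchy_density x)"
    by (intro integrable_mult_right cauchy_density_integrable)
  have "(\<lambda>n. LINT x|lborel. g (s + e n * x) * of_real (cauchy_density x)) \<longlonglongrightarrow> (LINT x|lborel. g s * of_real (cauchy_density x))"
  proof (rule integral_dominated_convergence[where w = "\<lambda>x. C * cauchy_density x"])
    show "AE x in lborel. (\<lambda>n. g (s + e n * x) * of_real (cauchy_density x)) \<longlonglongrightarrow> g s * of_real (cauchy_density x)"
    proof (intro AE_I2 tendsto_mult tendsto_const)
      fix x
      have "(\<lambda>n. s + e n * x) \<longlonglongrightarrow> s + 0 * x" by (intro tendsto_intros e)
      then have "(\<lambda>n. s + e n * x) \<longlonglongrightarrow> s" by simp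
      moreover have "isCont g s" using g(1) by (simp add: continuous_on_eq_continuous_at)
      ultimately show "(\<lambda>n. g (s + e n * x)) \<longlonglongrightarrow> g s" by (rule isCont_tendsto_compose[rotated])
    qed
  qed (use i b in auto)
  also have "(LINT x|lborel. g s * of_real (cauchy_density x)) = g s"
    by (simp add: cauchy_density_integral)
  finally show "(\<lambda>n. LINT l|lborel. g l * of_real (poisson (e n) (s - l))) \<longlonglongrightarrow> g s"
    unfolding poisson_integral_subst[OF e(1)] .
  have "norm (LINT x|lborel. g (s + e n * x) * of_real (cauchy_density x)) \<le> (LINT x|lborel. C * cauchy_density x)"
  proof (rule order_trans[OF integral_norm_bound integral_mono])
    have "integrable lborel (\<lambda>x. g (s + e n * x) * of_real (cauchy_density x))"
      by (rule Bochner_Integration.integrable_bound[OF i])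
         (use b in \<open>auto intro: order_trans[OF _ abs_ge_self]\<close>)
    then show "integrable lborel (\<lambda>x. norm (g (s + e n * x) * of_real (cauchy_density x)))"
      by (rule integrable_norm)
  qed (use i b in auto)
  then show "norm (LINT l|lborel. g l * of_real (poisson (e n) (s - l))) \<le> C"
    unfolding poisson_integral_subst[OF e(1)] by (simp add: cauchy_density_integral)
qed

text \<open>Integration against the spectral measure of a state, without constructing the measure:
  continuity under bounded pointwise limits stands in for countable additivity.\<close>

locale spectral_functional =
  fixes L :: "(real \<Rightarrow> complex) \<Rightarrow> complex"
  assumes lin: "h \<in> bounded_borel \<Longrightarrow> k \<in> bounded_borel \<Longrightarrow> L (\<lambda>s. c * h s + k s) = c * L h + L k"
    and cnj: "h \<in> bounded_borel \<Longrightarrow> L (\<lambda>s. cnj (h s)) = cnj (L h)"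
    and lim: "(\<And>n. h' n \<in> bounded_borel) \<Longrightarrow> h \<in> bounded_borel \<Longrightarrow>
        (\<And>s. (\<lambda>n. h' n s) \<longlonglongrightarrow> h s) \<Longrightarrow> (\<And>n s. cmod (h' n s) \<le> C) \<Longrightarrow> (\<lambda>n. L (h' n)) \<longlonglongrightarrow> L h"

lemma bounded_borelI:
  "h \<in> borel_measurable borel \<Longrightarrow> (\<And>s. cmod (h s) \<le> C) \<Longrightarrow> h \<in> bounded_borel"
  by (auto simp: bounded_borel_def bounded_iff)

lemma bounded_borel_lincomb:
  assumes "h \<in> bounded_borel" "k \<in> bounded_borel"
  shows "(\<lambda>s. c * h s + k s) \<in> bounded_borel"
proof -
  obtain A B where "\<And>s. cmod (h s) \<le> A" "\<And>s. cmod (k s) \<le> B"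
    using assms by (auto simp: bounded_borel_def bounded_iff)
  then have "cmod (c * h s + k s) \<le> cmod c * A + B" for s
    by (intro order_trans[OF norm_triangle_ineq] add_mono) (auto simp: norm_mult intro: mult_left_mono)
  moreover have "(\<lambda>s. c * h s + k s) \<in> borel_measurable borel"
    using assms by (auto simp: bounded_borel_def)
  ultimately show ?thesis by (rule bounded_borelI[rotated])
qed

lemma bounded_borel_zero: "(\<lambda>s. 0) \<in> bounded_borel"
  by (rule bounded_borelI[of _ 0]) auto

lemma bounded_borel_sum:
  "(\<And>i. i < n \<Longrightarrow> h i \<in> bounded_borel) \<Longrightarrow> (\<lambda>s. \<Sum>i<n::nat. c i * h i s) \<in> bounded_borel"
proof (induction n)
  case (Suc n)
  then show ?case
    using bounded_borel_lincomb[of "h n" "\<lambda>s. \<Sum>i<n. c i * h i s" "c n"] by (simp add: add.commute)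
qed (simp add: bounded_borel_zero)

context spectral_functional
begin

lemma zero: "L (\<lambda>s. 0) = 0"
  using lin[OF bounded_borel_zero bounded_borel_zero, of 1] by simp

lemma sum:
  "(\<And>i. i < n \<Longrightarrow> h i \<in> bounded_borel) \<Longrightarrow> L (\<lambda>s. \<Sum>i<n::nat. c i * h i s) = (\<Sum>i<n. c i * L (h i))"
proof (induction n)
  case (Suc n)
  then show ?case
    using lin[of "h n" "\<lambda>s. \<Sum>i<n. c i * h i s" "c n"] bounded_borel_sum[of n h c] by (simp add: add.commute)
qed (simp add: zero)

lemma resolvent_bounded_borel:
  assumes "Im z \<noteq> 0"
  shows "(\<lambda>s. 1 / (of_real s - z)) \<in> bounded_borel"
proof (rule bounded_borelI)
  fix s :: real
  have "\<bar>Im z\<bar> \<le> cmod (of_real s - z)" using abs_Im_le_cmod[of "of_real s - z"] by simp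
  then show "cmod (1 / (of_real s - z)) \<le> 1 / \<bar>Im z\<bar>"
    using assms frac_le[of 1 1 "\<bar>Im z\<bar>" "cmod (of_real s - z)"] by (simp add: norm_divide)
qed measurable

text \<open>The Poisson kernel is the difference of the resolvent function and its conjugate divided
  by 2 pi i, so linearity and compatibility with conjugation suffice.\<close>

lemma poisson_value:
  assumes "\<epsilon> > 0"
  shows "L (\<lambda>s. of_real (poisson \<epsilon> (s - l))) = of_real (Im (L (\<lambda>s. 1 / (of_real s - Complex l \<epsilon>))) / pi)"
proof -
  let ?r = "\<lambda>s. 1 / (of_real s - Complex l \<epsilon>)"
  have r: "?r \<in> bounded_borel" using assms by (intro resolvent_bounded_borel) simp
  have rc: "(\<lambda>s. cnj (?r s)) \<in> bounded_borel"
    using resolvent_bounded_borel[of "cnj (Complex l \<epsilon>)"] assms by simp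
  let ?c = "1 / (2 * \<i> * of_real pi)"
  have eq: "of_real (poisson \<epsilon> (s - l)) = ?c * ?r s + ((- ?c) * cnj (?r s) + 0)" for s
  proof -
    have "?c * ?r s + ((- ?c) * cnj (?r s) + 0) = ?c * (?r s - cnj (?r s))" by (simp add: algebra_simps)
    also have "?r s - cnj (?r s) = 2 * \<i> * of_real (Im (?r s))" unfolding complex_diff_cnj by simp
    also have "Im (?r s) = \<epsilon> / ((s - l)\<^sup>2 + \<epsilon>\<^sup>2)" by (simp add: Im_divide)
    also have "?c * (2 * \<i> * of_real (\<epsilon> / ((s - l)\<^sup>2 + \<epsilon>\<^sup>2))) = of_real (poisson \<epsilon> (s - l))"
      by (simp add: poisson_alt[OF assms])
    finally show ?thesis ..
  qed
  have "L (\<lambda>s. of_real (poisson \<epsilon> (s - l))) = ?c * L ?r + ((- ?c) * cnj (L ?r) + L (\<lambda>s. 0))"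
    unfolding eq by (subst lin[OF r bounded_borel_lincomb[OF rc bounded_borel_zero]],
                     subst lin[OF rc bounded_borel_zero], subst cnj[OF r]) simp
  also have "\<dots> = ?c * (L ?r - cnj (L ?r))" by (simp add: zero algebra_simps)
  also have "L ?r - cnj (L ?r) = 2 * \<i> * of_real (Im (L ?r))" unfolding complex_diff_cnj by simp
  finally show ?thesis by simp
qed

text \<open>Smooth g with Poisson kernels of scale \<open>e n\<close>. Through Riemann sums L of the
  smoothed function is the integral of g against Im M at height \<open>e n\<close>. As n grows, one
  side converges by bounded convergence in L, the other by continuity of M up to the real
  axis.\<close>

theorem stone_formula:
  fixes M :: "complex \<Rightarrow> complex" and g :: "real \<Rightarrow> complex"
  assumes M: "\<And>z. Im z > 0 \<Longrightarrow> L (\<lambda>s. 1 / (of_real s - z)) = M z"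
    and contM: "continuous_on {z. 0 \<le> Im z} M"
    and g: "continuous_on UNIV g" "\<And>x. x \<notin> {p..q} \<Longrightarrow> g x = 0" and pq: "p \<le> q"
  shows "L g = (LINT l|lborel. g l * of_real (Im (M (of_real l)) / pi))"
proof -
  have [measurable]: "g \<in> borel_measurable borel" using g(1) by (rule borel_measurable_continuous_onI)
  have "compact (g ` {p..q})" by (intro compact_continuous_image continuous_on_subset[OF g(1)]) auto
  then obtain C0 where C0: "\<And>x. x \<in> {p..q} \<Longrightarrow> norm (g x) \<le> C0"
    using compact_imp_bounded bounded_iff by (metis imageI)
  define C where "C = max C0 0"
  have C: "norm (g x) \<le> C" for x
    using C0[of x] g(2)[of x] by (cases "x \<in> {p..q}") (auto simp: C_def)
  have C_nonneg: "C \<ge> 0" by (simp add: C_def)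
  define e where "e = (\<lambda>n::nat. 1 / real (Suc n))"
  have e: "\<And>n. e n > 0" "e \<longlonglongrightarrow> 0" "\<And>n. e n \<le> 1"
    using LIMSEQ_inverse_real_of_nat by (auto simp: e_def inverse_eq_divide)
  define ge where "ge = (\<lambda>n s. LINT l|lborel. g l * of_real (poisson (e n) (s - l)))"
  have HK: "(LINT l|lborel. g l * of_real (f l)) = integral {p..q} (\<lambda>l. g l * of_real (f l))"
    if f: "continuous_on {p..q} f" for f :: "real \<Rightarrow> real"
  proof -
    have "(LINT l|lborel. g l * of_real (f l)) = (LINT l:{p..q}|lborel. g l * of_real (f l))"
      unfolding set_lebesgue_integral_def
      by (intro Bochner_Integration.integral_cong) (use g(2) in \<open>auto simp: indicator_def\<close>)
    also have "\<dots> = integral {p..q} (\<lambda>l. g l * of_real (f l))"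
      by (intro set_borel_integral_eq_integral(2) borel_integrable_atLeastAtMost' continuous_intros
            continuous_on_subset[OF g(1)] f) auto
    finally show ?thesis .
  qed
  have ge_bb: "ge n \<in> bounded_borel" for n
  proof (rule bounded_borelI)
    show "cmod (ge n s) \<le> C" for s
      unfolding ge_def by (rule poisson_approx_identity(2)[OF g(1) C e(1,2)])
    show "ge n \<in> borel_measurable borel" unfolding ge_def by measurable
  qed
  have g_bb: "g \<in> bounded_borel" by (rule bounded_borelI[OF _ C]) measurable
  have lim1: "(\<lambda>n. L (ge n)) \<longlonglongrightarrow> L g"
  proof (rule lim[OF ge_bb g_bb])
    show "(\<lambda>n. ge n s) \<longlonglongrightarrow> g s" for s
      unfolding ge_def by (rule poisson_approx_identity(1)[OF g(1) C e(1,2)])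
    show "cmod (ge n s) \<le> C" for n s
      unfolding ge_def by (rule poisson_approx_identity(2)[OF g(1) C e(1,2)])
  qed
  have contImM: "continuous_on {p..q} (\<lambda>l. Im (M (Complex l t)) / pi)" if "t \<ge> 0" for t
  proof -
    have "continuous_on {p..q} (\<lambda>l. Complex l t)"
      unfolding Complex_eq by (intro continuous_intros)
    then have "continuous_on {p..q} (\<lambda>l. M (Complex l t))"
      by (rule continuous_on_compose2[OF contM]) (use that in auto)
    then show ?thesis unfolding divide_inverse by (intro continuous_intros)
  qed
  have Lge: "L (ge n) = (LINT l|lborel. g l * of_real (Im (M (Complex l (e n))) / pi))" for n
  proof -
    let ?P = "\<lambda>l s. complex_of_real (poisson (e n) (s - l))"
    let ?x = "\<lambda>N i. p + real i * ((q - p) / real N)"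
    let ?h = "\<lambda>N s. \<Sum>i<N. (of_real ((q - p) / real N) * g (?x N i)) * ?P (?x N i) s"
    have P_bb: "?P l \<in> bounded_borel" for l
      by (rule bounded_borelI[of _ "1 / (pi * e n)"])
         (use poisson_bound[OF e(1)] poisson_pos[OF e(1), THEN less_imp_le] in auto)
    have h_bb: "?h N \<in> bounded_borel" for N by (rule bounded_borel_sum) (rule P_bb)
    have h_lim: "(\<lambda>N. ?h N s) \<longlonglongrightarrow> ge n s" for s
    proof -
      have c: "continuous_on {p..q} (\<lambda>l. poisson (e n) (s - l))" by (intro continuous_intros)
      have "ge n s = integral {p..q} (\<lambda>l. g l * of_real (poisson (e n) (s - l)))"
        unfolding ge_def by (rule HK[OF c])
      moreover have "continuous_on {p..q} (\<lambda>l. g l * of_real (poisson (e n) (s - l)))"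
        by (intro continuous_intros continuous_on_subset[OF g(1)]) auto
      ultimately show ?thesis
        using riemann_sum_tendsto[OF _ pq, of "\<lambda>l. g l * of_real (poisson (e n) (s - l))"] by (simp add: mult.assoc)
    qed
    have h_bound: "cmod (?h N s) \<le> (q - p) * C * (1 / (pi * e n))" for N s
    proof -
      have "cmod (?h N s) \<le> (\<Sum>i<N. (q - p) / real N * C * (1 / (pi * e n)))"
      proof (rule order_trans[OF norm_sum sum_mono])
        fix i
        show "cmod ((of_real ((q - p) / real N) * g (?x N i)) * ?P (?x N i) s) \<le> (q - p) / real N * C * (1 / (pi * e n))"
          unfolding norm_mult
          using poisson_bound[OF e(1)] poisson_pos[OF e(1), THEN less_imp_le] C pq C_nonneg
          by (intro mult_mono) (auto simp del: of_real_divide of_real_diff)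
      qed
      also have "\<dots> \<le> (q - p) * C * (1 / (pi * e n))"
        using pq C_nonneg e(1)[of n] by (cases "N = 0") auto
      finally show ?thesis .
    qed
    \<comment> \<open>At fixed n the Poisson kernel is bounded by 1/(pi times \<open>e n\<close>),
      so the Riemann sums are bounded uniformly in N.\<close>
    have "(\<lambda>N. L (?h N)) \<longlonglongrightarrow> L (ge n)"
      by (rule lim[OF h_bb ge_bb h_lim h_bound])
    moreover have "L (?h N) = (\<Sum>i<N. of_real ((q - p) / real N) * (g (?x N i) * of_real (Im (M (Complex (?x N i) (e n))) / pi)))" for N
      by (subst sum[OF P_bb]) (simp add: poisson_value[OF e(1)] M e(1) mult.assoc)
    moreover have "(\<lambda>N. \<Sum>i<N. of_real ((q - p) / real N) * (g (?x N i) * of_real (Im (M (Complex (?x N i) (e n))) / pi)))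
        \<longlonglongrightarrow> integral {p..q} (\<lambda>l. g l * of_real (Im (M (Complex l (e n))) / pi))"
      using contImM[OF less_imp_le[OF e(1)]]
      by (intro riemann_sum_tendsto pq continuous_on_mult continuous_on_of_real continuous_on_subset[OF g(1)]) auto
    ultimately have "L (ge n) = integral {p..q} (\<lambda>l. g l * of_real (Im (M (Complex l (e n))) / pi))"
      using LIMSEQ_unique by auto
    then show ?thesis using HK[OF contImM[OF less_imp_le[OF e(1)]]] by simp
  qed
  \<comment> \<open>A compact rectangle containing all points of height \<open>e n\<close> over
    {p..q}; the maximum of |M| on it provides the dominating function.\<close>
  define K where "K = (\<lambda>(l, t). Complex l t) ` ({p..q} \<times> {0..1::real})"
  have "compact K"
    unfolding K_def by (intro compact_continuous_image compact_Times) (auto simp: case_prod_beta Complex_eq intro!: continuous_intros)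
  moreover have "K \<subseteq> {z. 0 \<le> Im z}" by (auto simp: K_def)
  ultimately have "compact (M ` K)"
    by (intro compact_continuous_image continuous_on_subset[OF contM])
  then obtain B where B: "\<And>z. z \<in> K \<Longrightarrow> cmod (M z) \<le> B"
    using compact_imp_bounded bounded_iff by (metis imageI)
  have lim2: "(\<lambda>n. LINT l|lborel. g l * of_real (Im (M (Complex l (e n))) / pi)) \<longlonglongrightarrow> (LINT l|lborel. g l * of_real (Im (M (of_real l)) / pi))"
  proof (rule integral_dominated_convergence[where w = "\<lambda>l. indicator {p..q} l * (C * B)"])
    have meas: "(\<lambda>l. Im (M (Complex l t)) / pi) \<in> borel_measurable borel" if "t \<ge> 0" for t
    proof (rule borel_measurable_continuous_onI)
      have "continuous_on UNIV (\<lambda>l. Complex l t)"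
        unfolding Complex_eq by (intro continuous_intros)
      then have "continuous_on UNIV (\<lambda>l. M (Complex l t))"
        by (rule continuous_on_compose2[OF contM]) (use that in auto)
      then show "continuous_on UNIV (\<lambda>l. Im (M (Complex l t)) / pi)" unfolding divide_inverse by (intro continuous_intros)
    qed
    note [measurable] = meas[OF less_imp_le[OF e(1)]] meas[OF order_refl]
    have "(\<lambda>l. Im (M (of_real l)) / pi) \<in> borel_measurable borel"
      using meas[of 0] by (simp add: complex_of_real_def)
    then show "(\<lambda>l. g l * of_real (Im (M (of_real l)) / pi)) \<in> borel_measurable lborel" by measurable
    show "(\<lambda>l. g l * of_real (Im (M (Complex l (e n))) / pi)) \<in> borel_measurable lborel" for n by measurable
    show "integrable lborel (\<lambda>l. indicator {p..q} l * (C * B))"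
      by (intro integrable_mult_left integrable_real_indicator) (auto simp: emeasure_lborel_Icc_eq)
    show "AE l in lborel. (\<lambda>n. g l * of_real (Im (M (Complex l (e n))) / pi)) \<longlonglongrightarrow> g l * of_real (Im (M (of_real l)) / pi)"
    proof (intro AE_I2 tendsto_mult tendsto_const tendsto_of_real tendsto_divide tendsto_Im)
      fix l
      have "(\<lambda>n. Complex l (e n)) \<longlonglongrightarrow> of_real l"
        unfolding complex_of_real_def by (intro tendsto_Complex tendsto_const e)
      then show "(\<lambda>n. M (Complex l (e n))) \<longlonglongrightarrow> M (of_real l)"
        by (rule continuous_on_tendsto_compose[OF contM]) (simp_all add: less_imp_le[OF e(1)])
    qed simp
    show "AE l in lborel. norm (g l * of_real (Im (M (Complex l (e n))) / pi)) \<le> indicator {p..q} l * (C * B)" for n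
    proof (rule AE_I2)
      fix l
      show "norm (g l * of_real (Im (M (Complex l (e n))) / pi)) \<le> indicator {p..q} l * (C * B)"
      proof (cases "l \<in> {p..q}")
        case True
        have "Complex l (e n) \<in> K"
          unfolding K_def using True e(1)[of n] e(3)[of n] by (auto intro!: image_eqI[of _ _ "(l, e n)"])
        then have "\<bar>Im (M (Complex l (e n)))\<bar> \<le> B" using B abs_Im_le_cmod order_trans by blast
        moreover have "\<bar>Im (M (Complex l (e n)))\<bar> / pi \<le> \<bar>Im (M (Complex l (e n)))\<bar>"
          using pi_ge_two by (simp add: divide_le_eq mult_le_cancel_left1)
        ultimately have "\<bar>Im (M (Complex l (e n)))\<bar> / pi \<le> B" by linarith
        then have "norm (g l) * (\<bar>Im (M (Complex l (e n)))\<bar> / pi) \<le> C * B"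
          by (intro mult_mono C C_nonneg) auto
        then show ?thesis using True by (simp add: norm_mult norm_divide)
      qed (use g(2) in simp)
    qed
  qed
  show ?thesis using LIMSEQ_unique[OF lim1] lim2 unfolding Lge by blast
qed

end

section \<open>From the functional calculus to the spectral functional\<close>

context borel_functional_calculus
begin

text \<open>The calculus acts on functions, not on classes. The norm bound applied to the
  difference, a null function, yields compatibility with equality almost everywhere.\<close>

lemma cong:
  assumes h: "h \<in> bounded_borel" and fg: "f \<in> L2" "g \<in> L2" "l2_eq f g"
  shows "l2_eq (\<Phi> h f) (\<Phi> h g)"
proof -
  obtain C where C: "\<And>s. cmod (h s) \<le> C"
    using h by (auto simp: bounded_borel_def bounded_iff)
  let ?d = "\<lambda>x. (-1) * g x + f x"
  have dL: "?d \<in> L2" by (rule L2_lincomb[OF fg(2,1)])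
  have "l2_norm ?d = l2_norm (\<lambda>x. 0)"
  proof -
    have "l2_inner ?d ?d = l2_inner (\<lambda>x. 0) (\<lambda>x. 0)"
      by (rule l2_inner_cong) (use dL L2_zero fg(3) in \<open>auto simp: l2_eq_def\<close>)
    then have "(l2_norm ?d)\<^sup>2 = (l2_norm (\<lambda>x. 0))\<^sup>2"
      unfolding l2_inner_self using of_real_eq_iff by blast
    then show ?thesis by (simp add: power2_eq_iff_nonneg)
  qed
  then have "l2_norm (\<Phi> h ?d) \<le> 0"
    using norm_le[OF h dL C] by (simp add: l2_norm_def)
  then have "l2_norm (\<Phi> h ?d) = 0"
    using l2_norm_nonneg[of "\<Phi> h ?d"] by linarith
  then have 1: "l2_eq (\<Phi> h ?d) (\<lambda>x. 0)"
    by (intro l2_norm_eq_0 in_L2 h dL)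
  have 2: "l2_eq (\<Phi> h ?d) (\<lambda>x. (-1) * \<Phi> h g x + \<Phi> h f x)"
    by (rule linear[OF h fg(2,1)])
  from 1 2 show ?thesis unfolding l2_eq_def by eventually_elim simp
qed

lemma inner_cong_right:
  assumes "f \<in> L2" "g \<in> L2" "g' \<in> L2" "l2_eq g g'"
  shows "l2_inner f g = l2_inner f g'"
  by (rule l2_inner_cong) (use assms in auto)

lemma spectral_functional:
  assumes f: "f \<in> L2"
  shows "spectral_functional (\<lambda>h. l2_inner f (\<Phi> h f))"
proof
  fix h k :: "real \<Rightarrow> complex" and c assume hk: "h \<in> bounded_borel" "k \<in> bounded_borel"
  have "l2_inner f (\<Phi> (\<lambda>s. c * h s + k s) f) = l2_inner f (\<lambda>x. c * \<Phi> h f x + \<Phi> k f x)"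
    by (rule inner_cong_right[OF f _ _ hom_linear[OF hk f]])
       (intro in_L2 L2_lincomb bounded_borel_lincomb hk f)+
  then show "l2_inner f (\<Phi> (\<lambda>s. c * h s + k s) f) = c * l2_inner f (\<Phi> h f) + l2_inner f (\<Phi> k f)"
    by (simp add: l2_inner_lincomb_right f in_L2 hk)
next
  fix h :: "real \<Rightarrow> complex" assume h: "h \<in> bounded_borel"
  show "l2_inner f (\<Phi> (\<lambda>s. cnj (h s)) f) = cnj (l2_inner f (\<Phi> h f))"
    using hom_adjoint[OF h f f] l2_inner_commute by metis
next
  fix h' :: "nat \<Rightarrow> real \<Rightarrow> complex" and h C
  assume h: "\<And>n. h' n \<in> bounded_borel" "h \<in> bounded_borel" "\<And>s. (\<lambda>n. h' n s) \<longlonglongrightarrow> h s" "\<And>n s. cmod (h' n s) \<le> C"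
  show "(\<lambda>n. l2_inner f (\<Phi> (h' n) f)) \<longlonglongrightarrow> l2_inner f (\<Phi> h f)"
    by (rule l2_tendsto_inner[OF strongly_continuous[OF h f]]) (intro in_L2 h f)+
qed

text \<open>Write r for the resolvent function. Applying it to the truncated identity on u has two
  limits: r of f + z u, by the link with the operator, and u + z r of u, since r(s) s = 1 + z r(s)
  is bounded. Comparing them gives r of f = u, here tested against f.\<close>

lemma resolvent_inner:
  assumes z: "Im z \<noteq> 0" and f: "f \<in> L2" and u: "u \<in> L2" "A u (\<lambda>x. f x + z * u x)"
  shows "l2_inner f (\<Phi> (\<lambda>s. 1 / (of_real s - z)) f) = l2_inner f u"
proof -
  let ?r = "\<lambda>s. 1 / (of_real s - z)"
  have r: "?r \<in> bounded_borel"
    using spectral_functional.resolvent_bounded_borel[OF spectral_functional[OF f] z] .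
  have rc: "(\<lambda>s. cnj (?r s)) \<in> bounded_borel"
    using spectral_functional.resolvent_bounded_borel[OF spectral_functional[OF f], of "cnj z"] z by simp
  \<comment> \<open>Cut-offs of the identity function: each is bounded, they converge pointwise and
    are dominated by |s|, as \<open>identity_limit\<close> demands.\<close>
  define h where "h = (\<lambda>(n::nat) s. complex_of_real (if \<bar>s\<bar> \<le> real n then s else 0))"
  have h_bb: "h n \<in> bounded_borel" for n
    unfolding h_def by (rule bounded_borelI[of _ "real n"]) auto
  have h_lim: "(\<lambda>n. h n s) \<longlonglongrightarrow> of_real s" for s
  proof (rule tendsto_eventually)
    obtain N :: nat where "\<bar>s\<bar> \<le> real N" using real_arch_simple by blast
    then show "\<forall>\<^sub>F n in sequentially. h n s = of_real s"
      by (intro eventually_sequentiallyI[of N]) (auto simp: h_def)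
  qed
  have h_le: "cmod (h n s) \<le> \<bar>s\<bar>" for n s by (simp add: h_def)
  let ?w = "\<lambda>x. f x + z * u x"
  have w: "?w \<in> L2" using L2_lincomb[OF u(1) f, of z] by (simp add: add.commute)
  have X: "l2_tendsto (\<lambda>n. \<Phi> (h n) u) ?w"
    by (rule identity_limit[OF h_bb h_lim h_le u(2)])
  \<comment> \<open>The resolvent is moved to the left argument as its adjoint, so that the limit
    only has to be taken in an inner product with a fixed vector.\<close>
  let ?g = "\<Phi> (\<lambda>s. cnj (?r s)) f"
  have gL: "?g \<in> L2" by (rule in_L2[OF rc f])
  have "(\<lambda>n. l2_inner ?g (\<Phi> (h n) u)) \<longlonglongrightarrow> l2_inner ?g ?w"
    by (rule l2_tendsto_inner[OF X _ w gL]) (intro in_L2 h_bb u)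
  moreover have "l2_inner ?g y = l2_inner f (\<Phi> ?r y)" if "y \<in> L2" for y
    using hom_adjoint[OF r f that] .
  ultimately have A: "(\<lambda>n. l2_inner f (\<Phi> ?r (\<Phi> (h n) u))) \<longlonglongrightarrow> l2_inner f (\<Phi> ?r ?w)"
    using w in_L2[OF h_bb u(1)] by simp
  have rh: "(\<lambda>s. ?r s * h n s) \<in> bounded_borel" for n
  proof -
    obtain B where B: "\<And>s. cmod (?r s) \<le> B" using r by (auto simp: bounded_borel_def bounded_iff)
    have B0: "B \<ge> 0" using order_trans[OF norm_ge_zero B[of 0]] .
    have "cmod (?r s * h n s) \<le> B * real n" for s
      unfolding norm_mult by (intro mult_mono B B0) (auto simp: h_def)
    then show ?thesis by (intro bounded_borelI[of _ "B * real n"]) (simp_all add: h_def)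
  qed
  have A': "l2_inner f (\<Phi> ?r (\<Phi> (h n) u)) = l2_inner f (\<Phi> (\<lambda>s. ?r s * h n s) u)" for n
    by (rule inner_cong_right[OF f _ _ l2_eq_sym[OF hom_mult[OF r h_bb u(1)]]])
       (intro in_L2 r h_bb rh u)+
  let ?k = "\<lambda>s. z * ?r s + 1"
  have one: "(\<lambda>s. 1) \<in> bounded_borel" by (rule bounded_borelI[of _ 1]) auto
  have k: "?k \<in> bounded_borel" by (rule bounded_borel_lincomb[OF r one])
  have keq: "?k s = ?r s * of_real s" for s
  proof -
    have "of_real s - z \<noteq> 0" using z by (auto simp: complex_eq_iff)
    then show ?thesis by (simp add: field_simps)
  qed
  obtain D where D: "\<And>s. cmod (?k s) \<le> D" using k by (auto simp: bounded_borel_def bounded_iff)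
  have B: "l2_tendsto (\<lambda>n. \<Phi> (\<lambda>s. ?r s * h n s) u) (\<Phi> ?k u)"
  proof (rule strongly_continuous[OF rh k])
    show "(\<lambda>n. ?r s * h n s) \<longlonglongrightarrow> ?k s" for s
      unfolding keq by (intro tendsto_intros h_lim)
    show "cmod (?r s * h n s) \<le> D" for n s
    proof -
      have "cmod (?r s * h n s) \<le> cmod (?r s * of_real s)"
        unfolding norm_mult using h_le[of n s] by (intro mult_left_mono) auto
      also have "\<dots> \<le> D" using D[of s] unfolding keq .
      finally show ?thesis .
    qed
  qed (rule u)
  have "(\<lambda>n. l2_inner f (\<Phi> (\<lambda>s. ?r s * h n s) u)) \<longlonglongrightarrow> l2_inner f (\<Phi> ?k u)"
    by (rule l2_tendsto_inner[OF B]) (intro in_L2 rh k u f)+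
  with A have eq: "l2_inner f (\<Phi> ?r ?w) = l2_inner f (\<Phi> ?k u)"
    unfolding A' using LIMSEQ_unique by blast
  have "l2_inner f (\<Phi> ?r ?w) = l2_inner f (\<Phi> ?r (\<lambda>x. z * u x + f x))"
    by (simp add: add.commute)
  also have "\<dots> = l2_inner f (\<lambda>x. z * \<Phi> ?r u x + \<Phi> ?r f x)"
    by (rule inner_cong_right[OF f _ _ linear[OF r u(1) f]]) (intro in_L2 L2_lincomb r u f)+
  also have "\<dots> = z * l2_inner f (\<Phi> ?r u) + l2_inner f (\<Phi> ?r f)"
    by (rule l2_inner_lincomb_right) (intro in_L2 r u f)+
  finally have e1: "l2_inner f (\<Phi> ?r ?w) = z * l2_inner f (\<Phi> ?r u) + l2_inner f (\<Phi> ?r f)" .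
  have "l2_inner f (\<Phi> ?k u) = l2_inner f (\<lambda>x. z * \<Phi> ?r u x + \<Phi> (\<lambda>s. 1) u x)"
    by (rule inner_cong_right[OF f _ _ hom_linear[OF r one u(1)]]) (intro in_L2 L2_lincomb r u f k one)+
  also have "\<dots> = z * l2_inner f (\<Phi> ?r u) + l2_inner f (\<Phi> (\<lambda>s. 1) u)"
    by (rule l2_inner_lincomb_right) (intro in_L2 r u f one)+
  also have "l2_inner f (\<Phi> (\<lambda>s. 1) u) = l2_inner f u"
    by (rule inner_cong_right[OF f _ _ hom_one[OF u(1)]]) (intro in_L2 one u)+
  finally show ?thesis using eq e1 by simp
qed

end

subsection \<open>Fourier transform of the Lorentzian\<close>

text \<open>Subtracting \<open>exp (- t)\<close> from \<open>exp (i t z)\<close> removes the pole at \<open>i\<close>, so that Cauchy's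
  theorem on a half disc suffices.\<close>

lemma cauchy_density_fourier:
  assumes t: "t \<ge> 0"
  shows "(LINT x|lborel. exp (\<i> * of_real (t * x)) * of_real (cauchy_density x)) = of_real (exp (- t))"
proof -
  define E where "E = (\<lambda>z. exp (\<i> * of_real t * z))"
  have Ei: "E \<i> = of_real (exp (- t))" by (simp add: E_def exp_of_real[symmetric] mult_ac)
  define Q where "Q = (\<lambda>z. if z = \<i> then deriv E \<i> else (E z - E \<i>) / (z - \<i>))"
  define f where "f = (\<lambda>z. Q z / (z + \<i>))"
  have "E holomorphic_on UNIV" unfolding E_def by (intro holomorphic_intros)
  then have Q_hol: "Q holomorphic_on UNIV" unfolding Q_def by (rule pole_lemma) simp
  have f_hol: "f holomorphic_on {z. - 1 < Im z}"
    unfolding f_def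
  proof (rule holomorphic_on_divide)
    show "Q holomorphic_on {z. - 1 < Im z}" by (rule holomorphic_on_subset[OF Q_hol]) simp
    show "(\<lambda>z. z + \<i>) holomorphic_on {z. - 1 < Im z}" by (intro holomorphic_intros)
    show "z + \<i> \<noteq> 0" if "z \<in> {z. - 1 < Im z}" for z
    proof
      assume "z + \<i> = 0"
      then have "Im (z + \<i>) = 0" by simp
      then show False using that by simp
    qed
  qed
  have f_eq: "f z = (E z - E \<i>) / (z\<^sup>2 + 1)" if "z \<noteq> \<i>" for z
  proof -
    have "z\<^sup>2 + 1 = (z - \<i>) * (z + \<i>)" by (simp add: algebra_simps power2_eq_square)
    then show ?thesis using that by (simp add: f_def Q_def)
  qed
  have E_le: "cmod (E z) \<le> 1" if "0 \<le> Im z" for z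
    using that t by (simp add: E_def)
  \<comment> \<open>On the arc of radius R the numerator is at most 2 and the denominator at least
    R^2 - 1, so the arc contributes O(1/R).\<close>
  have line: "norm (integral {- R..R} (\<lambda>x. f (of_real x))) \<le> 2 / (R\<^sup>2 - 1) * R * pi" if R: "R > 1" for R :: real
  proof -
    let ?l = "linepath (of_real (- R)) (of_real R) :: real \<Rightarrow> complex"
    let ?c = "part_circlepath 0 R 0 pi"
    have pl: "path_image ?l \<subseteq> {z. - 1 < Im z}"
      by (auto simp: path_image_def linepath_def)
    have pc: "path_image ?c \<subseteq> {z. 0 \<le> Im z \<and> cmod z = R}"
    proof
      fix z assume "z \<in> path_image ?c"
      then obtain s where s: "0 \<le> s" "s \<le> pi" "z = R * exp (\<i> * of_real s)"
        by (auto simp: path_image_part_circlepath)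
      have "Im z = R * sin s" using s by (simp add: Im_exp)
      moreover have "0 \<le> sin s" using s by (intro sin_ge_zero)
      moreover have "cmod z = R" using s R by (simp add: norm_mult)
      ultimately show "z \<in> {z. 0 \<le> Im z \<and> cmod z = R}" using R by simp
    qed
    have pc': "path_image ?c \<subseteq> {z. - 1 < Im z}" using pc by auto
    have join: "pathfinish ?l = pathstart ?c" by simp
    have "(f has_contour_integral 0) (?l +++ ?c)"
    proof (rule Cauchy_theorem_convex_simple[OF f_hol])
      show "convex {z. - 1 < Im z}" by (rule convex_halfspace_Im_gt)
      show "valid_path (?l +++ ?c)" by (intro valid_path_join) (auto simp: join)
      show "path_image (?l +++ ?c) \<subseteq> {z. - 1 < Im z}" using pl pc' by (simp add: path_image_join)
      show "pathfinish (?l +++ ?c) = pathstart (?l +++ ?c)" by (simp add: exp_Euler)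
    qed
    then have tot: "contour_integral (?l +++ ?c) f = 0" by (rule contour_integral_unique)
    have op: "open {z. - 1 < Im z}" by (rule open_halfspace_Im_gt)
    have il: "f contour_integrable_on ?l" "f contour_integrable_on ?c"
      by (rule contour_integrable_holomorphic_simple[OF f_hol op _ pl], simp)
         (rule contour_integrable_holomorphic_simple[OF f_hol op _ pc'], simp)
    have "contour_integral ?l f = - contour_integral ?c f"
      using tot contour_integral_join[OF il] by (simp add: add_eq_0_iff2)
    moreover have "contour_integral ?l f = integral {- R..R} (\<lambda>x. f (of_real x))"
      using contour_integral_linepath_Reals_eq[of "of_real (- R)" "of_real R" f] R by simp
    moreover have "norm (contour_integral ?c f) \<le> 2 / (R\<^sup>2 - 1) * R * \<bar>pi - 0\<bar>"
    proof (rule contour_integral_bound_part_circlepath[OF il(2)])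
      show "0 \<le> 2 / (R\<^sup>2 - 1)" using R by simp
      show "norm (f z) \<le> 2 / (R\<^sup>2 - 1)" if "z \<in> path_image ?c" for z
      proof -
        have z: "0 \<le> Im z" "cmod z = R" using pc that by auto
        then have "z \<noteq> \<i>" using R by auto
        have "cmod (E z - E \<i>) \<le> 2"
          using norm_triangle_ineq4[of "E z" "E \<i>"] E_le[OF z(1)] E_le[of \<i>] by simp
        moreover have "R\<^sup>2 - 1 \<le> cmod (z\<^sup>2 + 1)"
          using norm_diff_ineq[of "z\<^sup>2" 1] z(2) by (simp add: norm_power)
        ultimately show ?thesis
          unfolding f_eq[OF \<open>z \<noteq> \<i>\<close>] norm_divide using R by (intro frac_le) auto
      qed
    qed (use R in auto)
    ultimately have "integral {- R..R} (\<lambda>x. f (of_real x)) = - contour_integral ?c f"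
        and "norm (contour_integral ?c f) \<le> 2 / (R\<^sup>2 - 1) * R * pi" by simp_all
    then show ?thesis by (simp only: norm_minus_cancel)
  qed
  have xi: "complex_of_real x \<noteq> \<i>" for x by (simp add: complex_eq_iff)
  have fx: "f (of_real x) = of_real pi * (exp (\<i> * of_real (t * x)) * of_real (cauchy_density x) - of_real (exp (- t)) * of_real (cauchy_density x))" for x
  proof -
    have "(of_real x)\<^sup>2 + 1 = complex_of_real (1 + x\<^sup>2)" by simp
    moreover have "complex_of_real (cauchy_density x) = 1 / (of_real pi * of_real (1 + x\<^sup>2))"
      by (simp add: cauchy_density_def)
    moreover have "(a - b) / d = c * (a * (1 / (c * d)) - b * (1 / (c * d)))" if "c \<noteq> 0" for a b c d :: complex
      using that by (simp add: diff_divide_distrib right_diff_distrib)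
    ultimately show ?thesis
      unfolding f_eq[OF xi] Ei by (simp only: E_def of_real_mult mult.assoc of_real_eq_0_iff pi_neq_zero not_False_eq_True)
  qed
  have i1: "integrable lborel (\<lambda>x. exp (\<i> * of_real (t * x)) * complex_of_real (cauchy_density x))"
    by (rule Bochner_Integration.integrable_bound[OF cauchy_density_integrable])
       (auto simp: norm_mult)
  have i2: "integrable lborel (\<lambda>x. of_real (exp (- t)) * complex_of_real (cauchy_density x))"
    by (intro integrable_mult_right integrable_of_real cauchy_density_integrable)
  have fi: "integrable lborel (\<lambda>x. f (of_real x))"
    unfolding fx by (intro integrable_mult_right Bochner_Integration.integrable_diff i1 i2)
  have "(\<lambda>n. LINT x|lborel. indicator {- real (n + 2)..real (n + 2)} x *\<^sub>R f (of_real x)) \<longlonglongrightarrow> (LINT x|lborel. f (of_real x))"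
  proof (rule integral_dominated_convergence[where w = "\<lambda>x. norm (f (of_real x))"])
    show "AE x in lborel. (\<lambda>n. indicator {- real (n + 2)..real (n + 2)} x *\<^sub>R f (of_real x)) \<longlonglongrightarrow> f (of_real x)"
    proof (intro AE_I2 tendsto_eventually)
      fix x :: real
      obtain N :: nat where "\<bar>x\<bar> \<le> real N" using real_arch_simple by blast
      then show "\<forall>\<^sub>F n in sequentially. indicator {- real (n + 2)..real (n + 2)} x *\<^sub>R f (of_real x) = f (of_real x)"
        by (intro eventually_sequentiallyI[of N]) (auto simp: indicator_def)
    qed
  qed (use fi in \<open>auto intro: borel_measurable_integrable integrable_norm simp: indicator_def\<close>)
  moreover have "(\<lambda>n. LINT x|lborel. indicator {- real (n + 2)..real (n + 2)} x *\<^sub>R f (of_real x)) \<longlonglongrightarrow> 0"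
  proof (rule Lim_null_comparison[OF always_eventually])
    show "(\<lambda>n. 2 / ((real (n + 2))\<^sup>2 - 1) * real (n + 2) * pi) \<longlonglongrightarrow> 0" by real_asymp
    show "\<forall>n. norm (LINT x|lborel. indicator {- real (n + 2)..real (n + 2)} x *\<^sub>R f (of_real x)) \<le> 2 / ((real (n + 2))\<^sup>2 - 1) * real (n + 2) * pi"
    proof
      fix n
      have "set_integrable lborel {- real (n + 2)..real (n + 2)} (\<lambda>x. f (of_real x))"
        unfolding set_integrable_def by (rule integrable_mult_indicator[OF _ fi]) simp
      from set_borel_integral_eq_integral(2)[OF this]
      show "norm (LINT x|lborel. indicator {- real (n + 2)..real (n + 2)} x *\<^sub>R f (of_real x)) \<le> 2 / ((real (n + 2))\<^sup>2 - 1) * real (n + 2) * pi"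
        using line[of "real (n + 2)"] by (simp add: set_lebesgue_integral_def)
    qed
  qed
  ultimately have "(LINT x|lborel. f (of_real x)) = 0" using LIMSEQ_unique by blast
  moreover have "(LINT x|lborel. f (of_real x)) = of_real pi * ((LINT x|lborel. exp (\<i> * of_real (t * x)) * of_real (cauchy_density x)) - of_real (exp (- t)))"
  proof -
    have "(LINT x|lborel. f (of_real x)) = of_real pi * (LINT x|lborel. exp (\<i> * of_real (t * x)) * of_real (cauchy_density x) - of_real (exp (- t)) * of_real (cauchy_density x))"
      unfolding fx by (rule integral_mult_right_zero)
    also have "(LINT x|lborel. exp (\<i> * of_real (t * x)) * of_real (cauchy_density x) - of_real (exp (- t)) * of_real (cauchy_density x))
      = (LINT x|lborel. exp (\<i> * of_real (t * x)) * of_real (cauchy_density x)) - (LINT x|lborel. of_real (exp (- t)) * of_real (cauchy_density x))"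
      by (rule Bochner_Integration.integral_diff[OF i1 i2])
    also have "(LINT x|lborel. of_real (exp (- t)) * complex_of_real (cauchy_density x)) = of_real (exp (- t))"
      by (subst integral_mult_right_zero) (simp add: cauchy_density_integral)
    finally show ?thesis .
  qed
  ultimately show ?thesis by simp
qed

lemma poisson_integrable:
  assumes "\<epsilon> > 0"
  shows "integrable lborel (\<lambda>l. poisson \<epsilon> (a - l))" and "(LINT l|lborel. poisson \<epsilon> (a - l)) = 1"
proof -
  have eq: "cauchy_density = (\<lambda>x. \<epsilon> * poisson \<epsilon> (a - (a + \<epsilon> * x)))"
    using assms by (auto simp: fun_eq_iff poisson_def cauchy_density_def)
  have "integrable lborel (\<lambda>x. poisson \<epsilon> (a - (a + \<epsilon> * x)))"
    using cauchy_density_integrable assms unfolding eq by simp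
  then show i: "integrable lborel (\<lambda>l. poisson \<epsilon> (a - l))"
    using lborel_integrable_real_affine_iff[of \<epsilon> "\<lambda>l. poisson \<epsilon> (a - l)" a] assms by simp
  have "(LINT l|lborel. poisson \<epsilon> (a - l)) = \<epsilon> * (LINT x|lborel. poisson \<epsilon> (a - (a + \<epsilon> * x)))"
    using assms by (subst lborel_integral_real_affine[where c = \<epsilon> and t = a]) auto
  also have "\<dots> = (LINT x|lborel. cauchy_density x)" unfolding eq by simp
  finally show "(LINT l|lborel. poisson \<epsilon> (a - l)) = 1" by (simp add: cauchy_density_integral)
qed

text \<open>Rescaling and the reflection x to - x, under which the density is even, turn the
  integral into a transform at the nonnegative frequency t \<epsilon>.\<close>

lemma poisson_fourier:
  assumes "\<epsilon> > 0" "t \<ge> 0"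
  shows "(LINT l|lborel. exp (- \<i> * of_real t * of_real l) * of_real (poisson \<epsilon> (a - l))) = exp (- \<i> * of_real t * Complex a (- \<epsilon>))"
proof -
  have "(LINT l|lborel. exp (- \<i> * of_real t * of_real l) * of_real (poisson \<epsilon> (a - l)))
    = (LINT x|lborel. exp (- \<i> * of_real t * of_real (a + \<epsilon> * x)) * of_real (cauchy_density x))"
    by (rule poisson_integral_subst[OF assms(1)])
  also have "\<dots> = (LINT x|lborel. exp (- \<i> * of_real t * of_real (a - \<epsilon> * x)) * of_real (cauchy_density x))"
    by (subst lborel_integral_real_affine[where c = "-1" and t = 0]) (auto simp: cauchy_density_def)
  also have "\<dots> = (LINT x|lborel. exp (- \<i> * of_real t * of_real a) * (exp (\<i> * of_real ((t * \<epsilon>) * x)) * of_real (cauchy_density x)))"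
    by (intro Bochner_Integration.integral_cong refl) (simp add: exp_add[symmetric] algebra_simps)
  also have "\<dots> = exp (- \<i> * of_real t * of_real a) * of_real (exp (- (t * \<epsilon>)))"
    using cauchy_density_fourier[of "t * \<epsilon>"] assms by (simp only: integral_mult_right_zero mult_nonneg_nonneg less_imp_le)
  also have "\<dots> = exp (- \<i> * of_real t * Complex a (- \<epsilon>))"
  proof -
    have "- \<i> * of_real t * of_real a + of_real (- (t * \<epsilon>)) = - \<i> * of_real t * Complex a (- \<epsilon>)"
      by (simp add: complex_eq_iff)
    then show ?thesis by (simp only: exp_of_real[symmetric] exp_add[symmetric])
  qed
  finally show ?thesis .
qed

text \<open>Away from the peak the distance to \<open>a\<close> is at least half the distance to
  \<open>b\<close>, whence the factor 4, and 1 + 1/\<rho>^2 compares 1/y^2 with 1/(1 + y^2). The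
  majorant is centred at the fixed \<open>b\<close>, while \<open>a\<close> is going to move with
  \<eta>.\<close>

lemma poisson_tail:
  assumes "\<rho> > 0" "\<rho> \<le> \<bar>x - b\<bar>" "\<bar>a - b\<bar> \<le> \<rho> / 2" "\<epsilon> > 0"
  shows "poisson \<epsilon> (a - x) \<le> 4 * \<epsilon> * (1 + 1 / \<rho>\<^sup>2) * cauchy_density (x - b)"
proof -
  let ?y = "x - b"
  have "\<bar>?y\<bar> \<le> \<bar>a - x\<bar> + \<bar>a - b\<bar>" by linarith
  then have "\<bar>?y / 2\<bar> \<le> \<bar>a - x\<bar>" using assms(2,3) by (simp add: abs_divide)
  then have "(?y / 2)\<^sup>2 \<le> (a - x)\<^sup>2" by (simp only: abs_le_square_iff)
  then have 1: "?y\<^sup>2 / 4 \<le> (a - x)\<^sup>2 + \<epsilon>\<^sup>2" by (simp add: power_divide add_increasing2)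
  have y0: "?y\<^sup>2 > 0" using assms by auto
  have "poisson \<epsilon> (a - x) = \<epsilon> / (pi * ((a - x)\<^sup>2 + \<epsilon>\<^sup>2))" by (rule poisson_alt[OF assms(4)])
  also have "\<dots> \<le> \<epsilon> / (pi * (?y\<^sup>2 / 4))"
    using assms(4) 1 y0 by (intro divide_left_mono mult_left_mono mult_pos_pos add_nonneg_pos) auto
  also have "\<dots> = 4 * \<epsilon> / pi * (1 / ?y\<^sup>2)" by simp
  also have "\<dots> \<le> 4 * \<epsilon> / pi * ((1 + 1 / \<rho>\<^sup>2) / (1 + ?y\<^sup>2))"
  proof (rule mult_left_mono)
  show "1 / ?y\<^sup>2 \<le> (1 + 1 / \<rho>\<^sup>2) / (1 + ?y\<^sup>2)"
  proof -
    have "\<rho>\<^sup>2 \<le> ?y\<^sup>2" using assms(1,2) abs_le_square_iff[of \<rho> ?y] by simp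
    then have "1 \<le> ?y\<^sup>2 / \<rho>\<^sup>2" using assms(1) by simp
    then have "1 + ?y\<^sup>2 \<le> (1 + 1 / \<rho>\<^sup>2) * ?y\<^sup>2" by (simp add: algebra_simps)
    then show ?thesis using y0 by (simp add: divide_simps add_pos_pos)
  qed
  qed (use assms(4) in simp)
  finally show ?thesis by (simp add: cauchy_density_def)
qed

subsection \<open>The Lorentzian approximation near a resonance\<close>

text \<open>Approach the centre along real points. It is used for difference quotients, which are
  visibly real off the centre while their value at the centre is a derivative.\<close>

lemma holomorphic_real_at_center:
  fixes H :: "complex \<Rightarrow> complex"
  assumes "continuous_on (cball (of_real e0) \<rho>) H" "\<rho> > 0"
    and "\<And>x. x \<in> {e0 - \<rho>..e0 + \<rho>} \<Longrightarrow> x \<noteq> e0 \<Longrightarrow> Im (H (of_real x)) = 0"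
  shows "Im (H (of_real e0)) = 0"
proof -
  let ?x = "\<lambda>n. e0 + \<rho> / real (Suc n)"
  have xin: "?x n \<in> {e0 - \<rho>..e0 + \<rho>}" "?x n \<noteq> e0" for n
  proof -
    have "0 < \<rho> / real (Suc n)" "\<rho> / real (Suc n) \<le> \<rho>"
      using assms(2) by (simp_all add: divide_le_eq)
    then show "?x n \<in> {e0 - \<rho>..e0 + \<rho>}" "?x n \<noteq> e0" by auto
  qed
  have "?x \<longlonglongrightarrow> e0 + 0"
    by (intro tendsto_intros LIMSEQ_Suc lim_const_over_n)
  then have "(\<lambda>n. complex_of_real (?x n)) \<longlonglongrightarrow> of_real e0" by (intro tendsto_of_real) simp
  moreover have "complex_of_real (?x n) \<in> cball (of_real e0) \<rho>" for n
    using xin(1)[of n] unfolding mem_cball dist_of_real dist_real_def atLeastAtMost_iff by linarith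
  ultimately have "(\<lambda>n. H (of_real (?x n))) \<longlonglongrightarrow> H (of_real e0)"
    using assms(2) by (intro continuous_on_tendsto_compose[OF assms(1)]) auto
  then have "(\<lambda>n. Im (H (of_real (?x n)))) \<longlonglongrightarrow> Im (H (of_real e0))" by (rule tendsto_Im)
  then have "(\<lambda>n. 0::real) \<longlonglongrightarrow> Im (H (of_real e0))"
    by (simp only: assms(3)[OF xin])
  then show ?thesis using LIMSEQ_unique tendsto_const by blast
qed

text \<open>The regular part of \<open>g / (zs - z)\<close> at its pole is controlled by the maximum principle.\<close>

lemma difference_quotient_close:
  fixes g g0 :: "complex \<Rightarrow> complex"
  assumes hol: "g holomorphic_on ball a r" "g0 holomorphic_on ball a r" and \<rho>: "0 < \<rho>" "\<rho> < r"
    and zs: "cmod (zs - a) \<le> \<rho> / 2"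
    and close: "\<And>z. z \<in> cball a \<rho> \<Longrightarrow> cmod (g z - g0 z) \<le> \<tau>" "cmod (g zs - g0 a) \<le> \<tau>" "cmod (zs - a) \<le> \<tau>"
    and B: "\<And>z. z \<in> cball a \<rho> \<Longrightarrow> cmod (g0 z) \<le> B"
    and z: "z \<in> cball a \<rho>"
  defines "h \<equiv> \<lambda>z. if z = zs then deriv g zs else (g z - g zs) / (z - zs)"
    and "h0 \<equiv> \<lambda>z. if z = a then deriv g0 a else (g0 z - g0 a) / (z - a)"
  shows "cmod (h z - h0 z) \<le> 2 * (2 * \<rho> + 2 * B) / \<rho>\<^sup>2 * \<tau>"
proof -
  have zsin: "zs \<in> ball a r" using zs \<rho> by (simp add: dist_norm norm_minus_commute)
  have hh: "h holomorphic_on ball a r" "h0 holomorphic_on ball a r"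
    unfolding h_def h0_def by (rule pole_lemma; use hol zsin \<rho> in simp)+
  have D: "(\<lambda>z. h z - h0 z) holomorphic_on ball a r" by (intro holomorphic_intros hh)
  have sub: "cball a \<rho> \<subseteq> ball a r" using \<rho> by auto
  show ?thesis
  proof (rule maximum_modulus_frontier[where S = "cball a \<rho>" and f = "\<lambda>z. h z - h0 z"])
    show "(\<lambda>z. h z - h0 z) holomorphic_on interior (cball a \<rho>)"
      by (rule holomorphic_on_subset[OF D]) (use \<rho> in auto)
    show "continuous_on (closure (cball a \<rho>)) (\<lambda>z. h z - h0 z)"
      using continuous_on_subset[OF holomorphic_on_imp_continuous_on[OF D] sub] by simp
    show "cmod (h w - h0 w) \<le> 2 * (2 * \<rho> + 2 * B) / \<rho>\<^sup>2 * \<tau>" if "w \<in> frontier (cball a \<rho>)" for w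
    proof -
      have w: "cmod (w - a) = \<rho>" "w \<in> cball a \<rho>" using that by (auto simp: dist_norm norm_minus_commute)
      have wzs: "\<rho> / 2 \<le> cmod (w - zs)"
        using norm_triangle_ineq[of "w - zs" "zs - a"] w zs by simp
      have ne: "w \<noteq> zs" "w \<noteq> a" using wzs w \<rho> by auto
      have \<tau>0: "0 \<le> \<tau>" using close(3) norm_ge_zero order_trans by blast
      have "h w - h0 w = ((g w - g zs) * (w - a) - (g0 w - g0 a) * (w - zs)) / ((w - zs) * (w - a))"
        using ne by (simp add: h_def h0_def divide_simps)
      also have "(g w - g zs) * (w - a) - (g0 w - g0 a) * (w - zs)
        = (g w - g0 w) * (w - a) - (g zs - g0 a) * (w - a) + (g0 w - g0 a) * (zs - a)"
        by (simp add: algebra_simps)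
      finally have eq: "cmod (h w - h0 w) = cmod ((g w - g0 w) * (w - a) - (g zs - g0 a) * (w - a) + (g0 w - g0 a) * (zs - a)) / (cmod (w - zs) * \<rho>)"
        using w by (simp add: norm_divide norm_mult)
      have n1: "cmod ((g w - g0 w) * (w - a)) \<le> \<tau> * \<rho>"
        unfolding norm_mult w(1) using close(1)[OF w(2)] \<rho> by simp
      have n2: "cmod ((g zs - g0 a) * (w - a)) \<le> \<tau> * \<rho>"
        unfolding norm_mult w(1) using close(2) \<rho> by simp
      have "cmod (g0 w - g0 a) \<le> 2 * B"
        using norm_triangle_ineq4[of "g0 w" "g0 a"] B[OF w(2)] B[of a] \<rho> by simp
      moreover have "0 \<le> B" using B[OF w(2)] norm_ge_zero order_trans by blast
      ultimately have n3: "cmod ((g0 w - g0 a) * (zs - a)) \<le> 2 * B * \<tau>"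
        unfolding norm_mult using close(3) \<tau>0 order_trans[OF norm_ge_zero] by (intro mult_mono) auto
      have num: "cmod ((g w - g0 w) * (w - a) - (g zs - g0 a) * (w - a) + (g0 w - g0 a) * (zs - a)) \<le> (2 * \<rho> + 2 * B) * \<tau>"
        using norm_triangle_ineq[of "(g w - g0 w) * (w - a) - (g zs - g0 a) * (w - a)" "(g0 w - g0 a) * (zs - a)"]
          norm_triangle_ineq4[of "(g w - g0 w) * (w - a)" "(g zs - g0 a) * (w - a)"] n1 n2 n3
        by (simp add: algebra_simps)
      have "cmod (h w - h0 w) \<le> (2 * \<rho> + 2 * B) * \<tau> / (\<rho> / 2 * \<rho>)"
        unfolding eq using num wzs \<rho> order_trans[OF norm_ge_zero num] by (intro frac_le mult_right_mono) auto
      also have "\<dots> = 2 * (2 * \<rho> + 2 * B) / \<rho>\<^sup>2 * \<tau>" by (simp add: power2_eq_square)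
      finally show ?thesis .
    qed
  qed (use z in auto)
qed

lemma Im_simple_pole:
  fixes c :: complex
  assumes "\<gamma> > 0"
  shows "Im (c / (Complex e (- \<gamma>) - of_real x)) = (Re c * \<gamma> + Im c * (e - x)) / ((e - x)\<^sup>2 + \<gamma>\<^sup>2)"
proof -
  have "Complex e (- \<gamma>) - of_real x = Complex (e - x) (- \<gamma>)" by (simp add: complex_eq_iff)
  then show ?thesis by (simp add: Im_divide algebra_simps)
qed

text \<open>A nonnegative boundary value \<open>Im (g / (zs - x))\<close> with \<open>zs\<close> close to the real axis is close to the
  Cauchy distribution of scale \<open>\<gamma> = - Im zs\<close>. The imaginary part of the residue would contribute a term of
  order \<open>\<bar>e - x\<bar> / ((e - x)\<^sup>2 + \<gamma>\<^sup>2)\<close>, whose integral diverges as \<open>\<gamma> \<rightarrow> 0\<close>; positivity at distance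
  \<open>K * sqrt \<gamma>\<close> from \<open>e\<close> forces it to be \<open>o (sqrt \<gamma>)\<close>, which makes the term harmless.\<close>

lemma near_pole_bound:
  fixes c h :: "complex" and H :: "real \<Rightarrow> complex"
  assumes \<gamma>: "0 < \<gamma>" "\<gamma> \<le> 1"
    and H: "\<And>x. x \<in> {p..q} \<Longrightarrow> \<bar>Im (H x)\<bar> \<le> \<tau>"
    and pos: "\<And>x. x \<in> {p..q} \<Longrightarrow> 0 \<le> Im (c / (Complex e (- \<gamma>) - of_real x) + H x)"
    and K: "1 \<le> K" "{e - K * sqrt \<gamma>..e + K * sqrt \<gamma>} \<subseteq> {p..q}"
    and x: "x \<in> {p..q}"
  shows "\<bar>Im (c / (Complex e (- \<gamma>) - of_real x) + H x) / pi - c0 * poisson \<gamma> (e - x)\<bar>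
     \<le> (\<bar>Re c - c0\<bar> + (\<bar>Re c\<bar> / K + 2 * K * \<tau>) / 2) * poisson \<gamma> (e - x) + (\<bar>Re c\<bar> / K + 2 * K * \<tau>) + \<tau>"
proof -
  define s where "s = sqrt \<gamma>"
  have s: "s > 0" "s\<^sup>2 = \<gamma>" "s \<le> 1" using \<gamma> by (auto simp: s_def)
  have \<tau>0: "0 \<le> \<tau>" using H[OF x] by linarith
  define \<delta> where "\<delta> = \<bar>Re c\<bar> / K + 2 * K * \<tau>"
  have \<delta>0: "0 \<le> \<delta>" using K \<tau>0 by (auto simp: \<delta>_def)
  have ci: "\<bar>Im c\<bar> \<le> \<delta> * s"
  proof -
    \<comment> \<open>The side of e is chosen so that the term with \<open>Im c\<close> is negative;
      nonnegativity of the total then bounds it by the other two terms.\<close>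
    define y where "y = (if 0 \<le> Im c then e + K * s else e - K * s)"
    have "K * s > 0" using K s by simp
    then have y: "y \<in> {p..q}" by (intro subsetD[OF K(2)]) (auto simp: y_def s_def)
    define D where "D = (e - y)\<^sup>2 + \<gamma>\<^sup>2"
    have D: "D = K\<^sup>2 * \<gamma> + \<gamma>\<^sup>2" using s by (auto simp: D_def y_def power_mult_distrib)
    have D0: "D > 0" using \<gamma> unfolding D by (simp add: add_nonneg_pos)
    have iy: "Im c * (e - y) = - (\<bar>Im c\<bar> * (K * s))" by (auto simp: y_def)
    have "0 \<le> (Re c * \<gamma> + Im c * (e - y)) / D + \<tau>"
      using pos[OF y] H[OF y] unfolding plus_complex.sel Im_simple_pole[OF \<gamma>(1)] D_def by linarith
    then have "0 \<le> ((Re c * \<gamma> + Im c * (e - y)) / D + \<tau>) * D" using D0 by simp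
    also have "\<dots> = Re c * \<gamma> - \<bar>Im c\<bar> * (K * s) + \<tau> * D"
      using D0 unfolding iy by (simp add: distrib_right)
    finally have "\<bar>Im c\<bar> * (K * s) \<le> Re c * \<gamma> + \<tau> * D" by simp
    also have "\<dots> \<le> \<bar>Re c\<bar> * \<gamma> + \<tau> * (2 * K\<^sup>2 * \<gamma>)"
    proof (intro add_mono mult_left_mono)
      have "\<gamma>\<^sup>2 \<le> \<gamma>" using \<gamma> by (simp add: power2_eq_square mult_left_le)
      moreover have "\<gamma> \<le> K\<^sup>2 * \<gamma>" using K \<gamma> by (simp add: power2_eq_square) (metis mult_mono one_le_mult_iff less_eq_real_def mult_1 mult_le_cancel_right1 zero_le_one order_trans)
      ultimately show "D \<le> 2 * K\<^sup>2 * \<gamma>" unfolding D by linarith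
    qed (use \<tau>0 \<gamma> in auto)
    also have "\<dots> = (\<delta> * s) * (K * s)"
      using K s(2) by (simp add: \<delta>_def power2_eq_square algebra_simps flip: s(2))
    finally show ?thesis using \<open>K * s > 0\<close> by (simp add: mult_le_cancel_right)
  qed
  define D where "D = (e - x)\<^sup>2 + \<gamma>\<^sup>2"
  have D0: "D > 0" using \<gamma> by (simp add: D_def add_nonneg_pos)
  have P: "poisson \<gamma> (e - x) = \<gamma> / (pi * D)" by (simp add: poisson_alt[OF \<gamma>(1)] D_def)
  have eq: "Im (c / (Complex e (- \<gamma>) - of_real x) + H x) / pi - c0 * poisson \<gamma> (e - x)
     = (Re c - c0) * poisson \<gamma> (e - x) + Im c * (e - x) / (pi * D) + Im (H x) / pi"
    unfolding plus_complex.sel Im_simple_pole[OF \<gamma>(1)] P D_def[symmetric] using D0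
    by (simp add: field_simps)
  have t1: "\<bar>(Re c - c0) * poisson \<gamma> (e - x)\<bar> = \<bar>Re c - c0\<bar> * poisson \<gamma> (e - x)"
    using poisson_pos[OF \<gamma>(1), of "e - x"] by (simp add: abs_mult)
  have pi1: "a / pi \<le> a" if "a \<ge> 0" for a :: real
    using that pi_ge_two by (simp add: divide_le_eq mult_le_cancel_left1)
  have t3: "\<bar>Im (H x) / pi\<bar> \<le> \<tau>"
    using pi1[of "\<bar>Im (H x)\<bar>"] H[OF x] by simp
  have t2: "\<bar>Im c * (e - x) / (pi * D)\<bar> \<le> \<delta> / 2 * poisson \<gamma> (e - x) + \<delta>"
  proof -
    \<comment> \<open>The arithmetic-geometric mean inequality at scale s = sqrt \<gamma> splits the
      odd term into a multiple of the Poisson kernel and a constant, both integrable uniformly in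
      \<gamma>.\<close>
    have "2 * (\<bar>e - x\<bar> * s) \<le> (e - x)\<^sup>2 + \<gamma>"
      using sum_squares_bound[of "\<bar>e - x\<bar>" s] s(2) by (simp add: mult_ac)
    also have "\<dots> \<le> D + \<gamma>" by (simp add: D_def)
    finally have ys: "s * \<bar>e - x\<bar> \<le> (D + \<gamma>) / 2" by (simp add: mult_ac)
    have "\<bar>Im c * (e - x) / (pi * D)\<bar> = \<bar>Im c\<bar> * \<bar>e - x\<bar> / (pi * D)"
      using D0 by (simp add: abs_mult)
    also have "\<dots> \<le> (\<delta> * s) * \<bar>e - x\<bar> / (pi * D)"
      using ci D0 by (intro divide_right_mono mult_right_mono) auto
    also have "\<dots> = \<delta> * (s * \<bar>e - x\<bar>) / (pi * D)" by (simp add: mult.assoc)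
    also have "\<dots> \<le> \<delta> * ((D + \<gamma>) / 2) / (pi * D)"
      using ys D0 \<delta>0 by (intro divide_right_mono mult_left_mono) auto
    also have "\<dots> = \<delta> / 2 * poisson \<gamma> (e - x) + \<delta> / 2 / pi"
      unfolding P using D0 by (simp add: field_simps)
    also have "\<delta> / 2 / pi \<le> \<delta>" using pi1[of "\<delta> / 2"] \<delta>0 by simp
    finally show ?thesis by simp
  qed
  show ?thesis
    unfolding eq \<delta>_def[symmetric] using t1 t2 t3 
      abs_triangle_ineq[of "(Re c - c0) * poisson \<gamma> (e - x) + Im c * (e - x) / (pi * D)" "Im (H x) / pi"]
      abs_triangle_ineq[of "(Re c - c0) * poisson \<gamma> (e - x)" "Im c * (e - x) / (pi * D)"]
    by (simp add: distrib_right)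
qed

section \<open>Persistence of simple zeros\<close>

definition diff_quot :: "(complex \<Rightarrow> complex) \<Rightarrow> complex \<Rightarrow> complex \<Rightarrow> complex" where
  "diff_quot g a z = (if z = a then deriv g a else (g z - g a) / (z - a))"

lemma diff_quot_holomorphic:
  "g holomorphic_on S \<Longrightarrow> a \<in> interior S \<Longrightarrow> diff_quot g a holomorphic_on S"
  using pole_lemma[of g S a] by (simp add: diff_quot_def[abs_def])

lemma diff_quot_mult: "z \<noteq> a \<Longrightarrow> (z - a) * diff_quot g a z = g z - g a"
  by (simp add: diff_quot_def)

text \<open>Here the base points move as well. \<open>difference_quotient_close\<close> bounds the
  error linearly in the three distances: of the functions, of their values at the base points and of
  the base points themselves.\<close>

lemma diff_quot_close:
  fixes g :: "'i \<Rightarrow> complex \<Rightarrow> complex"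
  assumes r: "0 < R" "R < r"
    and hol: "eventually (\<lambda>i. g i holomorphic_on ball a r) F" "g0 holomorphic_on ball a r"
    and lim: "uniform_limit (cball a R) g g0 F"
    and zs: "(zs \<longlongrightarrow> a) F"
  shows "((\<lambda>i. g i (zs i)) \<longlongrightarrow> g0 a) F"
    and "uniform_limit (cball a R) (\<lambda>i. diff_quot (g i) (zs i)) (diff_quot g0 a) F"
proof -
  have cont: "continuous_on (cball a R) g0"
    by (rule continuous_on_subset[OF holomorphic_on_imp_continuous_on[OF hol(2)]]) (use r in auto)
  have c0: "isCont g0 a"
    using continuous_on_interior[OF cont] r by simp
  have ev_in: "eventually (\<lambda>i. zs i \<in> cball a R) F"
    using tendstoD[OF zs r(1)] by eventually_elim (simp add: dist_commute)
  have g0zs: "((\<lambda>i. g0 (zs i)) \<longlongrightarrow> g0 a) F" by (rule isCont_tendsto_compose[OF c0 zs])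
  show gz: "((\<lambda>i. g i (zs i)) \<longlongrightarrow> g0 a) F"
  proof (rule tendstoI)
    fix e :: real assume e: "e > 0"
    have "eventually (\<lambda>i. \<forall>z\<in>cball a R. dist (g i z) (g0 z) < e / 2) F"
      using uniform_limitD[OF lim, of "e / 2"] e by simp
    moreover have "eventually (\<lambda>i. dist (g0 (zs i)) (g0 a) < e / 2) F"
      using tendstoD[OF g0zs, of "e / 2"] e by simp
    ultimately show "eventually (\<lambda>i. dist (g i (zs i)) (g0 a) < e) F"
      using ev_in
    proof eventually_elim
      case (elim i)
      have "dist (g i (zs i)) (g0 a) \<le> dist (g i (zs i)) (g0 (zs i)) + dist (g0 (zs i)) (g0 a)"
        by (rule dist_triangle)
      also have "\<dots> < e / 2 + e / 2" using elim by (intro add_strict_mono) auto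
      finally show ?case by simp
    qed
  qed
  obtain B where B: "\<And>z. z \<in> cball a R \<Longrightarrow> cmod (g0 z) \<le> B"
  proof -
    have "compact (g0 ` cball a R)" by (intro compact_continuous_image cont) simp
    then show thesis using that compact_imp_bounded bounded_iff by (metis imageI)
  qed
  have B0: "B \<ge> 0" using order_trans[OF norm_ge_zero B[of a]] r by simp
  show "uniform_limit (cball a R) (\<lambda>i. diff_quot (g i) (zs i)) (diff_quot g0 a) F"
  proof (rule uniform_limitI)
    fix e :: real assume e: "e > 0"
    define C where "C = 2 * (2 * R + 2 * B) / R\<^sup>2"
    have C0: "C > 0" using r B0 by (simp add: C_def)
    define \<tau> where "\<tau> = e / (2 * C)"
    have \<tau>: "\<tau> > 0" "C * \<tau> < e" using e C0 by (auto simp: \<tau>_def)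
    have "eventually (\<lambda>i. \<forall>z\<in>cball a R. dist (g i z) (g0 z) < \<tau>) F"
      by (rule uniform_limitD[OF lim \<tau>(1)])
    moreover have "eventually (\<lambda>i. dist (zs i) a < min \<tau> (R / 2)) F"
      using tendstoD[OF zs, of "min \<tau> (R / 2)"] \<tau> r by simp
    moreover have "eventually (\<lambda>i. dist (g i (zs i)) (g0 a) < \<tau>) F"
      by (rule tendstoD[OF gz \<tau>(1)])
    ultimately show "eventually (\<lambda>i. \<forall>z\<in>cball a R. dist (diff_quot (g i) (zs i) z) (diff_quot g0 a z) < e) F"
      using hol(1)
    proof eventually_elim
      case (elim i)
      show ?case
      proof
        fix z assume z: "z \<in> cball a R"
        have "cmod (diff_quot (g i) (zs i) z - diff_quot g0 a z) \<le> 2 * (2 * R + 2 * B) / R\<^sup>2 * \<tau>"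
          unfolding diff_quot_def
          by (rule difference_quotient_close[OF elim(4) hol(2) r])
             (use elim B z in \<open>auto simp: dist_norm less_imp_le\<close>)
        then show "dist (diff_quot (g i) (zs i) z) (diff_quot g0 a z) < e"
          using \<tau>(2) by (simp add: dist_norm C_def)
      qed
    qed
  qed
qed

text \<open>Existence: without a zero, 1/g would satisfy the maximum principle, although it is
  larger at the centre than on the circle. Uniqueness: a second zero would be one of the difference
  quotient, whose limit is bounded away from 0. This route avoids winding numbers and yields
  convergence of the quotients at the same time.\<close>

lemma hurwitz_simple_zero:
  fixes g :: "'i \<Rightarrow> complex \<Rightarrow> complex"
  assumes r: "0 < R" "R < r"
    and hol: "eventually (\<lambda>i. g i holomorphic_on ball a r) F" "g0 holomorphic_on ball a r"
    and lim: "uniform_limit (cball a R) g g0 F"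
    and zero: "g0 a = 0" "deriv g0 a \<noteq> 0" "\<And>z. z \<in> cball a R \<Longrightarrow> g0 z = 0 \<Longrightarrow> z = a"
  obtains zs where "(zs \<longlongrightarrow> a) F"
    and "eventually (\<lambda>i. \<forall>z\<in>cball a R. g i z = 0 \<longleftrightarrow> z = zs i) F"
    and "uniform_limit (cball a R) (\<lambda>i. diff_quot (g i) (zs i)) (diff_quot g0 a) F"
proof -
  let ?q = "diff_quot g0 a"
  have sub: "cball a R \<subseteq> ball a r" using r by auto
  have q_cont: "continuous_on (cball a R) ?q"
    using diff_quot_holomorphic[OF hol(2), of a] r
    by (intro continuous_on_subset[OF holomorphic_on_imp_continuous_on sub]) auto
  have q_nz: "?q z \<noteq> 0" if "z \<in> cball a R" for z
  proof (cases "z = a")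
    case False
    then have "g0 z \<noteq> 0" using zero(3)[OF that] by blast
    then show ?thesis using False zero(1) by (simp add: diff_quot_def)
  qed (use zero(2) in \<open>simp add: diff_quot_def\<close>)
  \<comment> \<open>The minimum of the limiting quotient gives |g0 z| at least m |z - a|, which both
    localises the zeros and bounds g0 from below on the circle.\<close>
  obtain m where m: "m > 0" "\<And>z. z \<in> cball a R \<Longrightarrow> m \<le> cmod (?q z)"
  proof -
    have ne: "cball a R \<noteq> {}" using r by auto
    have "continuous_on (cball a R) (\<lambda>z. cmod (?q z))" by (intro continuous_intros q_cont)
    then obtain x where x: "x \<in> cball a R" "\<forall>y\<in>cball a R. cmod (?q x) \<le> cmod (?q y)"
      using continuous_attains_inf[OF compact_cball ne] by blast
    then show thesis using that[of "cmod (?q x)"] q_nz by auto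
  qed
  have low: "m * cmod (z - a) \<le> cmod (g0 z)" if "z \<in> cball a R" for z
  proof (cases "z = a")
    case False
    then have "cmod (g0 z) = cmod (z - a) * cmod (?q z)"
      using diff_quot_mult[of z a g0] zero(1) by (simp flip: norm_mult)
    then show ?thesis using mult_right_mono[OF m(2)[OF that] norm_ge_zero[of "z - a"]] by (simp add: mult.commute)
  qed (use zero in simp)
  define zs where "zs = (\<lambda>i. SOME z. z \<in> cball a R \<and> g i z = 0)"
  have ex: "eventually (\<lambda>i. \<exists>z. z \<in> cball a R \<and> g i z = 0) F"
  proof -
    have "m * R / 2 > 0" using m r by simp
    then have "eventually (\<lambda>i. \<forall>z\<in>cball a R. dist (g i z) (g0 z) < m * R / 2) F"
      by (rule uniform_limitD[OF lim])
    then show ?thesis using hol(1)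
    proof eventually_elim
      case (elim i)
      show ?case
      proof (rule ccontr)
        assume "\<not> ?thesis"
        then have nz: "\<And>z. z \<in> cball a R \<Longrightarrow> g i z \<noteq> 0" by blast
        have gi: "g i holomorphic_on cball a R" by (rule holomorphic_on_subset[OF elim(2) sub])
        have h: "(\<lambda>z. 1 / g i z) holomorphic_on cball a R"
          by (intro holomorphic_intros gi nz)
        have "cmod (1 / g i a) \<le> 1 / (m * R / 2)"
        proof (rule maximum_modulus_frontier[where S = "cball a R" and f = "\<lambda>z. 1 / g i z"])
          show "(\<lambda>z. 1 / g i z) holomorphic_on interior (cball a R)"
            by (rule holomorphic_on_subset[OF h]) (auto intro: ball_subset_cball[THEN subsetD])
          show "continuous_on (closure (cball a R)) (\<lambda>z. 1 / g i z)"
            using holomorphic_on_imp_continuous_on[OF h] by simp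
          show "cmod (1 / g i z) \<le> 1 / (m * R / 2)" if "z \<in> frontier (cball a R)" for z
          proof -
            have z: "z \<in> cball a R" "cmod (z - a) = R" using that by (auto simp: dist_norm norm_minus_commute)
            have "m * R \<le> cmod (g0 z)" using low[OF z(1)] z(2) by simp
            moreover have "cmod (g0 z) \<le> cmod (g i z) + dist (g i z) (g0 z)"
              using norm_triangle_ineq2[of "g0 z" "g i z"] by (simp add: dist_norm norm_minus_commute)
            moreover have "dist (g i z) (g0 z) < m * R / 2" using elim(1) z(1) by blast
            ultimately have "m * R / 2 \<le> cmod (g i z)" by linarith
            then show ?thesis
              using frac_le[of 1 1 "m * R / 2" "cmod (g i z)"] m(1) r(1) by (simp add: norm_divide)
          qed
        qed (use r in auto)
        moreover have "cmod (g i a) < m * R / 2" using bspec[OF elim(1), of a] r(1) zero(1) by (simp add: dist_norm)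
        moreover have "cmod (g i a) > 0" using nz[of a] r by simp
        ultimately show False
          using frac_less2[of 1 1 "cmod (g i a)" "m * R / 2"] by (simp add: norm_divide)
      qed
    qed
  qed
  then have zs_in: "eventually (\<lambda>i. zs i \<in> cball a R \<and> g i (zs i) = 0) F"
    by eventually_elim (unfold zs_def, rule someI_ex)
  have zs_lim: "(zs \<longlongrightarrow> a) F"
  proof (rule tendstoI)
    fix e :: real assume e: "e > 0"
    then have "m * e > 0" using m by simp
    then have "eventually (\<lambda>i. \<forall>z\<in>cball a R. dist (g i z) (g0 z) < m * e) F"
      by (rule uniform_limitD[OF lim])
    then show "eventually (\<lambda>i. dist (zs i) a < e) F" using zs_in
    proof eventually_elim
      case (elim i)
      then have "cmod (g0 (zs i)) < m * e" using bspec[OF elim(1), of "zs i"] by (simp add: dist_norm)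
      then have "m * cmod (zs i - a) < m * e" using low[of "zs i"] elim by simp
      then show ?case using m by (simp add: dist_norm)
    qed
  qed
  have q_lim: "uniform_limit (cball a R) (\<lambda>i. diff_quot (g i) (zs i)) ?q F"
    by (rule diff_quot_close(2)[OF r hol lim zs_lim])
  have uniq: "eventually (\<lambda>i. \<forall>z\<in>cball a R. g i z = 0 \<longleftrightarrow> z = zs i) F"
    using uniform_limitD[OF q_lim m(1)] zs_in
  proof eventually_elim
    case (elim i)
    show ?case
    proof (intro ballI iffI)
      fix z assume z: "z \<in> cball a R" "g i z = 0"
      show "z = zs i"
      proof (rule ccontr)
        assume ne: "z \<noteq> zs i"
        then have "(z - zs i) * diff_quot (g i) (zs i) z = 0"
          using diff_quot_mult[OF ne, of "g i"] z elim by simp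
        then have "diff_quot (g i) (zs i) z = 0" using ne by simp
        then show False using bspec[OF elim(1) z(1)] m(2)[OF z(1)] by (simp add: dist_norm)
      qed
    qed (use elim in simp)
  qed
  show thesis by (rule that[OF zs_lim uniq q_lim])
qed

text \<open>Dividing W by z - zs gives a nonvanishing V, and N / W = g / (zs - z) with g = - N / V.
  Splitting off g(zs) leaves minus a difference quotient of g. In the limit g and this quotient are
  real on the real axis, so the remainder has small imaginary part, the real part of the residue
  term is under control, and \<open>near_pole_bound\<close> applies.\<close>

theorem resonance_lorentzian:
  fixes W N :: "real \<Rightarrow> complex \<Rightarrow> complex" and e0 :: real
  defines "a \<equiv> complex_of_real e0"
  assumes r: "0 < \<rho>" "\<rho> < R" "R < r"
    and hol: "eventually (\<lambda>i. W i holomorphic_on ball a r) F" "W0 holomorphic_on ball a r"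
      "eventually (\<lambda>i. N i holomorphic_on ball a r) F" "N0 holomorphic_on ball a r"
    and lim: "uniform_limit (cball a R) W W0 F" "uniform_limit (cball a R) N N0 F"
    and zero: "W0 a = 0" "deriv W0 a \<noteq> 0" "\<And>z. z \<in> cball a R \<Longrightarrow> W0 z = 0 \<Longrightarrow> z = a"
    and real0: "\<And>x. \<bar>x - e0\<bar> \<le> R \<Longrightarrow> Im (W0 (of_real x)) = 0" "\<And>x. \<bar>x - e0\<bar> \<le> R \<Longrightarrow> Im (N0 (of_real x)) = 0"
    and neg: "eventually (\<lambda>i. \<forall>z\<in>cball a R. W i z = 0 \<longrightarrow> Im z < 0) F"
    and pos: "eventually (\<lambda>i. \<forall>x\<in>{e0 - \<rho>..e0 + \<rho>}. 0 \<le> Im (N i (of_real x) / W i (of_real x))) F"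
  obtains zs where "(zs \<longlongrightarrow> a) F"
    and "eventually (\<lambda>i. Im (zs i) < 0 \<and> (\<forall>z\<in>cball a R. W i z = 0 \<longleftrightarrow> z = zs i)) F"
    and "\<And>\<delta>. \<delta> > 0 \<Longrightarrow> eventually (\<lambda>i. \<forall>x\<in>{e0 - \<rho>..e0 + \<rho>}.
      \<bar>Im (N i (of_real x) / W i (of_real x)) / pi - Re (- N0 a / deriv W0 a) * poisson (- Im (zs i)) (Re (zs i) - x)\<bar>
        \<le> \<delta> * poisson (- Im (zs i)) (Re (zs i) - x) + \<delta>) F"
proof -
  have R0: "0 < R" using r by simp
  obtain zs where zs: "(zs \<longlongrightarrow> a) F" "eventually (\<lambda>i. \<forall>z\<in>cball a R. W i z = 0 \<longleftrightarrow> z = zs i) F"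
    and q_lim: "uniform_limit (cball a R) (\<lambda>i. diff_quot (W i) (zs i)) (diff_quot W0 a) F"
    using hurwitz_simple_zero[OF R0 r(3) hol(1,2) lim(1) zero] by blast
  have zs_in: "eventually (\<lambda>i. zs i \<in> ball a R) F"
    using tendstoD[OF zs(1) R0] by eventually_elim (simp add: dist_commute)
  have zs_neg: "eventually (\<lambda>i. Im (zs i) < 0 \<and> (\<forall>z\<in>cball a R. W i z = 0 \<longleftrightarrow> z = zs i)) F"
    using neg zs(2) zs_in by eventually_elim (auto dest: bspec)
  let ?VL = "diff_quot W0 a"
  let ?V = "\<lambda>i. diff_quot (W i) (zs i)"
  have sub: "cball a R \<subseteq> ball a r" using r by auto
  have V0_hol: "?VL holomorphic_on ball a r" by (rule diff_quot_holomorphic[OF hol(2)]) (use r in auto)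
  have V0_cont: "continuous_on (cball a R) ?VL"
    by (rule continuous_on_subset[OF holomorphic_on_imp_continuous_on[OF V0_hol] sub])
  have V0_nz: "?VL z \<noteq> 0" if "z \<in> cball a R" for z
  proof (cases "z = a")
    case False
    then have "W0 z \<noteq> 0" using zero(3)[OF that] by blast
    then show ?thesis using False zero(1) by (simp add: diff_quot_def)
  qed (use zero(2) in \<open>simp add: diff_quot_def\<close>)
  have ne: "cball a R \<noteq> {}" using R0 by auto
  obtain m where m: "m > 0" "\<And>z. z \<in> cball a R \<Longrightarrow> m \<le> cmod (?VL z)"
  proof -
    have "continuous_on (cball a R) (\<lambda>z. cmod (?VL z))" by (intro continuous_intros V0_cont)
    then obtain x where x: "x \<in> cball a R" "\<forall>y\<in>cball a R. cmod (?VL x) \<le> cmod (?VL y)"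
      using continuous_attains_inf[OF compact_cball ne] by blast
    then show thesis using that[of "cmod (?VL x)"] V0_nz by auto
  qed
  define g where "g = (\<lambda>i z. - N i z / ?V i z)"
  define g0 where "g0 = (\<lambda>z. - N0 z / ?VL z)"
  have V_nz: "eventually (\<lambda>i. \<forall>z\<in>cball a R. ?V i z \<noteq> 0) F"
    using uniform_limitD[OF q_lim m(1)]
  proof eventually_elim
    case (elim i)
    then show ?case using m(2) by (force simp: dist_norm)
  qed
  have g_hol: "eventually (\<lambda>i. g i holomorphic_on ball a R) F"
    using hol(1,3) V_nz zs_in
  proof eventually_elim
    case (elim i)
    have "zs i \<in> ball a r" using elim(4) r by auto
    then have V: "?V i holomorphic_on ball a r"
      by (intro diff_quot_holomorphic elim) simp
    have "ball a R \<subseteq> ball a r" using r by auto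
    note h = holomorphic_on_subset[OF elim(2) this] holomorphic_on_subset[OF V this]
    show ?case unfolding g_def
      by (rule holomorphic_on_divide[OF holomorphic_on_minus[OF h(1)] h(2)]) (use elim(3) in auto)
  qed
  have g0_hol: "g0 holomorphic_on ball a R"
  proof -
    have "ball a R \<subseteq> ball a r" using r by auto
    note h = holomorphic_on_subset[OF hol(4) this] holomorphic_on_subset[OF V0_hol this]
    show ?thesis unfolding g0_def
      by (rule holomorphic_on_divide[OF holomorphic_on_minus[OF h(1)] h(2)]) (use V0_nz in auto)
  qed
  have g_lim: "uniform_limit (cball a R) g g0 F"
    unfolding g_def g0_def
  proof (rule uniform_lim_divide)
    show "uniform_limit (cball a R) (\<lambda>i z. - N i z) (\<lambda>z. - N0 z) F"
      by (intro uniform_limit_intros lim)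
    have "continuous_on (cball a R) (\<lambda>z. - N0 z)"
      by (intro continuous_intros continuous_on_subset[OF holomorphic_on_imp_continuous_on[OF hol(4)] sub])
    then show "bounded ((\<lambda>z. - N0 z) ` cball a R)"
      by (intro compact_imp_bounded compact_continuous_image) auto
  qed (use q_lim m in auto)
  \<comment> \<open>An intermediate radius: g is known to be holomorphic only on the open ball of
    radius R, and closeness of its difference quotients requires a strictly smaller closed ball that
    still covers the interval.\<close>
  define s where "s = (\<rho> + R) / 2"
  have s: "\<rho> < s" "0 < s" "s < R" using r by (auto simp: s_def)
  have g_lim': "uniform_limit (cball a s) g g0 F"
    by (rule uniform_limit_on_subset[OF g_lim]) (use s in auto)
  note gq = diff_quot_close[OF s(2,3) g_hol g0_hol g_lim' zs(1)]
  have V0a: "?VL a = deriv W0 a" by (simp add: diff_quot_def)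
  have real_V0: "Im (?VL (of_real x)) = 0" if "\<bar>x - e0\<bar> \<le> R" "x \<noteq> e0" for x
  proof -
    have "of_real x \<noteq> a" using that by (simp add: a_def)
    moreover have "W0 (of_real x) = of_real (Re (W0 (of_real x)))" using real0(1)[OF that(1)] by (simp add: complex_eq_iff)
    ultimately have "?VL (of_real x) = of_real (Re (W0 (of_real x)) / (x - e0))"
      using zero(1) unfolding diff_quot_def a_def by (metis diff_zero of_real_diff of_real_divide)
    then show ?thesis by simp
  qed
  have real_V0a: "Im (?VL a) = 0"
    unfolding a_def
    by (rule holomorphic_real_at_center[of e0 R]) (use V0_cont R0 real_V0 in \<open>auto simp: a_def\<close>)
  have real_g0: "Im (g0 (of_real x)) = 0" if "\<bar>x - e0\<bar> \<le> R" for x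
  proof -
    have "Im (?VL (of_real x)) = 0" using real_V0[OF that] real_V0a by (cases "x = e0") (auto simp: a_def)
    then show ?thesis using real0(2)[OF that] by (simp add: g0_def Im_divide)
  qed
  let ?hL = "diff_quot g0 a"
  have real_h0': "Im (?hL (of_real x)) = 0" if "\<bar>x - e0\<bar> \<le> R" "x \<noteq> e0" for x
  proof -
    have ne: "of_real x \<noteq> a" using that by (simp add: a_def)
    have "g0 (of_real x) = of_real (Re (g0 (of_real x)))" using real_g0[OF that(1)] by (simp add: complex_eq_iff)
    moreover have "g0 a = of_real (Re (g0 a))" using real_g0[of e0] R0 by (simp add: complex_eq_iff a_def)
    ultimately have "?hL (of_real x) = of_real ((Re (g0 (of_real x)) - Re (g0 a)) / (x - e0))"
      using ne unfolding diff_quot_def a_def by (metis of_real_diff of_real_divide)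
    then show ?thesis by simp
  qed
  have h0_hol: "?hL holomorphic_on ball a R" by (rule diff_quot_holomorphic[OF g0_hol]) (use R0 in simp)
  have "continuous_on (cball a s) ?hL"
    by (rule continuous_on_subset[OF holomorphic_on_imp_continuous_on[OF h0_hol]]) (use s in auto)
  then have "Im (?hL (of_real e0)) = 0"
    unfolding a_def by (rule holomorphic_real_at_center[OF _ s(2)]) (use s real_h0' in \<open>auto simp: a_def\<close>)
  then have real_h0: "Im (?hL (of_real x)) = 0" if "\<bar>x - e0\<bar> \<le> R" for x
    using real_h0'[OF that] by (cases "x = e0") auto
  define c0 where "c0 = Re (- N0 a / deriv W0 a)"
  have c0: "Re (g0 a) = c0" by (simp add: g0_def V0a c0_def)
  have bound: "eventually (\<lambda>i. \<forall>x\<in>{e0 - \<rho>..e0 + \<rho>}.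
      \<bar>Im (N i (of_real x) / W i (of_real x)) / pi - c0 * poisson (- Im (zs i)) (Re (zs i) - x)\<bar>
        \<le> \<delta> * poisson (- Im (zs i)) (Re (zs i) - x) + \<delta>) F" if \<delta>: "\<delta> > 0" for \<delta>
  proof -
    \<comment> \<open>K makes |Re c| / K at most \<delta>/8 as soon as Re c is within 1 of c0; only
      then is \<tau> chosen, so small that 2 K \<tau> = \<delta>/8.\<close>
    define K where "K = max 1 (8 * (\<bar>c0\<bar> + 1) / \<delta>)"
    have K1: "1 \<le> K" by (simp add: K_def)
    have K2: "(\<bar>c0\<bar> + 1) / K \<le> \<delta> / 8"
    proof -
      have "8 * (\<bar>c0\<bar> + 1) / \<delta> \<le> K" by (simp add: K_def)
      then show ?thesis using \<delta> K1 by (simp add: field_simps)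
    qed
    define \<tau> where "\<tau> = \<delta> / (16 * K)"
    have \<tau>: "\<tau> > 0" "2 * K * \<tau> = \<delta> / 8" "\<tau> \<le> \<delta> / 8" using \<delta> K1 by (auto simp: \<tau>_def field_simps)
    have e1: "eventually (\<lambda>i. dist (g i (zs i)) (g0 a) < min 1 (\<delta> / 8)) F"
      by (rule tendstoD[OF gq(1)]) (use \<delta> in simp)
    have e2: "eventually (\<lambda>i. \<forall>z\<in>cball a s. dist (diff_quot (g i) (zs i) z) (?hL z) < \<tau>) F"
      by (rule uniform_limitD[OF gq(2) \<tau>(1)])
    \<comment> \<open>The three bounds ensure \<gamma> at most 1, e within \<rho>/2 of e0, and K
      sqrt \<gamma> at most \<rho>/2, so that the test points of \<open>near_pole_bound\<close>
      remain in the interval.\<close>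
    define d where "d = min 1 (min (\<rho> / 2) ((\<rho> / (2 * K))\<^sup>2))"
    have d: "d > 0" using r K1 by (auto simp: d_def)
    have e3: "eventually (\<lambda>i. dist (zs i) a < d) F" by (rule tendstoD[OF zs(1) d])
    show ?thesis
      using e1 e2 e3 pos zs_neg zs_in
    proof eventually_elim
      case (elim i)
      define \<gamma> where "\<gamma> = - Im (zs i)"
      define e where "e = Re (zs i)"
      have z: "zs i = Complex e (- \<gamma>)" by (simp add: e_def \<gamma>_def)
      have \<gamma>0: "\<gamma> > 0" using elim(5) by (simp add: \<gamma>_def)
      have za: "cmod (zs i - a) < d" using elim(3) by (simp add: dist_norm)
      have \<gamma>d: "\<gamma> < d" using abs_Im_le_cmod[of "zs i - a"] za by (simp add: \<gamma>_def a_def)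
      have ed: "\<bar>e - e0\<bar> < d" using abs_Re_le_cmod[of "zs i - a"] za by (simp add: e_def a_def)
      have Ks: "K * sqrt \<gamma> \<le> \<rho> / 2"
      proof -
        have "sqrt \<gamma> \<le> sqrt ((\<rho> / (2 * K))\<^sup>2)" using \<gamma>d by (intro real_sqrt_le_mono) (simp add: d_def)
        also have "\<dots> = \<rho> / (2 * K)" using r K1 by simp
        finally show ?thesis using K1 by (simp add: field_simps)
      qed
      define c where "c = g i (zs i)"
      define H where "H = (\<lambda>x::real. - diff_quot (g i) (zs i) (of_real x))"
      have Heq: "N i (of_real x) / W i (of_real x) = c / (Complex e (- \<gamma>) - of_real x) + H x"
        if x: "x \<in> {e0 - \<rho>..e0 + \<rho>}" for x
      proof -
        have nx: "of_real x \<noteq> zs i" using \<gamma>0 by (auto simp: z complex_eq_iff)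
        then have nx': "of_real x - zs i \<noteq> 0" "zs i - of_real x \<noteq> 0" by auto
        have "of_real x - a = complex_of_real (x - e0)" by (simp add: a_def)
        then have "cmod (of_real x - a) = \<bar>x - e0\<bar>" by (simp only: norm_of_real)
        moreover have "\<bar>x - e0\<bar> \<le> R" using x r unfolding atLeastAtMost_iff by linarith
        ultimately have xin: "complex_of_real x \<in> cball a R" by (simp add: dist_norm norm_minus_commute)
        have "zs i \<in> cball a R" using elim(6) by auto
        then have "W i (zs i) = 0" using elim(5) by blast
        then have Wx: "W i (of_real x) = (of_real x - zs i) * ?V i (of_real x)"
          using diff_quot_mult[OF nx, of "W i"] by simp
        have "W i (of_real x) \<noteq> 0" using elim(5) xin nx by blast
        then have Vx: "?V i (of_real x) \<noteq> 0" unfolding Wx by auto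
        have "N i (of_real x) / W i (of_real x) = g i (of_real x) / (zs i - of_real x)"
          unfolding Wx g_def using Vx nx' by (simp add: divide_simps) (simp add: algebra_simps)
        also have "g i (of_real x) = c + (of_real x - zs i) * diff_quot (g i) (zs i) (of_real x)"
          unfolding diff_quot_mult[OF nx] c_def by simp
        also have "\<dots> / (zs i - of_real x) = c / (zs i - of_real x) + H x"
          unfolding H_def using nx' by (simp add: divide_simps) (simp add: algebra_simps)
        finally show ?thesis by (simp add: z)
      qed
      have Hb: "\<bar>Im (H x)\<bar> \<le> \<tau>" if x: "x \<in> {e0 - \<rho>..e0 + \<rho>}" for x
      proof -
        have "of_real x - a = complex_of_real (x - e0)" by (simp add: a_def)
        then have "cmod (of_real x - a) = \<bar>x - e0\<bar>" by (simp only: norm_of_real)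
        moreover have xs: "\<bar>x - e0\<bar> \<le> s" using x s unfolding atLeastAtMost_iff by linarith
        ultimately have xin: "complex_of_real x \<in> cball a s" by (simp add: dist_norm norm_minus_commute)
        have "Im (?hL (of_real x)) = 0" by (rule real_h0) (use xs s in linarith)
        then have "\<bar>Im (H x)\<bar> = \<bar>Im (diff_quot (g i) (zs i) (of_real x) - ?hL (of_real x))\<bar>"
          by (simp add: H_def)
        also have "\<dots> \<le> dist (diff_quot (g i) (zs i) (of_real x)) (?hL (of_real x))"
          unfolding dist_norm by (rule abs_Im_le_cmod)
        also have "\<dots> \<le> \<tau>" using elim(2) xin by (auto intro: less_imp_le)
        finally show ?thesis .
      qed
      have cc: "\<bar>Re c - c0\<bar> < min 1 (\<delta> / 8)"
        using elim(1) abs_Re_le_cmod[of "c - g0 a"] by (simp add: c_def dist_norm c0)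
      have Rc: "\<bar>Re c\<bar> / K \<le> \<delta> / 8"
      proof -
        have "\<bar>Re c - c0\<bar> < 1" using cc by simp
        then have "\<bar>Re c\<bar> \<le> \<bar>c0\<bar> + 1" by linarith
        then have "\<bar>Re c\<bar> / K \<le> (\<bar>c0\<bar> + 1) / K" using K1 by (intro divide_right_mono) auto
        then show ?thesis using K2 by linarith
      qed
      have cc': "\<bar>Re c - c0\<bar> \<le> \<delta> / 8" using cc by simp
      show ?case
      proof
        fix x assume x: "x \<in> {e0 - \<rho>..e0 + \<rho>}"
        have "\<bar>Im (c / (Complex e (- \<gamma>) - of_real x) + H x) / pi - c0 * poisson \<gamma> (e - x)\<bar>
          \<le> (\<bar>Re c - c0\<bar> + (\<bar>Re c\<bar> / K + 2 * K * \<tau>) / 2) * poisson \<gamma> (e - x) + (\<bar>Re c\<bar> / K + 2 * K * \<tau>) + \<tau>"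
        proof (rule near_pole_bound[OF \<gamma>0 _ Hb _ K1 _ x])
          show "\<gamma> \<le> 1" using \<gamma>d by (simp add: d_def)
          show "0 \<le> Im (c / (Complex e (- \<gamma>) - complex_of_real x) + H x)" if "x \<in> {e0 - \<rho>..e0 + \<rho>}" for x
            using elim(4) that unfolding Heq[OF that, symmetric] by blast
          have "\<bar>e - e0\<bar> \<le> \<rho> / 2" using ed by (simp add: d_def)
          then have "e0 - \<rho> \<le> e - K * sqrt \<gamma>" "e + K * sqrt \<gamma> \<le> e0 + \<rho>" using Ks by linarith+
          then show "{e - K * sqrt \<gamma>..e + K * sqrt \<gamma>} \<subseteq> {e0 - \<rho>..e0 + \<rho>}" by auto
        qed
        also have "\<dots> \<le> \<delta> * poisson \<gamma> (e - x) + \<delta>"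
        proof -
          have aux1: "u + (v + w) / 2 \<le> \<delta>"
            if "u \<le> \<delta> / 8" "v \<le> \<delta> / 8" "w = \<delta> / 8" for u v w :: real
            using that \<delta> by argo
          have aux2: "x + (v + w) + t \<le> y + \<delta>"
            if "v \<le> \<delta> / 8" "w = \<delta> / 8" "t \<le> \<delta> / 8" "x \<le> y" for v w t x y :: real
            using that \<delta> by argo
          show ?thesis
            by (rule aux2[OF Rc \<tau>(2,3)],
                rule mult_right_mono[OF aux1[OF cc' Rc \<tau>(2)] less_imp_le[OF poisson_pos[OF \<gamma>0]]])
        qed
        finally show "\<bar>Im (N i (of_real x) / W i (of_real x)) / pi - c0 * poisson (- Im (zs i)) (Re (zs i) - x)\<bar>
          \<le> \<delta> * poisson (- Im (zs i)) (Re (zs i) - x) + \<delta>"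
          unfolding Heq[OF x] \<gamma>_def[symmetric] e_def[symmetric] .
      qed
    qed
  qed
  show thesis by (rule that[OF zs(1) zs_neg bound[unfolded c0_def]])
qed

subsection \<open>The Stieltjes transform of a state in the interval\<close>

text \<open>Dominated convergence along sequences, with a convergent sequence and its limit as the
  compact set. The weight is kept apart from the kernel because kernel bounds are available only
  where the weight does not vanish.\<close>

lemma continuous_on_integral_param:
  fixes f :: "'p \<Rightarrow> 'a::heine_borel \<Rightarrow> complex" and w :: "'p \<Rightarrow> complex"
  assumes w: "integrable M w"
    and meas: "\<And>\<theta>. \<theta> \<in> S \<Longrightarrow> (\<lambda>p. w p * f p \<theta>) \<in> borel_measurable M"
    and cont: "\<And>p. w p \<noteq> 0 \<Longrightarrow> continuous_on S (f p)"
    and bound: "\<And>K. compact K \<Longrightarrow> K \<subseteq> S \<Longrightarrow> \<exists>B. \<forall>p. w p \<noteq> 0 \<longrightarrow> (\<forall>\<theta>\<in>K. cmod (f p \<theta>) \<le> B)"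
  shows "continuous_on S (\<lambda>\<theta>. LINT p|M. w p * f p \<theta>)"
    and "\<And>\<theta>. \<theta> \<in> S \<Longrightarrow> integrable M (\<lambda>p. w p * f p \<theta>)"
proof -
  have bd: "\<exists>B. \<forall>p. \<forall>\<theta>\<in>K. cmod (w p * f p \<theta>) \<le> cmod (w p) * B" if K: "compact K" "K \<subseteq> S" for K
  proof -
    obtain B where B: "\<And>p \<theta>. w p \<noteq> 0 \<Longrightarrow> \<theta> \<in> K \<Longrightarrow> cmod (f p \<theta>) \<le> B"
      using bound[OF K] by blast
    have "cmod (w p * f p \<theta>) \<le> cmod (w p) * B" if "\<theta> \<in> K" for p \<theta>
      using B[OF _ that, of p] by (cases "w p = 0") (auto simp: norm_mult intro: mult_left_mono)
    then show ?thesis by blast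
  qed
  show int: "integrable M (\<lambda>p. w p * f p \<theta>)" if \<theta>: "\<theta> \<in> S" for \<theta>
  proof -
    obtain B where B: "\<And>p. cmod (w p * f p \<theta>) \<le> cmod (w p) * B"
      using bd[of "{\<theta>}"] \<theta> by auto
    have "integrable M (\<lambda>p. cmod (w p) * B)" by (intro integrable_mult_left integrable_norm w)
    then show ?thesis
      by (rule Bochner_Integration.integrable_bound[OF _ meas[OF \<theta>]])
         (use B in \<open>auto intro: order_trans[OF _ abs_ge_self]\<close>)
  qed
  show "continuous_on S (\<lambda>\<theta>. LINT p|M. w p * f p \<theta>)"
    unfolding continuous_on_sequentially
  proof (intro allI ballI impI, elim conjE)
    fix x a assume x: "a \<in> S" "\<forall>n. x n \<in> S" "x \<longlonglongrightarrow> a"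
    obtain B where B: "\<And>p \<theta>. \<theta> \<in> insert a (range x) \<Longrightarrow> cmod (w p * f p \<theta>) \<le> cmod (w p) * B"
      using bd[OF compact_sequence_with_limit[OF x(3)]] x by blast
    have "(\<lambda>n. LINT p|M. w p * f p (x n)) \<longlonglongrightarrow> (LINT p|M. w p * f p a)"
    proof (rule integral_dominated_convergence[where w = "\<lambda>p. cmod (w p) * B"])
      show "integrable M (\<lambda>p. cmod (w p) * B)" by (intro integrable_mult_left integrable_norm w)
      show "AE p in M. (\<lambda>n. w p * f p (x n)) \<longlonglongrightarrow> w p * f p a"
      proof (rule AE_I2)
        fix p
        show "(\<lambda>n. w p * f p (x n)) \<longlonglongrightarrow> w p * f p a"
        proof (cases "w p = 0")
          case False
          have "(\<lambda>n. f p (x n)) \<longlonglongrightarrow> f p a"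
            by (rule continuous_on_tendsto_compose[OF cont[OF False] x(3,1)]) (use x(2) in simp)
          then show ?thesis by (rule tendsto_mult_left)
        qed simp
      qed
      show "AE p in M. norm (w p * f p (x n)) \<le> cmod (w p) * B" for n
        by (rule AE_I2, rule B) simp
    qed (use meas x in auto)
    then show "((\<lambda>\<theta>. LINT p|M. w p * f p \<theta>) \<circ> x) \<longlonglongrightarrow> (LINT p|M. w p * f p a)"
      by (simp add: o_def)
  qed
qed

text \<open>On the circle the bound is immediate, and the maximum principle carries it to the
  centre, where the quotient is a derivative.\<close>

lemma diff_quot_bound:
  assumes hol: "g holomorphic_on ball a r" and s: "0 < s" "s < r"
    and B: "\<And>z. z \<in> cball a s \<Longrightarrow> cmod (g z) \<le> B" and z: "z \<in> cball a s"
  shows "cmod (diff_quot g a z) \<le> 2 * B / s"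
proof (rule maximum_modulus_frontier[where S = "cball a s" and f = "diff_quot g a"])
  have D: "diff_quot g a holomorphic_on ball a r" by (rule diff_quot_holomorphic[OF hol]) (use s in simp)
  have sub: "cball a s \<subseteq> ball a r" using s by auto
  show "diff_quot g a holomorphic_on interior (cball a s)"
    by (rule holomorphic_on_subset[OF D]) (use s in auto)
  show "continuous_on (closure (cball a s)) (diff_quot g a)"
    using continuous_on_subset[OF holomorphic_on_imp_continuous_on[OF D] sub] by simp
  show "cmod (diff_quot g a w) \<le> 2 * B / s" if "w \<in> frontier (cball a s)" for w
  proof -
    have w: "cmod (w - a) = s" "w \<in> cball a s" using that by (auto simp: dist_norm norm_minus_commute)
    then have "w \<noteq> a" using s by auto
    have "cmod (g w - g a) \<le> 2 * B"
      using norm_triangle_ineq4[of "g w" "g a"] B[OF w(2)] B[of a] s by simp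
    then show ?thesis using \<open>w \<noteq> a\<close> w(1) s by (simp add: diff_quot_def norm_divide divide_right_mono)
  qed
qed (use z in auto)

text \<open>The difference quotients of the integrands form a family of the same kind, locally
  bounded by \<open>diff_quot_bound\<close>. Continuity of their integral at the base point is the
  existence of the derivative.\<close>

lemma holomorphic_on_integral_param:
  fixes f :: "'p \<Rightarrow> complex \<Rightarrow> complex" and w :: "'p \<Rightarrow> complex"
  assumes S: "open S" and w: "integrable M w"
    and meas: "\<And>z. z \<in> S \<Longrightarrow> (\<lambda>p. w p * f p z) \<in> borel_measurable M"
    and hol: "\<And>p. w p \<noteq> 0 \<Longrightarrow> f p holomorphic_on S"
    and bound: "\<And>K. compact K \<Longrightarrow> K \<subseteq> S \<Longrightarrow> \<exists>B. \<forall>p. w p \<noteq> 0 \<longrightarrow> (\<forall>z\<in>K. cmod (f p z) \<le> B)"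
  shows "(\<lambda>z. LINT p|M. w p * f p z) holomorphic_on S"
proof -
  let ?F = "\<lambda>z. LINT p|M. w p * f p z"
  have int: "integrable M (\<lambda>p. w p * f p z)" if "z \<in> S" for z
    by (rule continuous_on_integral_param(2)[OF w meas holomorphic_on_imp_continuous_on[OF hol] bound that])
  have "\<exists>D. (?F has_field_derivative D) (at a)" if a: "a \<in> S" for a
  proof -
    obtain r where r: "r > 0" "ball a r \<subseteq> S" using S a open_contains_ball by blast
    let ?q = "\<lambda>p. diff_quot (f p) a"
    let ?D = "\<lambda>z. LINT p|M. w p * ?q p z"
    have q_hol: "?q p holomorphic_on ball a r" if "w p \<noteq> 0" for p
      by (rule diff_quot_holomorphic[OF holomorphic_on_subset[OF hol[OF that] r(2)]]) (use r in simp)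
    have q_meas: "(\<lambda>p. w p * ?q p z) \<in> borel_measurable M" if z: "z \<in> ball a r" for z
    proof -
      have ne: "(\<lambda>p. w p * ?q p z) \<in> borel_measurable M" if "z \<in> ball a r" "z \<noteq> a" for z
      proof -
        have "(\<lambda>p. w p * ?q p z) = (\<lambda>p. (w p * f p z - w p * f p a) / (z - a))"
          using that by (simp add: diff_quot_def fun_eq_iff right_diff_distrib)
        also have "\<dots> \<in> borel_measurable M"
          using meas[of z] meas[OF a] that r by (intro borel_measurable_divide borel_measurable_diff borel_measurable_const) auto
        finally show ?thesis .
      qed
      show ?thesis
      proof (cases "z = a")
        case True
        \<comment> \<open>At the base point the quotient is a derivative in z; as a function of p it
          is measurable as the limit of quotients along this sequence.\<close>
        define X where "X = (\<lambda>n. a + of_real (r / 2 / real (Suc n)))"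
        have Xa: "X n \<in> ball a r" "X n \<noteq> a" for n
        proof -
          have p: "0 < r / 2 / real (Suc n)" "r / 2 / real (Suc n) < r" using r by (auto simp: divide_simps)
          then show "X n \<noteq> a" unfolding X_def by (metis add_cancel_right_right less_irrefl of_real_eq_0_iff)
          have "dist a (X n) = r / 2 / real (Suc n)"
            using p unfolding X_def dist_norm by (simp del: of_real_divide add: norm_minus_commute)
          then show "X n \<in> ball a r" using p by simp
        qed
        have "X \<longlonglongrightarrow> a + of_real 0" unfolding X_def
          by (intro tendsto_intros LIMSEQ_Suc lim_const_over_n)
        then have X: "X \<longlonglongrightarrow> a" by simp
        show ?thesis
        proof (rule borel_measurable_LIMSEQ_metric)
          show "(\<lambda>p. w p * ?q p (X n)) \<in> borel_measurable M" for n by (rule ne[OF Xa])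
          show "(\<lambda>n. w p * ?q p (X n)) \<longlonglongrightarrow> w p * ?q p z" for p
          proof (cases "w p = 0")
            case False
            have "(\<lambda>n. ?q p (X n)) \<longlonglongrightarrow> ?q p a"
              by (rule continuous_on_tendsto_compose[OF holomorphic_on_imp_continuous_on[OF q_hol[OF False]] X])
                 (use r Xa in auto)
            then show ?thesis unfolding True by (rule tendsto_mult_left)
          qed simp
        qed
      qed (rule ne[OF z])
    qed
    have q_bound: "\<exists>B. \<forall>p. w p \<noteq> 0 \<longrightarrow> (\<forall>z\<in>K. cmod (?q p z) \<le> B)" if K: "compact K" "K \<subseteq> ball a r" for K
    proof -
      obtain s where s: "0 < s" "s < r" "K \<subseteq> cball a s"
      proof (cases "K = {}")
        case True
        then show thesis using that[of "r / 2"] r by auto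
      next
        case False
        obtain x where x: "x \<in> K" "\<forall>y\<in>K. dist a y \<le> dist a x"
        proof -
          have "continuous_on K (\<lambda>y. dist a y)" by (intro continuous_intros)
          from continuous_attains_sup[OF K(1) False this] show thesis using that by blast
        qed
        define s where "s = max (dist a x) (r / 2)"
        have "dist a x < r" using x(1) K(2) by auto
        then have "0 < s" "s < r" using r by (auto simp: s_def)
        moreover have "K \<subseteq> cball a s" using x(2) by (fastforce simp: s_def)
        ultimately show thesis by (rule that)
      qed
      have "cball a s \<subseteq> S" using s(2) r(2) by (force simp: subset_iff)
      from bound[OF compact_cball this]
      obtain B where B0: "\<forall>p. w p \<noteq> 0 \<longrightarrow> (\<forall>z\<in>cball a s. cmod (f p z) \<le> B)" ..
      have B: "cmod (f p z) \<le> B" if "w p \<noteq> 0" "z \<in> cball a s" for p z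
        using B0 that by blast
      have "cmod (?q p z) \<le> 2 * B / s" if "w p \<noteq> 0" "z \<in> K" for p z
        by (rule diff_quot_bound[OF holomorphic_on_subset[OF hol[OF that(1)] r(2)] s(1,2) B[OF that(1)]])
           (use that s(3) in auto)
      then show ?thesis by blast
    qed
    note D = continuous_on_integral_param[OF w q_meas holomorphic_on_imp_continuous_on[OF q_hol] q_bound]
    have Dc: "isCont ?D a" using D(1) r(1) by (simp add: continuous_on_eq_continuous_at)
    have "eventually (\<lambda>z. z \<in> ball a r) (at a)"
      by (rule eventually_at_in_open') (use r(1) in auto)
    moreover have "eventually (\<lambda>z. z \<noteq> a) (at a)" by (simp add: eventually_at_filter)
    ultimately have ev: "eventually (\<lambda>z. ?D z = (?F z - ?F a) / (z - a)) (at a)"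
    proof eventually_elim
      case (elim z)
      have z: "z \<in> S" using elim r by auto
      have "?F z - ?F a = (LINT p|M. (w p * f p z - w p * f p a))"
        using int[OF z] int[OF a] by simp
      also have "\<dots> = (LINT p|M. (z - a) * (w p * ?q p z))"
        by (intro Bochner_Integration.integral_cong refl)
           (simp only: mult.left_commute[of "z - a"] diff_quot_mult[OF elim(2)] right_diff_distrib)
      also have "\<dots> = (z - a) * ?D z" by (rule integral_mult_right_zero)
      finally show ?case using elim(2) by simp
    qed
    have "((\<lambda>z. (?F z - ?F a) / (z - a)) \<longlongrightarrow> ?D a) (at a)"
      by (rule Lim_transform_eventually[OF _ ev]) (use Dc in \<open>simp add: isCont_def\<close>)
    then show ?thesis unfolding has_field_derivative_iff by blast
  qed
  then show ?thesis using S holomorphic_on_open by blast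
qed

section \<open>Boundary values and the Dirichlet limit of the edge functions\<close>

lemma continuous_on_edge_sol [continuous_intros]:
  fixes f h :: "'a::t2_space \<Rightarrow> real" and g :: "'a \<Rightarrow> complex"
  assumes "continuous_on S f" "continuous_on S g" "continuous_on S h"
  shows "continuous_on S (\<lambda>x. edge_sol (f x) (g x) (h x))"
  unfolding edge_sol_def by (intro continuous_intros assms)

lemma continuous_on_edge_wronskian [continuous_intros]:
  fixes f :: "'a::t2_space \<Rightarrow> real" and g :: "'a \<Rightarrow> complex"
  assumes "continuous_on S f" "continuous_on S g"
  shows "continuous_on S (\<lambda>x. edge_wronskian \<kappa> (f x) (g x))"
  unfolding edge_wronskian_def by (intro continuous_intros assms)

lemma holomorphic_edge_wronskian: "edge_wronskian \<kappa> \<eta> holomorphic_on S"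
  unfolding edge_wronskian_def by (intro holomorphic_intros)

lemma edge_wronskian_0: "edge_wronskian \<kappa> \<eta> 0 = of_real (2 * \<eta> + 2 * \<kappa>)"
  by (simp add: edge_wronskian_def)

lemma edge_wronskian_Dirichlet: "edge_wronskian \<kappa> 0 k = of_real (2 * \<kappa>) * csinc (k * of_real (2 * \<kappa>))"
  by (simp add: edge_wronskian_def)

lemma edge_wronskian_nonzero:
  assumes "0 \<le> Im k" "\<kappa> > 0" "\<eta> > 0"
  shows "edge_wronskian \<kappa> \<eta> k \<noteq> 0"
proof (cases "k = 0")
  case True
  have "2 * \<eta> + 2 * \<kappa> \<noteq> 0" using assms by simp
  then show ?thesis unfolding True edge_wronskian_0 of_real_eq_0_iff .
next
  case False
  then show ?thesis
    using resonance_factor_nonzero[OF assms(1) False assms(2,3)] by (simp add: edge_wronskian_eq_0_iff)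
qed

lemma edge_wronskian_Dirichlet_zero:
  assumes "\<kappa> > 0" "0 \<le> Re k" "edge_wronskian \<kappa> 0 k = 0"
  obtains s where "k = of_real s" "s > 0" "sin (s * (2 * \<kappa>)) = 0"
proof -
  have "csinc (k * of_real (2 * \<kappa>)) = 0" using assms by (simp add: edge_wronskian_Dirichlet)
  then have s0: "k * of_real (2 * \<kappa>) \<noteq> 0" "sin (k * of_real (2 * \<kappa>)) = 0" by (auto simp: csinc_eq_0_iff)
  from s0(2) obtain m :: int where m: "k * of_real (2 * \<kappa>) = of_real (real_of_int m * pi)"
    by (auto simp: sin_eq_0)
  define s where "s = real_of_int m * pi / (2 * \<kappa>)"
  have k: "k = of_real s" using m assms(1) by (simp add: s_def field_simps)
  have "s \<noteq> 0" "s \<ge> 0" using s0(1) k assms(2) by auto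
  then have "s > 0" by simp
  moreover have "complex_of_real (sin (s * (2 * \<kappa>))) = 0" using s0(2) unfolding k by (simp flip: sin_of_real)
  then have "sin (s * (2 * \<kappa>)) = 0" by (simp only: of_real_eq_0_iff)
  ultimately show thesis using k that by blast
qed

text \<open>The principal root jumps across the negative axis but is continuous from above; the
  formula with real square roots shows this on the closed half plane.\<close>

lemma continuous_on_csqrt_upper: "continuous_on {z. 0 \<le> Im z} csqrt"
proof -
  have "continuous_on {z. 0 \<le> Im z} (\<lambda>z. of_real (sqrt ((cmod z + Re z) / 2)) + \<i> * of_real (sqrt ((cmod z - Re z) / 2)))"
    by (intro continuous_intros) auto
  moreover have "of_real (sqrt ((cmod z + Re z) / 2)) + \<i> * of_real (sqrt ((cmod z - Re z) / 2)) = csqrt z" if "0 \<le> Im z" for z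
    using that by (auto simp: complex_eq_iff sgn_if)
  ultimately show ?thesis by (rule continuous_on_eq) auto
qed

lemma Im_csqrt_nonneg: "0 \<le> Im z \<Longrightarrow> 0 \<le> Im (csqrt z)"
  by (auto simp: sgn_if abs_Re_le_cmod intro!: mult_nonneg_nonneg real_sqrt_ge_zero complex_Re_le_cmod)

text \<open>The momentum of a real energy is real or purely imaginary. The Dirichlet quantities are
  even in k, hence real in either case.\<close>

lemma cnj_csqrt_of_real: "cnj (csqrt (of_real x)) = csqrt (of_real x) \<or> cnj (csqrt (of_real x)) = - csqrt (of_real x)"
  by (cases "0 \<le> x") (simp_all add: csqrt_of_real_nonneg csqrt_of_real_nonpos)

lemma cnj_edge_sol_Dirichlet: "cnj k = k \<or> cnj k = - k \<Longrightarrow> cnj (edge_sol 0 k a) = edge_sol 0 k a"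
  by (auto simp: edge_sol_def cnj_csinc)

lemma edge_wronskian_Dirichlet_real:
  "Im (edge_wronskian \<kappa> 0 (csqrt (of_real x))) = 0"
proof -
  have "cnj (edge_wronskian \<kappa> 0 (csqrt (of_real x))) = edge_wronskian \<kappa> 0 (csqrt (of_real x))"
    using cnj_csqrt_of_real[of x] by (auto simp: edge_wronskian_Dirichlet cnj_csinc)
  then show ?thesis by (simp add: complex_eq_iff)
qed

text \<open>At \<eta> = 0 the Wronskian is sin(2 \<kappa> sqrt z) / sqrt z. Where the sine vanishes
  only its own derivative contributes, and the cosine is 1 or -1 there, so the zero is
  simple.\<close>

lemma deriv_edge_wronskian_Dirichlet:
  assumes "E > 0" "sin (sqrt E * (2 * \<kappa>)) = 0"
  shows "((\<lambda>z. edge_wronskian \<kappa> 0 (csqrt z)) has_field_derivative of_real (\<kappa> * cos (sqrt E * (2 * \<kappa>)) / E)) (at (of_real E))"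
proof -
  define k where "k = sqrt E"
  have k: "k > 0" "k\<^sup>2 = E" using assms by (auto simp: k_def)
  have ES: "complex_of_real E \<in> slit_plane" using assms by (simp add: slit_plane_def complex_nonpos_Reals_iff)
  have cE: "csqrt (of_real E) = of_real k" using assms by (simp add: k_def csqrt_of_real_nonneg)
  have s0: "sin (of_real k * of_real (2 * \<kappa>)) = (0::complex)"
    using assms(2) by (simp only: k_def[symmetric] of_real_mult[symmetric] sin_of_real of_real_0)
  have c0: "cos (of_real k * of_real (2 * \<kappa>)) = complex_of_real (cos (k * (2 * \<kappa>)))"
    by (simp only: of_real_mult[symmetric] cos_of_real)
  have "((\<lambda>z. sin (csqrt z * of_real (2 * \<kappa>)) / csqrt z) has_field_derivative
      (cos (of_real k * of_real (2 * \<kappa>)) * (inverse (2 * of_real k) * of_real (2 * \<kappa>)) * of_real k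
        - sin (of_real k * of_real (2 * \<kappa>)) * inverse (2 * of_real k)) / (of_real k * of_real k)) (at (of_real E))"
  proof -
    have z: "complex_of_real E \<notin> \<real>\<^sub>\<le>\<^sub>0" using ES by (simp add: slit_plane_def)
    note Dk = has_field_derivative_csqrt[OF z]
    have "csqrt (of_real E) \<noteq> 0" using k(1) by (simp add: cE)
    from DERIV_divide[OF DERIV_chain2[OF DERIV_sin DERIV_cmult_right[OF Dk, of "of_real (2 * \<kappa>)"]] Dk this]
    show ?thesis unfolding cE .
  qed
  also have "(cos (of_real k * of_real (2 * \<kappa>)) * (inverse (2 * of_real k) * of_real (2 * \<kappa>)) * of_real k
        - sin (of_real k * of_real (2 * \<kappa>)) * inverse (2 * of_real k)) / (of_real k * of_real k)
     = complex_of_real (\<kappa> * cos (k * (2 * \<kappa>)) / E)"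
    unfolding s0 c0 k(2)[symmetric] using k(1) by (simp add: field_simps power2_eq_square)
  finally have D: "((\<lambda>z. sin (csqrt z * of_real (2 * \<kappa>)) / csqrt z) has_field_derivative
      of_real (\<kappa> * cos (sqrt E * (2 * \<kappa>)) / E)) (at (of_real E))" by (simp add: k_def)
  have eq: "sin (csqrt z * of_real (2 * \<kappa>)) / csqrt z = edge_wronskian \<kappa> 0 (csqrt z)" if "z \<in> slit_plane" for z
    using csinc_mult[of "csqrt z * of_real (2 * \<kappa>)"] csqrt_nonzero_slit_plane[OF that]
    unfolding edge_wronskian_Dirichlet by (metis (no_types, lifting) mult.assoc nonzero_mult_div_cancel_left)
  show ?thesis
    by (rule has_field_derivative_transform_within_open[OF D open_slit_plane ES eq])
qed

text \<open>The quadratic form of the interval kernel without its Wronskian denominator. It is one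
  integral over the product measure, so that the parameter lemmas apply with a weight independent of
  \<eta> and k.\<close>

definition edge_num :: "real \<Rightarrow> (real \<Rightarrow> complex) \<Rightarrow> real \<Rightarrow> complex \<Rightarrow> complex" where
  "edge_num \<kappa> \<phi> \<eta> k = (LINT p|(lborel \<Otimes>\<^sub>M lborel). (cnj (\<phi> (fst p)) * \<phi> (snd p)) *
     (edge_sol \<eta> k (min (fst p) (snd p) + \<kappa>) * edge_sol \<eta> k (\<kappa> - max (fst p) (snd p))))"

text \<open>The support condition is pointwise, which confines the arguments of
  \<open>edge_sol\<close> to the compact interval from 0 to 2\<kappa> wherever the weight is
  nonzero.\<close>

locale box_state =
  fixes \<kappa> :: real and \<phi> :: "real \<Rightarrow> complex"
  assumes \<kappa>: "\<kappa> > 0" and \<phi>: "\<phi> \<in> L2" and supp: "\<And>x. x \<notin> {-\<kappa>..\<kappa>} \<Longrightarrow> \<phi> x = 0"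
begin

abbreviation weight :: "real \<times> real \<Rightarrow> complex" where
  "weight p \<equiv> cnj (\<phi> (fst p)) * \<phi> (snd p)"

abbreviation kernel :: "real \<Rightarrow> complex \<Rightarrow> real \<times> real \<Rightarrow> complex" where
  "kernel \<eta> k p \<equiv> edge_sol \<eta> k (min (fst p) (snd p) + \<kappa>) * edge_sol \<eta> k (\<kappa> - max (fst p) (snd p))"

lemma meas [measurable]: "\<phi> \<in> borel_measurable borel"
  using \<phi> by (rule L2_measurable)

lemma integrable_phi: "integrable lborel \<phi>"
proof -
  have "(\<lambda>x. indicator {-\<kappa>..\<kappa>} x *\<^sub>R \<phi> x) = \<phi>"
    using supp by (auto simp: fun_eq_iff indicator_def)
  then show ?thesis using L2_set_integrable[OF \<phi>, of "-\<kappa>" \<kappa>] by (simp add: set_integrable_def)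
qed

lemma product_integrable:
  fixes f g :: "real \<Rightarrow> complex"
  assumes "integrable lborel f" "integrable lborel g"
  shows "integrable (lborel \<Otimes>\<^sub>M lborel) (\<lambda>p. f (fst p) * g (snd p))"
    and "(LINT p|(lborel \<Otimes>\<^sub>M lborel). f (fst p) * g (snd p)) = (LINT x|lborel. f x) * (LINT x|lborel. g x)"
proof -
  have fm: "f \<in> borel_measurable borel" "g \<in> borel_measurable borel"
    using borel_measurable_integrable[OF assms(1)] borel_measurable_integrable[OF assms(2)] by simp_all
  have m: "(\<lambda>p. f (fst p) * g (snd p)) \<in> borel_measurable (lborel \<Otimes>\<^sub>M lborel)"
    by (rule borel_lborel_pair) (use fm in measurable)
  show i: "integrable (lborel \<Otimes>\<^sub>M lborel) (\<lambda>p. f (fst p) * g (snd p))"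
  proof (rule lborel_pair.Fubini_integrable[OF m])
    have "(\<lambda>x. LINT y|lborel. norm (f (fst (x, y)) * g (snd (x, y)))) = (\<lambda>x. norm (f x) * (LINT y|lborel. norm (g y)))"
      by (simp add: norm_mult)
    then show "integrable lborel (\<lambda>x. LINT y|lborel. norm (f (fst (x, y)) * g (snd (x, y))))"
      using assms(1) by simp
    show "AE x in lborel. integrable lborel (\<lambda>y. f (fst (x, y)) * g (snd (x, y)))"
      using assms(2) by simp
  qed
  have "(LINT p|(lborel \<Otimes>\<^sub>M lborel). f (fst p) * g (snd p)) = (LINT x|lborel. LINT y|lborel. f x * g y)"
    using lborel_pair.integral_fst'[OF i] by simp
  also have "\<dots> = (LINT x|lborel. f x * (LINT y|lborel. g y))"
    by (simp only: integral_mult_right_zero)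
  also have "\<dots> = (LINT x|lborel. f x) * (LINT x|lborel. g x)"
    by (rule integral_mult_left_zero)
  finally show "(LINT p|(lborel \<Otimes>\<^sub>M lborel). f (fst p) * g (snd p)) = (LINT x|lborel. f x) * (LINT x|lborel. g x)" .
qed

lemma weight_integrable: "integrable (lborel \<Otimes>\<^sub>M lborel) weight"
  by (intro product_integrable(1) integrable_phi) (simp add: integrable_phi)

lemma kernel_measurable: "(\<lambda>p. weight p * kernel \<eta> k p) \<in> borel_measurable (lborel \<Otimes>\<^sub>M lborel)"
proof (rule borel_lborel_pair)
  have [measurable]: "edge_sol \<eta> k \<in> borel_measurable borel"
    by (intro borel_measurable_continuous_onI continuous_intros continuous_on_id)
  show "(\<lambda>p. weight p * kernel \<eta> k p) \<in> borel_measurable (borel \<Otimes>\<^sub>M borel)" by measurable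
qed

lemma kernel_bound:
  assumes "compact K"
  shows "\<exists>B. \<forall>p. weight p \<noteq> 0 \<longrightarrow> (\<forall>\<theta>\<in>K. cmod (kernel (fst \<theta>) (snd \<theta>) p) \<le> B)"
proof -
  let ?f = "\<lambda>t::(real \<times> complex) \<times> real \<times> real. edge_sol (fst (fst t)) (snd (fst t)) (fst (snd t)) * edge_sol (fst (fst t)) (snd (fst t)) (snd (snd t))"
  have "compact (?f ` (K \<times> {0..2 * \<kappa>} \<times> {0..2 * \<kappa>}))"
    by (intro compact_continuous_image compact_Times assms continuous_intros) auto
  from compact_imp_bounded[OF this]
  obtain B where B0: "\<forall>y\<in>?f ` (K \<times> {0..2 * \<kappa>} \<times> {0..2 * \<kappa>}). cmod y \<le> B"
    unfolding bounded_iff ..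
  have B: "cmod (?f t) \<le> B" if "t \<in> K \<times> {0..2 * \<kappa>} \<times> {0..2 * \<kappa>}" for t
    by (rule bspec[OF B0 imageI[OF that]])
  have "cmod (kernel (fst \<theta>) (snd \<theta>) p) \<le> B" if w: "weight p \<noteq> 0" and \<theta>: "\<theta> \<in> K" for p \<theta>
  proof -
    have "fst p \<in> {-\<kappa>..\<kappa>}" "snd p \<in> {-\<kappa>..\<kappa>}" using w supp by auto
    then have "min (fst p) (snd p) + \<kappa> \<in> {0..2 * \<kappa>}" "\<kappa> - max (fst p) (snd p) \<in> {0..2 * \<kappa>}" by auto
    then show ?thesis using B[of "(\<theta>, min (fst p) (snd p) + \<kappa>, \<kappa> - max (fst p) (snd p))"] \<theta> by simp
  qed
  then show ?thesis by blast
qed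

lemma continuous_on_edge_num: "continuous_on UNIV (\<lambda>\<theta>. edge_num \<kappa> \<phi> (fst \<theta>) (snd \<theta>))"
  and integrable_edge_num: "integrable (lborel \<Otimes>\<^sub>M lborel) (\<lambda>p. weight p * kernel \<eta> k p)"
proof -
  note c = continuous_on_integral_param[OF weight_integrable, of UNIV "\<lambda>p \<theta>. kernel (fst \<theta>) (snd \<theta>) p"]
  have 1: "continuous_on UNIV (\<lambda>\<theta>. kernel (fst \<theta>) (snd \<theta>) p)" for p
    by (intro continuous_intros)
  have 2: "\<exists>B. \<forall>p. weight p \<noteq> 0 \<longrightarrow> (\<forall>\<theta>\<in>K. cmod (kernel (fst \<theta>) (snd \<theta>) p) \<le> B)" if "compact K" "K \<subseteq> UNIV" for K
    by (rule kernel_bound[OF that(1)])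
  show "continuous_on UNIV (\<lambda>\<theta>. edge_num \<kappa> \<phi> (fst \<theta>) (snd \<theta>))"
    unfolding edge_num_def by (rule c(1)[OF kernel_measurable 1 2])
  have "integrable (lborel \<Otimes>\<^sub>M lborel) (\<lambda>p. weight p * kernel (fst (\<eta>, k)) (snd (\<eta>, k)) p)"
    by (rule c(2)[OF kernel_measurable 1 2 UNIV_I])
  then show "integrable (lborel \<Otimes>\<^sub>M lborel) (\<lambda>p. weight p * kernel \<eta> k p)"
    by (simp only: fst_conv snd_conv)
qed

lemma holomorphic_edge_num: "edge_num \<kappa> \<phi> \<eta> holomorphic_on UNIV"
proof -
  have "(\<lambda>k. LINT p|(lborel \<Otimes>\<^sub>M lborel). weight p * kernel \<eta> k p) holomorphic_on UNIV"
  proof (rule holomorphic_on_integral_param[OF open_UNIV weight_integrable kernel_measurable])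
    show "(\<lambda>k. kernel \<eta> k p) holomorphic_on UNIV" for p
      unfolding edge_sol_def by (intro holomorphic_intros)
    show "\<exists>B. \<forall>p. weight p \<noteq> 0 \<longrightarrow> (\<forall>k\<in>K. cmod (kernel \<eta> k p) \<le> B)" if K: "compact K" for K
    proof -
      obtain B where B: "\<forall>p. weight p \<noteq> 0 \<longrightarrow> (\<forall>\<theta>\<in>{\<eta>} \<times> K. cmod (kernel (fst \<theta>) (snd \<theta>) p) \<le> B)"
        using kernel_bound[OF compact_Times[OF compact_sing K]] by blast
      have "cmod (kernel \<eta> k p) \<le> B" if "weight p \<noteq> 0" "k \<in> K" for p k
      proof -
        have "(\<eta>, k) \<in> {\<eta>} \<times> K" using that(2) by simp
        from B[rule_format, OF that(1) this] show ?thesis by (simp only: fst_conv snd_conv)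
      qed
      then show ?thesis by blast
    qed
  qed
  then show ?thesis by (simp add: edge_num_def[abs_def])
qed

lemma integral_lborel_swap:
  fixes g :: "real \<times> real \<Rightarrow> complex"
  assumes "g \<in> borel_measurable (lborel \<Otimes>\<^sub>M lborel)"
  shows "(LINT p|(lborel \<Otimes>\<^sub>M lborel). g (snd p, fst p)) = (LINT p|(lborel \<Otimes>\<^sub>M lborel). g p)"
  using lborel_pair.integral_product_swap[OF assms] by (simp add: case_prod_beta')

text \<open>Conjugation exchanges the two variables in the weight, while the kernel at \<eta> = 0 is
  real and symmetric.\<close>

lemma edge_num_Dirichlet_real: "Im (edge_num \<kappa> \<phi> 0 (csqrt (of_real x))) = 0"
proof -
  let ?k = "csqrt (of_real x)"
  let ?g = "\<lambda>p. weight p * kernel 0 ?k p"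
  have c: "cnj (kernel 0 ?k p) = kernel 0 ?k p" for p
    by (simp add: cnj_edge_sol_Dirichlet[OF cnj_csqrt_of_real])
  have "cnj (edge_num \<kappa> \<phi> 0 ?k) = (LINT p|(lborel \<Otimes>\<^sub>M lborel). cnj (?g p))"
    unfolding edge_num_def by (rule Bochner_Integration.integral_cnj[symmetric])
  also have "\<dots> = (LINT p|(lborel \<Otimes>\<^sub>M lborel). ?g (snd p, fst p))"
  proof (intro Bochner_Integration.integral_cong refl)
    fix p :: "real \<times> real"
    show "cnj (?g p) = ?g (snd p, fst p)"
      unfolding complex_cnj_mult[of "weight p"] c by (simp add: mult_ac min.commute max.commute)
  qed
  also have "\<dots> = (LINT p|(lborel \<Otimes>\<^sub>M lborel). ?g p)"
    by (rule integral_lborel_swap[OF kernel_measurable])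
  also have "\<dots> = edge_num \<kappa> \<phi> 0 ?k" by (simp add: edge_num_def)
  finally show ?thesis by (simp add: complex_eq_iff)
qed

text \<open>At an eigenvalue the left and right solutions are proportional with factor - cos(2
  \<kappa> k). The kernel becomes a product of functions of one variable each, and the double
  integral a squared coefficient.\<close>

lemma edge_num_Dirichlet:
  assumes k: "k > 0" "sin (k * (2 * \<kappa>)) = 0"
  shows "edge_num \<kappa> \<phi> 0 (of_real k) = of_real (- cos (k * (2 * \<kappa>)) / k\<^sup>2 * (cmod (l2_inner \<phi> (box_sin \<kappa> k)))\<^sup>2)"
proof -
  have es: "edge_sol 0 (of_real k) a = of_real (sin (k * a) / k)" for a
  proof -
    have "of_real k * edge_sol 0 (of_real k) a = sin (of_real k * of_real a)"
      using csinc_mult[of "of_real k * of_real a"] by (simp add: edge_sol_def mult_ac)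
    also have "\<dots> = complex_of_real (sin (k * a))" by (simp flip: sin_of_real)
    finally show ?thesis using k(1) by (simp add: field_simps)
  qed
  have sin_refl: "sin (k * (\<kappa> - y)) = - cos (k * (2 * \<kappa>)) * sin (k * (y + \<kappa>))" for y
  proof -
    have "k * (\<kappa> - y) = k * (2 * \<kappa>) - k * (y + \<kappa>)" by (simp add: algebra_simps)
    then show ?thesis by (simp only: sin_diff k(2); simp)
  qed
  have ker: "kernel 0 (of_real k) p = of_real (- cos (k * (2 * \<kappa>)) / k\<^sup>2) * (of_real (sin (k * (fst p + \<kappa>))) * of_real (sin (k * (snd p + \<kappa>))))" for p
  proof -
    have "kernel 0 (of_real k) p = of_real (sin (k * (min (fst p) (snd p) + \<kappa>)) / k * (- cos (k * (2 * \<kappa>)) * sin (k * (max (fst p) (snd p) + \<kappa>)) / k))"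
      unfolding es sin_refl by (simp only: of_real_mult)
    also have "sin (k * (min (fst p) (snd p) + \<kappa>)) / k * (- cos (k * (2 * \<kappa>)) * sin (k * (max (fst p) (snd p) + \<kappa>)) / k)
      = - cos (k * (2 * \<kappa>)) / k\<^sup>2 * (sin (k * (fst p + \<kappa>)) * sin (k * (snd p + \<kappa>)))"
      by (simp add: min_def max_def power2_eq_square)
    finally show ?thesis by (simp only: of_real_mult)
  qed
  let ?f = "\<lambda>x. cnj (\<phi> x) * box_sin \<kappa> k x"
  have f: "integrable lborel ?f" by (rule L2_integrable_inner[OF \<phi> box_sin_L2])
  have fc: "(\<lambda>x. cnj (?f x)) = (\<lambda>x. box_sin \<kappa> k x * \<phi> x)"
    by (auto simp: fun_eq_iff box_sin_def indicator_def)
  have f': "integrable lborel (\<lambda>x. box_sin \<kappa> k x * \<phi> x)"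
    unfolding fc[symmetric] by (simp only: integrable_cnj f)
  have "edge_num \<kappa> \<phi> 0 (of_real k) = (LINT p|(lborel \<Otimes>\<^sub>M lborel). of_real (- cos (k * (2 * \<kappa>)) / k\<^sup>2) * (?f (fst p) * (box_sin \<kappa> k (snd p) * \<phi> (snd p))))"
    unfolding edge_num_def
  proof (intro Bochner_Integration.integral_cong refl)
    fix p :: "real \<times> real"
    show "weight p * kernel 0 (of_real k) p = of_real (- cos (k * (2 * \<kappa>)) / k\<^sup>2) * (?f (fst p) * (box_sin \<kappa> k (snd p) * \<phi> (snd p)))"
    proof (cases "fst p \<in> {-\<kappa>..\<kappa>} \<and> snd p \<in> {-\<kappa>..\<kappa>}")
      case True
      then show ?thesis unfolding ker box_sin_def by (simp add: mult_ac)
    next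
      case False
      then have "\<phi> (fst p) = 0 \<or> \<phi> (snd p) = 0" using supp by blast
      then show ?thesis by auto
    qed
  qed
  also have "\<dots> = of_real (- cos (k * (2 * \<kappa>)) / k\<^sup>2) * (LINT p|(lborel \<Otimes>\<^sub>M lborel). ?f (fst p) * (box_sin \<kappa> k (snd p) * \<phi> (snd p)))"
    by (rule integral_mult_right_zero)
  also have "(LINT p|(lborel \<Otimes>\<^sub>M lborel). ?f (fst p) * (box_sin \<kappa> k (snd p) * \<phi> (snd p))) = (LINT x|lborel. ?f x) * (LINT x|lborel. box_sin \<kappa> k x * \<phi> x)"
    by (rule product_integrable(2)[OF f f'])
  also have "(LINT x|lborel. box_sin \<kappa> k x * \<phi> x) = cnj (LINT x|lborel. ?f x)"
    unfolding fc[symmetric] by (rule Bochner_Integration.integral_cnj)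
  also have "(LINT x|lborel. ?f x) = l2_inner \<phi> (box_sin \<kappa> k)" by (simp add: l2_inner_def)
  also have "l2_inner \<phi> (box_sin \<kappa> k) * cnj (l2_inner \<phi> (box_sin \<kappa> k)) = of_real ((cmod (l2_inner \<phi> (box_sin \<kappa> k)))\<^sup>2)"
    by (rule complex_norm_square[symmetric])
  finally show ?thesis by (simp only: of_real_mult)
qed

lemma resolvent_edge_num:
  assumes z: "Im z > 0" and \<eta>: "\<eta> > 0"
  shows "l2_inner \<phi> (\<lambda>x. LINT y|lborel. delta_green \<kappa> \<eta> (csqrt z) x y * \<phi> y)
    = edge_num \<kappa> \<phi> \<eta> (csqrt z) / edge_wronskian \<kappa> \<eta> (csqrt z)"
proof -
  let ?k = "csqrt z"
  let ?W = "edge_wronskian \<kappa> \<eta> ?k"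
  have k: "Im ?k > 0" by (rule Im_csqrt_pos[OF z])
  then have k0: "?k \<noteq> 0" by (metis complex_eq_iff less_irrefl zero_complex.sel(2))
  have nz: "resonance_factor \<kappa> \<eta> ?k 1 \<noteq> 0" "resonance_factor \<kappa> \<eta> ?k (-1) \<noteq> 0"
    using resonance_factor_nonzero[OF less_imp_le[OF k] k0 \<kappa> \<eta>] by auto
  have "l2_inner \<phi> (\<lambda>x. LINT y|lborel. delta_green \<kappa> \<eta> ?k x y * \<phi> y)
     = (LINT x|lborel. LINT y|lborel. weight (x, y) * kernel \<eta> ?k (x, y) / ?W)"
    unfolding l2_inner_def
  proof (intro Bochner_Integration.integral_cong refl)
    fix x
    have "cnj (\<phi> x) * (LINT y|lborel. delta_green \<kappa> \<eta> ?k x y * \<phi> y) = (LINT y|lborel. cnj (\<phi> x) * (delta_green \<kappa> \<eta> ?k x y * \<phi> y))"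
      by (rule integral_mult_right_zero[symmetric])
    also have "\<dots> = (LINT y|lborel. weight (x, y) * kernel \<eta> ?k (x, y) / ?W)"
    proof (intro Bochner_Integration.integral_cong refl)
      fix y
      show "cnj (\<phi> x) * (delta_green \<kappa> \<eta> ?k x y * \<phi> y) = weight (x, y) * kernel \<eta> ?k (x, y) / ?W"
      proof (cases "x \<in> {-\<kappa>..\<kappa>} \<and> y \<in> {-\<kappa>..\<kappa>}")
        case True
        then have "\<bar>x\<bar> \<le> \<kappa>" "\<bar>y\<bar> \<le> \<kappa>" by auto
        from delta_green_edge_sol[OF k0 \<kappa> this nz] show ?thesis by simp
      next
        case False
        then have "\<phi> x = 0 \<or> \<phi> y = 0" using supp by blast
        then show ?thesis by auto
      qed
    qed
    finally show "cnj (\<phi> x) * (LINT y|lborel. delta_green \<kappa> \<eta> ?k x y * \<phi> y) = (LINT y|lborel. weight (x, y) * kernel \<eta> ?k (x, y) / ?W)" .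
  qed
  also have "\<dots> = (LINT p|(lborel \<Otimes>\<^sub>M lborel). weight p * kernel \<eta> ?k p / ?W)"
    by (rule lborel_pair.integral_fst') (intro integrable_divide integrable_edge_num)
  also have "\<dots> = edge_num \<kappa> \<phi> \<eta> ?k / ?W"
    unfolding edge_num_def by (rule integral_divide_zero)
  finally show ?thesis .
qed

lemma resolvent_edge_num_Im:
  assumes z: "Im z > 0" and \<eta>: "\<eta> > 0"
  shows "0 \<le> Im (edge_num \<kappa> \<phi> \<eta> (csqrt z) / edge_wronskian \<kappa> \<eta> (csqrt z))"
proof -
  have "H_delta \<kappa> \<eta> (\<lambda>x. LINT y|lborel. delta_green \<kappa> \<eta> (csqrt z) x y * \<phi> y)
      (\<lambda>x. \<phi> x + z * (LINT y|lborel. delta_green \<kappa> \<eta> (csqrt z) x y * \<phi> y))"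
    using delta_green_resolvent[OF Im_csqrt_pos[OF z] \<kappa> \<eta> \<phi>] by simp
  from H_delta_resolvent_Im[OF this \<phi>] z show ?thesis
    unfolding resolvent_edge_num[OF z \<eta>] by simp
qed

text \<open>The element M of the overview: it is the resolvent element for Im z > 0, by
  \<open>resolvent_edge_num\<close>, and its formula supplies the boundary values on the real
  axis.\<close>

definition stieltjes :: "real \<Rightarrow> complex \<Rightarrow> complex" where
  "stieltjes \<eta> z = edge_num \<kappa> \<phi> \<eta> (csqrt z) / edge_wronskian \<kappa> \<eta> (csqrt z)"

lemma continuous_on_stieltjes:
  assumes "\<eta> > 0" shows "continuous_on {z. 0 \<le> Im z} (stieltjes \<eta>)"
proof -
  have c: "continuous_on {z. 0 \<le> Im z} (\<lambda>z. (\<eta>, csqrt z))"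
    by (intro continuous_intros continuous_on_csqrt_upper)
  show ?thesis
    unfolding stieltjes_def[abs_def]
  proof (rule continuous_on_divide)
    show "continuous_on {z. 0 \<le> Im z} (\<lambda>z. edge_num \<kappa> \<phi> \<eta> (csqrt z))"
      using continuous_on_compose2[OF continuous_on_edge_num c] by simp
    show "continuous_on {z. 0 \<le> Im z} (\<lambda>z. edge_wronskian \<kappa> \<eta> (csqrt z))"
      by (intro continuous_intros continuous_on_csqrt_upper)
    show "\<forall>z\<in>{z. 0 \<le> Im z}. edge_wronskian \<kappa> \<eta> (csqrt z) \<noteq> 0"
      using edge_wronskian_nonzero[OF Im_csqrt_nonneg \<kappa> assms] by auto
  qed
qed

lemma stieltjes_Im_nonneg:
  assumes "\<eta> > 0" shows "0 \<le> Im (stieltjes \<eta> (of_real x))"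
proof -
  let ?z = "\<lambda>n. Complex x (1 / real (Suc n))"
  have "(\<lambda>n. 1 / real (Suc n)) \<longlonglongrightarrow> 0"
    using LIMSEQ_inverse_real_of_nat by (simp add: inverse_eq_divide)
  then have "?z \<longlonglongrightarrow> of_real x" unfolding complex_of_real_def by (intro tendsto_Complex tendsto_const)
  then have "(\<lambda>n. stieltjes \<eta> (?z n)) \<longlonglongrightarrow> stieltjes \<eta> (of_real x)"
    by (rule continuous_on_tendsto_compose[OF continuous_on_stieltjes[OF assms]]) auto
  then have "(\<lambda>n. Im (stieltjes \<eta> (?z n))) \<longlonglongrightarrow> Im (stieltjes \<eta> (of_real x))" by (rule tendsto_Im)
  moreover have "0 \<le> Im (stieltjes \<eta> (?z n))" for n
    unfolding stieltjes_def by (rule resolvent_edge_num_Im[OF _ assms]) simp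
  ultimately show ?thesis by (intro LIMSEQ_le_const) auto
qed

end

subsection \<open>Decay\<close>

text \<open>The difference of the density and the Lorentzians has an integrable pointwise majorant
  of integral \<delta> times a constant, and the oscillating factor has modulus 1. Each j
  contributes 1 from the relative error, 2 \<rho> from the absolute error on its interval and c from
  the tail; q - p comes from the rest of {p..q}.\<close>

lemma lorentzian_sum_estimate:
  fixes F h :: "real \<Rightarrow> real" and E \<rho> c e \<gamma> :: "'j \<Rightarrow> real"
  assumes J: "finite J" and \<delta>: "\<delta> \<ge> 0" and pq: "p \<le> q" and t: "t \<ge> 0"
    and F: "F \<in> borel_measurable borel"
    and h: "h \<in> borel_measurable borel" "\<And>x. 0 \<le> h x \<and> h x \<le> 1" "\<And>x. x \<notin> {p..q} \<Longrightarrow> h x = 0"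
    and c: "\<And>j. j \<in> J \<Longrightarrow> 0 \<le> c j" and \<gamma>: "\<And>j. j \<in> J \<Longrightarrow> 0 < \<gamma> j" and \<rho>: "\<And>j. j \<in> J \<Longrightarrow> 0 < \<rho> j"
    and disj: "disjoint_family_on (\<lambda>j. {E j - \<rho> j..E j + \<rho> j}) J"
    and one: "\<And>j x. j \<in> J \<Longrightarrow> x \<in> {E j - \<rho> j..E j + \<rho> j} \<Longrightarrow> h x = 1"
    and near: "\<And>j x. j \<in> J \<Longrightarrow> x \<in> {E j - \<rho> j..E j + \<rho> j} \<Longrightarrow>
      \<bar>F x - c j * poisson (\<gamma> j) (e j - x)\<bar> \<le> \<delta> * poisson (\<gamma> j) (e j - x) + \<delta>"
    and off: "\<And>x. x \<in> {p..q} \<Longrightarrow> (\<And>j. j \<in> J \<Longrightarrow> x \<notin> {E j - \<rho> j..E j + \<rho> j}) \<Longrightarrow> \<bar>F x\<bar> \<le> \<delta>"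
    and tail: "\<And>j x. j \<in> J \<Longrightarrow> x \<notin> {E j - \<rho> j..E j + \<rho> j} \<Longrightarrow> poisson (\<gamma> j) (e j - x) \<le> \<delta> * cauchy_density (x - E j)"
  shows "cmod ((LINT x|lborel. exp (- \<i> * of_real t * of_real x) * of_real (h x) * of_real (F x))
      - (\<Sum>j\<in>J. of_real (c j) * exp (- \<i> * of_real t * Complex (e j) (- \<gamma> j))))
    \<le> \<delta> * ((\<Sum>j\<in>J. 1 + 2 * \<rho> j + c j) + (q - p))"
proof -
  define I where "I = (\<lambda>j. {E j - \<rho> j..E j + \<rho> j})"
  define P where "P = (\<lambda>j x. poisson (\<gamma> j) (e j - x))"
  define G where "G = (\<lambda>x. (\<Sum>j\<in>J. \<delta> * P j x + \<delta> * indicator (I j) x + c j * (\<delta> * cauchy_density (x - E j))) + \<delta> * indicator {p..q} x)"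
  have P0: "0 \<le> P j x" if "j \<in> J" for j x using poisson_pos[OF \<gamma>[OF that]] by (simp add: P_def less_imp_le)
  have cd0: "0 \<le> cauchy_density y" for y using cauchy_density_pos by (rule less_imp_le)
  have pt: "\<bar>h x * F x - (\<Sum>j\<in>J. c j * P j x)\<bar> \<le> G x" for x
  proof -
    have ind: "indicator (\<Union> (I ` J)) x = (\<Sum>j\<in>J. indicator (I j) x :: real)"
      by (rule indicator_UN_disjoint[OF J]) (use disj in \<open>simp add: I_def\<close>)
    \<comment> \<open>Each summand pairs the density on its own interval, where h = 1, with the full
      Lorentzian, so that off the interval only the tail remains; the last term lives off all
      intervals.\<close>
    have "h x * F x - (\<Sum>j\<in>J. c j * P j x)
       = (\<Sum>j\<in>J. h x * F x * indicator (I j) x - c j * P j x) + h x * F x * (1 - indicator (\<Union> (I ` J)) x)"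
      unfolding ind by (simp add: sum_subtractf sum_distrib_left algebra_simps)
    also have "\<bar>\<dots>\<bar> \<le> (\<Sum>j\<in>J. \<bar>h x * F x * indicator (I j) x - c j * P j x\<bar>) + \<bar>h x * F x * (1 - indicator (\<Union> (I ` J)) x)\<bar>"
      by (rule order_trans[OF abs_triangle_ineq]) (intro add_mono sum_abs order_refl)
    also have "\<dots> \<le> G x"
      unfolding G_def
    proof (intro add_mono sum_mono)
      fix j assume j: "j \<in> J"
      show "\<bar>h x * F x * indicator (I j) x - c j * P j x\<bar> \<le> \<delta> * P j x + \<delta> * indicator (I j) x + c j * (\<delta> * cauchy_density (x - E j))"
      proof (cases "x \<in> I j")
        case True
        have "0 \<le> c j * (\<delta> * cauchy_density (x - E j))" using c[OF j] \<delta> cd0 by simp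
        moreover have "\<bar>F x - c j * P j x\<bar> \<le> \<delta> * P j x + \<delta>" using near[OF j, of x] True by (simp add: I_def P_def)
        ultimately show ?thesis using True one[OF j, of x] by (simp add: I_def)
      next
        case False
        have "P j x \<le> \<delta> * cauchy_density (x - E j)" using tail[OF j, of x] False by (simp add: I_def P_def)
        then have "c j * P j x \<le> c j * (\<delta> * cauchy_density (x - E j))" using c[OF j] by (rule mult_left_mono)
        moreover have "0 \<le> \<delta> * P j x" "0 \<le> c j * P j x" using \<delta> P0[OF j] c[OF j] by auto
        ultimately show ?thesis using False by simp
      qed
    next
      show "\<bar>h x * F x * (1 - indicator (\<Union> (I ` J)) x)\<bar> \<le> \<delta> * indicator {p..q} x"
      proof (cases "x \<in> {p..q} \<and> x \<notin> \<Union> (I ` J)")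
        case True
        then have "\<bar>F x\<bar> \<le> \<delta>" by (intro off) (auto simp: I_def)
        moreover have "\<bar>h x * F x\<bar> \<le> 1 * \<bar>F x\<bar>" unfolding abs_mult using h(2)[of x] by (intro mult_right_mono) auto
        ultimately show ?thesis using True by simp
      next
        case False
        then have z: "h x * F x * (1 - indicator (\<Union> (I ` J)) x) = 0" using h(3)[of x] by (auto simp: indicator_def)
        show ?thesis unfolding z using \<delta> by simp
      qed
    qed
    finally show ?thesis .
  qed
  have iP: "integrable lborel (P j)" "(LINT x|lborel. P j x) = 1" if "j \<in> J" for j
    unfolding P_def using poisson_integrable[OF \<gamma>[OF that]] by auto
  have iI: "integrable lborel (\<lambda>x. indicator (I j) x :: real)" "(LINT x|lborel. indicator (I j) x :: real) = 2 * \<rho> j" if "j \<in> J" for j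
    unfolding I_def using \<rho>[OF that] by (auto intro!: integrable_real_indicator simp: emeasure_lborel_Icc_eq)
  have ipq: "integrable lborel (\<lambda>x. indicator {p..q} x :: real)" "(LINT x|lborel. indicator {p..q} x :: real) = q - p"
    using pq by (auto intro!: integrable_real_indicator simp: emeasure_lborel_Icc_eq)
  have ic: "integrable lborel (\<lambda>x. cauchy_density (x - b))" "(LINT x|lborel. cauchy_density (x - b)) = 1" for b
  proof -
    show "integrable lborel (\<lambda>x. cauchy_density (x - b))"
      using lborel_integrable_real_affine[OF cauchy_density_integrable, of 1 "- b"] by simp
    show "(LINT x|lborel. cauchy_density (x - b)) = 1"
      using lborel_integral_real_affine[of 1 cauchy_density "- b"] cauchy_density_integral by simp
  qed
  have iG: "integrable lborel G"
    unfolding G_def using iP iI ipq ic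
    by (intro Bochner_Integration.integrable_add Bochner_Integration.integrable_sum integrable_mult_right) auto
  have "(LINT x|lborel. G x) = (\<Sum>j\<in>J. \<delta> * 1 + \<delta> * (2 * \<rho> j) + c j * (\<delta> * 1)) + \<delta> * (q - p)"
  proof -
    have ij: "integrable lborel (\<lambda>x. \<delta> * P j x + \<delta> * indicator (I j) x + c j * (\<delta> * cauchy_density (x - E j)))" if "j \<in> J" for j
      using iP[OF that] iI[OF that] ic by (intro Bochner_Integration.integrable_add integrable_mult_right) auto
    have vj: "(LINT x|lborel. \<delta> * P j x + \<delta> * indicator (I j) x + c j * (\<delta> * cauchy_density (x - E j))) = \<delta> * 1 + \<delta> * (2 * \<rho> j) + c j * (\<delta> * 1)" if "j \<in> J" for j
      using iP[OF that] iI[OF that] ic[of "E j"] by simp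
    have "(LINT x|lborel. G x) = (LINT x|lborel. (\<Sum>j\<in>J. \<delta> * P j x + \<delta> * indicator (I j) x + c j * (\<delta> * cauchy_density (x - E j)))) + (LINT x|lborel. \<delta> * indicator {p..q} x)"
      unfolding G_def using ij ipq by (intro Bochner_Integration.integral_add Bochner_Integration.integrable_sum integrable_mult_right) auto
    also have "(LINT x|lborel. (\<Sum>j\<in>J. \<delta> * P j x + \<delta> * indicator (I j) x + c j * (\<delta> * cauchy_density (x - E j))))
       = (\<Sum>j\<in>J. (LINT x|lborel. \<delta> * P j x + \<delta> * indicator (I j) x + c j * (\<delta> * cauchy_density (x - E j))))"
      using ij by (rule Bochner_Integration.integral_sum)
    also have "\<dots> = (\<Sum>j\<in>J. \<delta> * 1 + \<delta> * (2 * \<rho> j) + c j * (\<delta> * 1))" by (intro sum.cong refl vj)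
    also have "(LINT x|lborel. \<delta> * indicator {p..q} x) = \<delta> * (q - p)" using ipq(2) by simp
    finally show ?thesis .
  qed
  also have "\<dots> = \<delta> * ((\<Sum>j\<in>J. 1 + 2 * \<rho> j + c j) + (q - p))"
    by (simp add: sum_distrib_left algebra_simps)
  finally have vG: "(LINT x|lborel. G x) = \<delta> * ((\<Sum>j\<in>J. 1 + 2 * \<rho> j + c j) + (q - p))" .
  let ?e = "\<lambda>x. exp (- \<i> * of_real t * of_real x)"
  have ne: "cmod (?e x) = 1" for x by simp
  have em: "?e \<in> borel_measurable borel" by (intro borel_measurable_continuous_onI continuous_intros)
  have Pm: "P j \<in> borel_measurable borel" for j unfolding P_def by measurable
  note [measurable] = F h(1) em Pm
  have iD: "integrable lborel (\<lambda>x. ?e x * of_real (h x * F x - (\<Sum>j\<in>J. c j * P j x)))"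
  proof (rule Bochner_Integration.integrable_bound[OF iG])
    show "AE x in lborel. norm (?e x * of_real (h x * F x - (\<Sum>j\<in>J. c j * P j x))) \<le> norm (G x)"
      unfolding norm_mult ne norm_of_real using pt by (auto intro: order_trans[OF _ abs_ge_self])
  qed measurable
  have ePi: "integrable lborel (\<lambda>x. ?e x * of_real (P j x))" if "j \<in> J" for j
    by (rule Bochner_Integration.integrable_bound[OF iP(1)[OF that]]) (auto simp: norm_mult)
  have eP: "(LINT x|lborel. ?e x * of_real (P j x)) = exp (- \<i> * of_real t * Complex (e j) (- \<gamma> j))" if "j \<in> J" for j
    unfolding P_def by (rule poisson_fourier[OF \<gamma>[OF that] t])
  have iS: "integrable lborel (\<lambda>x. \<Sum>j\<in>J. of_real (c j) * (?e x * of_real (P j x)))"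
    by (intro Bochner_Integration.integrable_sum integrable_mult_right ePi)
  have "(LINT x|lborel. (\<Sum>j\<in>J. of_real (c j) * (?e x * of_real (P j x)))) = (\<Sum>j\<in>J. (LINT x|lborel. of_real (c j) * (?e x * of_real (P j x))))"
    by (rule Bochner_Integration.integral_sum) (intro integrable_mult_right ePi)
  also have "\<dots> = (\<Sum>j\<in>J. of_real (c j) * exp (- \<i> * of_real t * Complex (e j) (- \<gamma> j)))"
    by (intro sum.cong refl) (simp only: integral_mult_right_zero eP)
  finally have vS: "(LINT x|lborel. (\<Sum>j\<in>J. of_real (c j) * (?e x * of_real (P j x)))) = (\<Sum>j\<in>J. of_real (c j) * exp (- \<i> * of_real t * Complex (e j) (- \<gamma> j)))" .
  have "?e x * of_real (h x) * of_real (F x) = ?e x * of_real (h x * F x - (\<Sum>j\<in>J. c j * P j x)) + (\<Sum>j\<in>J. of_real (c j) * (?e x * of_real (P j x)))" for x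
    by (simp add: sum_distrib_left algebra_simps)
  then have "(LINT x|lborel. ?e x * of_real (h x) * of_real (F x))
     = (LINT x|lborel. ?e x * of_real (h x * F x - (\<Sum>j\<in>J. c j * P j x))) + (\<Sum>j\<in>J. of_real (c j) * exp (- \<i> * of_real t * Complex (e j) (- \<gamma> j)))"
    using iD iS by (simp only: Bochner_Integration.integral_add vS)
  then have "cmod ((LINT x|lborel. ?e x * of_real (h x) * of_real (F x)) - (\<Sum>j\<in>J. of_real (c j) * exp (- \<i> * of_real t * Complex (e j) (- \<gamma> j))))
    = cmod (LINT x|lborel. ?e x * of_real (h x * F x - (\<Sum>j\<in>J. c j * P j x)))" by simp
  also have "\<dots> \<le> (LINT x|lborel. G x)"
  proof (rule order_trans[OF integral_norm_bound integral_mono])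
    show "cmod (?e x * of_real (h x * F x - (\<Sum>j\<in>J. c j * P j x))) \<le> G x" for x
      unfolding norm_mult ne norm_of_real using pt[of x] by simp
  qed (use iD iG in auto)
  finally show ?thesis unfolding vG .
qed

text \<open>Compactness of X turns joint continuity at \<eta> = 0 into uniform convergence; every
  smallness statement in \<eta> rests on this.\<close>

lemma uniform_limit_joint:
  fixes f :: "real \<Rightarrow> complex \<Rightarrow> complex"
  assumes "continuous_on UNIV (\<lambda>\<theta>. f (fst \<theta>) (snd \<theta>))" "compact X"
  shows "uniform_limit X f (f 0) (at_right 0)"
proof (rule uniform_limitI)
  fix e :: real assume e: "e > 0"
  have c: "continuous_on (UNIV \<times> X) (\<lambda>\<theta>. f (fst \<theta>) (snd \<theta>))"
    by (rule continuous_on_subset[OF assms(1)]) simp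
  have "e / 2 > 0" using e by simp
  from continuous_on_prod_compactE[OF c assms(2) UNIV_I this, of 0]
  obtain U where U: "0 \<in> U" "open U" "\<forall>x\<in>U \<inter> UNIV. \<forall>t\<in>X. dist (f x t) (f 0 t) \<le> e / 2"
    unfolding fst_conv snd_conv .
  have "eventually (\<lambda>\<eta>. \<eta> \<in> U) (at_right 0)"
    using topological_tendstoD[OF tendsto_ident_at U(2,1)] .
  then show "eventually (\<lambda>\<eta>. \<forall>x\<in>X. dist (f \<eta> x) (f 0 x) < e) (at_right 0)"
    by eventually_elim (use U(3) e in force)
qed

lemma uniform_limit_joint_csqrt:
  fixes f :: "real \<Rightarrow> complex \<Rightarrow> complex"
  assumes "continuous_on UNIV (\<lambda>\<theta>. f (fst \<theta>) (snd \<theta>))" "compact X" "continuous_on X csqrt"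
  shows "uniform_limit X (\<lambda>\<eta> z. f \<eta> (csqrt z)) (\<lambda>z. f 0 (csqrt z)) (at_right (0::real))"
proof -
  have "compact (csqrt ` X)" by (intro compact_continuous_image assms)
  from uniform_limit_joint[OF assms(1) this] show ?thesis
    unfolding uniform_limit_iff by simp
qed

context box_state
begin

lemma joint_edge_wronskian: "continuous_on UNIV (\<lambda>\<theta>. edge_wronskian \<kappa> (fst \<theta>) (snd \<theta>))"
  by (intro continuous_intros)

text \<open>Where the Dirichlet Wronskian has no zero the quotient converges uniformly, and its
  limit is real, so the imaginary part tends to 0.\<close>

lemma stieltjes_off_spectrum:
  assumes T: "compact T" "\<And>x. x \<in> T \<Longrightarrow> edge_wronskian \<kappa> 0 (csqrt (of_real x)) \<noteq> 0" and \<delta>: "\<delta> > 0"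
  shows "eventually (\<lambda>\<eta>. \<forall>x\<in>T. \<bar>Im (stieltjes \<eta> (of_real x))\<bar> < \<delta>) (at_right 0)"
proof (cases "T = {}")
  case False
  let ?X = "complex_of_real ` T"
  have X: "compact ?X" by (rule compact_continuous_image[OF _ T(1)]) (intro continuous_intros)
  have c: "continuous_on ?X csqrt" by (rule continuous_on_subset[OF continuous_on_csqrt_upper]) auto
  let ?W = "\<lambda>z. edge_wronskian \<kappa> 0 (csqrt z)"
  let ?N = "\<lambda>z. edge_num \<kappa> \<phi> 0 (csqrt z)"
  have cW: "continuous_on ?X (\<lambda>z. cmod (?W z))" by (intro continuous_intros c)
  have "?X \<noteq> {}" using False by simp
  from continuous_attains_inf[OF X this cW]
  obtain x0 where x0: "x0 \<in> ?X" "\<forall>y\<in>?X. cmod (?W x0) \<le> cmod (?W y)" by blast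
  have "compact (?N ` ?X)"
  proof (rule compact_continuous_image[OF _ X])
    have "continuous_on ?X (\<lambda>z. (0::real, csqrt z))" by (intro continuous_intros c)
    from continuous_on_compose2[OF continuous_on_edge_num this] show "continuous_on ?X ?N" by simp
  qed
  then have bN: "bounded (?N ` ?X)" by (rule compact_imp_bounded)
  have "uniform_limit ?X stieltjes (\<lambda>z. ?N z / ?W z) (at_right 0)"
    unfolding stieltjes_def[abs_def]
  proof (rule uniform_lim_divide)
    show "uniform_limit ?X (\<lambda>\<eta> z. edge_num \<kappa> \<phi> \<eta> (csqrt z)) ?N (at_right 0)"
      by (rule uniform_limit_joint_csqrt[OF continuous_on_edge_num X c])
    show "uniform_limit ?X (\<lambda>\<eta> z. edge_wronskian \<kappa> \<eta> (csqrt z)) ?W (at_right 0)"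
      by (rule uniform_limit_joint_csqrt[OF joint_edge_wronskian X c])
    show "cmod (?W x0) \<le> norm (?W z)" if "z \<in> ?X" for z using x0(2) that by blast
    show "0 < cmod (?W x0)" using x0(1) T(2) by auto
  qed (rule bN)
  from uniform_limitD[OF this \<delta>]
  show ?thesis
  proof eventually_elim
    case (elim \<eta>)
    show ?case
    proof
      fix x assume x: "x \<in> T"
      let ?q = "?N (of_real x) / ?W (of_real x)"
      have "Im ?q = 0"
        using edge_num_Dirichlet_real[of x] edge_wronskian_Dirichlet_real[of \<kappa> x] by (simp add: Im_divide)
      then have "\<bar>Im (stieltjes \<eta> (of_real x))\<bar> = \<bar>Im (stieltjes \<eta> (of_real x) - ?q)\<bar>" by simp
      also have "\<dots> \<le> dist (stieltjes \<eta> (of_real x)) ?q" unfolding dist_norm by (rule abs_Im_le_cmod)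
      also have "\<dots> < \<delta>" using elim x by blast
      finally show "\<bar>Im (stieltjes \<eta> (of_real x))\<bar> < \<delta>" .
    qed
  qed
qed simp

lemma Dirichlet_zero_eigenvalue:
  assumes "edge_wronskian \<kappa> 0 k = 0" "0 \<le> Re k"
  shows "eigenvalue (H_Dirichlet \<kappa>) (k\<^sup>2)"
proof -
  obtain s where s: "k = of_real s" "s > 0" "sin (s * (2 * \<kappa>)) = 0"
    using edge_wronskian_Dirichlet_zero[OF \<kappa> assms(2,1)] .
  from Dirichlet_eigenvalue[OF \<kappa> s(2,3)] show ?thesis by (simp add: s(1))
qed

lemma Re_csqrt_nonneg: "0 \<le> Re (csqrt z)"
  using csqrt_principal[of z] by linarith

text \<open>The compact set of momenta between the small disk, where Hurwitz' theorem applies, and the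
  given disk, which may well contain \<open>0\<close> and part of the slit.\<close>

lemma no_far_zeros:
  assumes R: "0 < R"
    and iso: "{z. eigenvalue (H_Dirichlet \<kappa>) z} \<inter> cball (of_real E) r = {of_real E}"
  shows "eventually (\<lambda>\<eta>. \<forall>z\<in>cball (of_real E) r. edge_wronskian \<kappa> \<eta> (csqrt z) = 0 \<longrightarrow> z \<in> ball (of_real E) R) (at_right 0)"
proof -
  define X where "X = {k. 0 \<le> Re k \<and> cmod (k\<^sup>2 - of_real E) \<le> r \<and> R \<le> cmod (k\<^sup>2 - of_real E)}"
  have "closed X"
    unfolding X_def by (intro closed_Collect_conj closed_Collect_le continuous_intros)
  moreover have "bounded X"
  proof (rule boundedI)
    fix k assume k: "k \<in> X"
    have "(cmod k)\<^sup>2 = cmod ((k\<^sup>2 - of_real E) + of_real E)" by (simp add: norm_power)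
    also have "\<dots> \<le> r + \<bar>E\<bar>" using k norm_triangle_ineq[of "k\<^sup>2 - of_real E" "of_real E"] by (simp add: X_def)
    finally have "(cmod k)\<^sup>2 \<le> r + \<bar>E\<bar>" .
    then show "cmod k \<le> sqrt (r + \<bar>E\<bar>)" by (rule real_le_rsqrt)
  qed
  ultimately have X: "compact X" using compact_eq_bounded_closed by blast
  have nz: "edge_wronskian \<kappa> 0 k \<noteq> 0" if k: "k \<in> X" for k
  proof
    assume "edge_wronskian \<kappa> 0 k = 0"
    then have "eigenvalue (H_Dirichlet \<kappa>) (k\<^sup>2)" using k by (intro Dirichlet_zero_eigenvalue) (auto simp: X_def)
    moreover have "k\<^sup>2 \<in> cball (of_real E) r" using k by (simp add: X_def dist_norm norm_minus_commute)
    ultimately have "k\<^sup>2 \<in> {of_real E}" unfolding iso[symmetric] by blast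
    then show False using k R by (simp add: X_def)
  qed
  have "eventually (\<lambda>\<eta>. \<forall>k\<in>X. edge_wronskian \<kappa> \<eta> k \<noteq> 0) (at_right 0)"
  proof (cases "X = {}")
    case False
    have "continuous_on X (\<lambda>k. cmod (edge_wronskian \<kappa> 0 k))" by (intro continuous_intros)
    from continuous_attains_inf[OF X False this]
    obtain k0 where k0: "k0 \<in> X" "\<forall>y\<in>X. cmod (edge_wronskian \<kappa> 0 k0) \<le> cmod (edge_wronskian \<kappa> 0 y)" by blast
    have "0 < cmod (edge_wronskian \<kappa> 0 k0)" using nz[OF k0(1)] by simp
    from uniform_limitD[OF uniform_limit_joint[OF joint_edge_wronskian X] this]
    show ?thesis
    proof eventually_elim
      case (elim \<eta>)
      show ?case
      proof
        fix k assume k: "k \<in> X"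
        have "dist (edge_wronskian \<kappa> \<eta> k) (edge_wronskian \<kappa> 0 k) < cmod (edge_wronskian \<kappa> 0 k)"
          using elim k0(2) k by (blast intro: less_le_trans)
        then show "edge_wronskian \<kappa> \<eta> k \<noteq> 0" by (auto simp: dist_norm)
      qed
    qed
  qed simp
  then show ?thesis
  proof eventually_elim
    case (elim \<eta>)
    show ?case
    proof (intro ballI impI)
      fix z assume z: "z \<in> cball (of_real E) r" "edge_wronskian \<kappa> \<eta> (csqrt z) = 0"
      then have "csqrt z \<notin> X" using elim by blast
      then show "z \<in> ball (of_real E) R"
        using z(1) Re_csqrt_nonneg[of z] by (auto simp: X_def dist_norm norm_minus_commute)
    qed
  qed
qed

text \<open>\<open>resonance_lorentzian\<close> for the edge functions composed with
  \<open>csqrt\<close>. The given disk may meet the slit, so the zero is first found in a smaller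
  disk, and \<open>no_far_zeros\<close> then extends its uniqueness to the given one.\<close>

lemma eigenvalue_lorentzian:
  assumes f: "eigenfunction (H_Dirichlet \<kappa>) (of_real E) f" "l2_norm f = 1"
    and iso: "{z. eigenvalue (H_Dirichlet \<kappa>) z} \<inter> cball (of_real E) r = {of_real E}"
    and \<rho>: "0 < \<rho>" "\<rho> < r" "\<rho> < E"
  obtains zs where "(zs \<longlongrightarrow> of_real E) (at_right 0)"
    and "eventually (\<lambda>\<eta>. Im (zs \<eta>) < 0 \<and> zs \<eta> \<in> cball (of_real E) r \<and>
          (\<forall>z\<in>cball (of_real E) r. resonance (H_delta \<kappa> \<eta>) z \<longleftrightarrow> z = zs \<eta>)) (at_right 0)"
    and "\<And>\<delta>. \<delta> > 0 \<Longrightarrow> eventually (\<lambda>\<eta>. \<forall>x\<in>{E - \<rho>..E + \<rho>}.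
      \<bar>Im (stieltjes \<eta> (of_real x)) / pi - (cmod (l2_inner \<phi> f))\<^sup>2 * poisson (- Im (zs \<eta>)) (Re (zs \<eta>) - x)\<bar>
        \<le> \<delta> * poisson (- Im (zs \<eta>)) (Re (zs \<eta>) - x) + \<delta>) (at_right 0)"
proof -
  note E = Dirichlet_eigenfunction[OF \<kappa> f(1)]
  let ?a = "complex_of_real E"
  \<comment> \<open>Strictly between \<rho> and the smaller of r and E: the disk covers the
    interval, lies in the given disk and stays in the right half plane, where \<open>csqrt\<close>
    is holomorphic.\<close>
  define R where "R = (\<rho> + min r E) / 2"
  have R: "\<rho> < R" "R < E" "R < r" "0 < R" using \<rho> by (auto simp: R_def)
  have slit: "ball ?a E \<subseteq> slit_plane"
  proof
    fix z assume "z \<in> ball ?a E"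
    then have "cmod (?a - z) < E" by (simp add: dist_norm)
    then have "\<bar>Re (?a - z)\<bar> < E" using abs_Re_le_cmod[of "?a - z"] by linarith
    then have "Re z > 0" by simp
    then show "z \<in> slit_plane" by (auto simp: slit_plane_def complex_nonpos_Reals_iff)
  qed
  let ?W = "\<lambda>\<eta> z. edge_wronskian \<kappa> \<eta> (csqrt z)"
  let ?N = "\<lambda>\<eta> z. edge_num \<kappa> \<phi> \<eta> (csqrt z)"
  have sq: "csqrt holomorphic_on ball ?a E" by (rule holomorphic_on_subset[OF holomorphic_csqrt_slit_plane slit])
  have W_hol: "?W \<eta> holomorphic_on ball ?a E" for \<eta>
    using holomorphic_on_compose[OF sq holomorphic_edge_wronskian] by (simp add: o_def)
  have N_hol: "?N \<eta> holomorphic_on ball ?a E" for \<eta>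
    using holomorphic_on_compose[OF sq holomorphic_on_subset[OF holomorphic_edge_num subset_UNIV]] by (simp add: o_def)
  have csq: "continuous_on (cball ?a R) csqrt"
    by (rule continuous_on_subset[OF holomorphic_on_imp_continuous_on[OF sq]]) (use R in auto)
  note W_lim = uniform_limit_joint_csqrt[OF joint_edge_wronskian compact_cball csq]
  note N_lim = uniform_limit_joint_csqrt[OF continuous_on_edge_num compact_cball csq]
  have cE: "csqrt ?a = of_real (sqrt E)" using E(1) by (simp add: csqrt_of_real_nonneg)
  note dW = deriv_edge_wronskian_Dirichlet[OF E(1,2)]
  have W0: "?W 0 ?a = 0"
  proof -
    have "complex_of_real (sqrt E) * of_real (2 * \<kappa>) * csinc (of_real (sqrt E) * of_real (2 * \<kappa>)) = of_real (sin (sqrt E * (2 * \<kappa>)))"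
      unfolding csinc_mult by (simp only: of_real_mult[symmetric] sin_of_real)
    also have "\<dots> = 0" unfolding E(2) by simp
    finally show ?thesis using E(1) \<kappa> unfolding cE edge_wronskian_Dirichlet by auto
  qed
  have "(cos (sqrt E * (2 * \<kappa>)))\<^sup>2 = 1" using E(2) sin_cos_squared_add[of "sqrt E * (2 * \<kappa>)"] by simp
  then have cos0: "cos (sqrt E * (2 * \<kappa>)) \<noteq> 0" by auto
  have dW0: "deriv (?W 0) ?a = of_real (\<kappa> * cos (sqrt E * (2 * \<kappa>)) / E)" by (rule DERIV_imp_deriv[OF dW])
  have dnz: "deriv (?W 0) ?a \<noteq> 0" unfolding dW0 of_real_eq_0_iff using \<kappa> cos0 E(1) by simp
  have only: "z = ?a" if "z \<in> cball ?a R" "?W 0 z = 0" for z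
  proof -
    have "eigenvalue (H_Dirichlet \<kappa>) ((csqrt z)\<^sup>2)"
      by (rule Dirichlet_zero_eigenvalue[OF that(2) Re_csqrt_nonneg])
    then have "z \<in> {z. eigenvalue (H_Dirichlet \<kappa>) z} \<inter> cball ?a r" using that(1) R by simp
    then show ?thesis unfolding iso by simp
  qed
  have pos_ev: "eventually (\<lambda>\<eta>::real. 0 < \<eta>) (at_right 0)" by (rule eventually_at_right_less)
  have neg: "eventually (\<lambda>\<eta>. \<forall>z\<in>cball ?a R. ?W \<eta> z = 0 \<longrightarrow> Im z < 0) (at_right 0)"
    using pos_ev
  proof eventually_elim
    case (elim \<eta>)
    show ?case using edge_wronskian_nonzero[OF Im_csqrt_nonneg \<kappa> elim] by (meson not_less)
  qed
  have pos: "eventually (\<lambda>\<eta>. \<forall>x\<in>{E - \<rho>..E + \<rho>}. 0 \<le> Im (?N \<eta> (of_real x) / ?W \<eta> (of_real x))) (at_right 0)"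
    using pos_ev by eventually_elim (use stieltjes_Im_nonneg in \<open>simp add: stieltjes_def\<close>)
  obtain zs where zs: "(zs \<longlongrightarrow> ?a) (at_right 0)"
    "eventually (\<lambda>\<eta>. Im (zs \<eta>) < 0 \<and> (\<forall>z\<in>cball ?a R. ?W \<eta> z = 0 \<longleftrightarrow> z = zs \<eta>)) (at_right 0)"
    "\<And>\<delta>. \<delta> > 0 \<Longrightarrow> eventually (\<lambda>\<eta>. \<forall>x\<in>{E - \<rho>..E + \<rho>}.
      \<bar>Im (?N \<eta> (of_real x) / ?W \<eta> (of_real x)) / pi - Re (- ?N 0 ?a / deriv (?W 0) ?a) * poisson (- Im (zs \<eta>)) (Re (zs \<eta>) - x)\<bar>
        \<le> \<delta> * poisson (- Im (zs \<eta>)) (Re (zs \<eta>) - x) + \<delta>) (at_right 0)"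
    by (rule resonance_lorentzian[OF \<rho>(1) R(1,2) always_eventually[OF allI[OF W_hol]] W_hol always_eventually[OF allI[OF N_hol]] N_hol
          W_lim N_lim W0 dnz only edge_wronskian_Dirichlet_real edge_num_Dirichlet_real neg pos]) blast+
  \<comment> \<open>The cosine and E cancel between the numerator and the derivative of the
    Wronskian, and the remaining 1/\<kappa> is the normalisation of the eigenfunction.\<close>
  have c: "Re (- ?N 0 ?a / deriv (?W 0) ?a) = (cmod (l2_inner \<phi> f))\<^sup>2"
  proof -
    have sE: "sqrt E > 0" "(sqrt E)\<^sup>2 = E" using E(1) by auto
    have "- ?N 0 ?a / deriv (?W 0) ?a = of_real (- (- cos (sqrt E * (2 * \<kappa>)) / (sqrt E)\<^sup>2 * (cmod (l2_inner \<phi> (box_sin \<kappa> (sqrt E))))\<^sup>2)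
        / (\<kappa> * cos (sqrt E * (2 * \<kappa>)) / E))"
      unfolding cE edge_num_Dirichlet[OF sE(1) E(2)] dW0 by (simp only: of_real_minus of_real_divide)
    also have "- (- cos (sqrt E * (2 * \<kappa>)) / (sqrt E)\<^sup>2 * (cmod (l2_inner \<phi> (box_sin \<kappa> (sqrt E))))\<^sup>2)
        / (\<kappa> * cos (sqrt E * (2 * \<kappa>)) / E) = (cmod (l2_inner \<phi> (box_sin \<kappa> (sqrt E))))\<^sup>2 / \<kappa>"
      unfolding sE(2) using cos0 E(1) by (simp add: field_simps)
    finally show ?thesis unfolding Dirichlet_coefficient[OF \<kappa> f \<phi>] by simp
  qed
  have res: "eventually (\<lambda>\<eta>. Im (zs \<eta>) < 0 \<and> zs \<eta> \<in> cball ?a r \<and>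
          (\<forall>z\<in>cball ?a r. resonance (H_delta \<kappa> \<eta>) z \<longleftrightarrow> z = zs \<eta>)) (at_right 0)"
    using zs(2) tendstoD[OF zs(1) R(4)] no_far_zeros[OF R(4) iso] pos_ev
  proof eventually_elim
    case (elim \<eta>)
    have zin: "zs \<eta> \<in> cball ?a R" using elim(2) by (simp add: dist_commute)
    \<comment> \<open>The lower half plane suffices: resonances lie there by definition, and
      \<open>zs\<close> lies there because the Wronskian has no zeros with Im z nonnegative.\<close>
    have iff: "resonance (H_delta \<kappa> \<eta>) z \<longleftrightarrow> ?W \<eta> z = 0" if "Im z < 0" for z
    proof -
      have "z \<noteq> 0" using that by auto
      then have n0: "csqrt z \<noteq> 0" by simp
      show ?thesis by (simp only: resonance_H_delta_iff[OF \<kappa> elim(4) that] edge_wronskian_eq_0_iff[OF n0])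
    qed
    have W_zs: "?W \<eta> (zs \<eta>) = 0" using elim(1) zin by blast
    have "resonance (H_delta \<kappa> \<eta>) z \<longleftrightarrow> z = zs \<eta>" if z: "z \<in> cball ?a r" for z
    proof
      assume res: "resonance (H_delta \<kappa> \<eta>) z"
      then have "Im z < 0" by (simp add: resonance_def)
      then have W: "?W \<eta> z = 0" using iff res by blast
      then have "z \<in> ball ?a R" using elim(3) z by blast
      then have "z \<in> cball ?a R" by simp
      then show "z = zs \<eta>" using elim(1) W by blast
    next
      assume "z = zs \<eta>"
      then show "resonance (H_delta \<kappa> \<eta>) z" using iff elim(1) W_zs by blast
    qed
    moreover have "zs \<eta> \<in> cball ?a r" using zin R by simp
    ultimately show ?case using elim(1) by blast
  qed
  show thesis
    by (rule that[OF zs(1) res zs(3)[unfolded c, folded stieltjes_def]])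
qed

lemma functional_calculus_density:
  assumes \<eta>: "\<eta> > 0" and \<Phi>: "borel_functional_calculus (H_delta \<kappa> \<eta>) \<Phi>"
    and g: "continuous_on UNIV g" "\<And>x. x \<notin> {p..q} \<Longrightarrow> g x = 0" and pq: "p \<le> q"
  shows "l2_inner \<phi> (\<Phi> g \<phi>) = (LINT x|lborel. g x * of_real (Im (stieltjes \<eta> (of_real x)) / pi))"
proof -
  interpret borel_functional_calculus "H_delta \<kappa> \<eta>" \<Phi> by (rule \<Phi>)
  interpret S: spectral_functional "\<lambda>h. l2_inner \<phi> (\<Phi> h \<phi>)" by (rule spectral_functional[OF \<phi>])
  show ?thesis
  proof (rule S.stone_formula[OF _ continuous_on_stieltjes[OF \<eta>] g pq])
    fix z :: complex assume z: "Im z > 0"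
    have H: "H_delta \<kappa> \<eta> (\<lambda>x. LINT y|lborel. delta_green \<kappa> \<eta> (csqrt z) x y * \<phi> y)
        (\<lambda>x. \<phi> x + z * (LINT y|lborel. delta_green \<kappa> \<eta> (csqrt z) x y * \<phi> y))"
      using delta_green_resolvent[OF Im_csqrt_pos[OF z] \<kappa> \<eta> \<phi>] by simp
    have "Im z \<noteq> 0" using z by simp
    from resolvent_inner[OF this \<phi> H_delta_L2(1)[OF H] H]
    show "l2_inner \<phi> (\<Phi> (\<lambda>s. 1 / (of_real s - z)) \<phi>) = stieltjes \<eta> z"
      unfolding stieltjes_def resolvent_edge_num[OF z \<eta>] .
  qed
qed

end

section \<open>Collecting the local estimates\<close>

theorem theorem1p4:
  fixes \<kappa> a b \<delta> \<epsilon> :: real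
    and \<phi> :: "real \<Rightarrow> complex"
    and \<chi>\<^sub>0 :: "real \<Rightarrow> real"
    and n :: nat
    and E r :: "nat \<Rightarrow> real"
    and \<phi>\<^sub>D :: "nat \<Rightarrow> real \<Rightarrow> complex"
  assumes "\<kappa> > 0"
    and "\<phi> \<in> L2" and "AE x in lborel. x \<notin> {-\<kappa>..\<kappa>} \<longrightarrow> \<phi> x = 0"
    and "0 < a" and "a < b" and "\<delta> > 0"
    and "\<forall>e \<in> {a-\<delta>..a} \<union> {b..b+\<delta>}. \<not> eigenvalue (H_Dirichlet \<kappa>) (of_real e)"
    and "continuous_on UNIV \<chi>\<^sub>0"
    and "\<forall>s. indicator {a..b} s \<le> \<chi>\<^sub>0 s \<and> \<chi>\<^sub>0 s \<le> indicator {a-\<delta>..b+\<delta>} s"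
    and "bij_betw E {1..n}
           {e. eigenvalue (H_Dirichlet \<kappa>) (of_real e) \<and> e \<in> closure {s. \<chi>\<^sub>0 s \<noteq> 0}}"
    and "\<forall>j\<in>{1..n}. eigenfunction (H_Dirichlet \<kappa>) (of_real (E j)) (\<phi>\<^sub>D j) \<and> l2_norm (\<phi>\<^sub>D j) = 1"
    and "\<forall>j\<in>{1..n}. r j > 0 \<and>
           {z. eigenvalue (H_Dirichlet \<kappa>) z} \<inter> cball (of_real (E j)) (r j) = {of_real (E j)}"
    and "disjoint_family_on (\<lambda>j. cball (of_real (E j) :: complex) (r j)) {1..n}"
    and "\<epsilon> > 0"
  shows "\<exists>\<eta>\<^sub>\<epsilon>>0. \<forall>\<eta>. 0 < \<eta> \<and> \<eta> < \<eta>\<^sub>\<epsilon> \<longrightarrow>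
      (\<forall>j\<in>{1..n}. \<exists>!z. z \<in> cball (of_real (E j)) (r j) \<and> resonance (H_delta \<kappa> \<eta>) z) \<and>
      (\<forall>\<Phi>. borel_functional_calculus (H_delta \<kappa> \<eta>) \<Phi> \<longrightarrow>
        (\<forall>t\<ge>0.
          cmod (l2_inner \<phi>
                  (\<Phi> (\<lambda>s. exp (- \<i> * of_real t * of_real s)) (\<Phi> (\<lambda>s. of_real (\<chi>\<^sub>0 s)) \<phi>))
                - (\<Sum>j=1..n. of_real ((cmod (l2_inner \<phi> (\<phi>\<^sub>D j)))\<^sup>2) *
                     exp (- \<i> * of_real t *
                       resonance_in (H_delta \<kappa> \<eta>) (cball (of_real (E j)) (r j)))))
          < \<epsilon>))"
proof -
  note asm = assms
  have \<kappa>: "\<kappa> > 0" and \<phi>L: "\<phi> \<in> L2" and supp: "AE x in lborel. x \<notin> {-\<kappa>..\<kappa>} \<longrightarrow> \<phi> x = 0"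
    and ab: "0 < a" "a < b" "\<delta> > 0"
    and gap: "\<And>e. e \<in> {a-\<delta>..a} \<union> {b..b+\<delta>} \<Longrightarrow> \<not> eigenvalue (H_Dirichlet \<kappa>) (of_real e)"
    and cont: "continuous_on UNIV \<chi>\<^sub>0"
    and ind: "\<And>s. indicator {a..b} s \<le> \<chi>\<^sub>0 s" "\<And>s. \<chi>\<^sub>0 s \<le> indicator {a-\<delta>..b+\<delta>} s"
    and bij: "bij_betw E {1..n} {e. eigenvalue (H_Dirichlet \<kappa>) (of_real e) \<and> e \<in> closure {s. \<chi>\<^sub>0 s \<noteq> 0}}"
    and eig: "\<And>j. j \<in> {1..n} \<Longrightarrow> eigenfunction (H_Dirichlet \<kappa>) (of_real (E j)) (\<phi>\<^sub>D j)" "\<And>j. j \<in> {1..n} \<Longrightarrow> l2_norm (\<phi>\<^sub>D j) = 1"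
    and r: "\<And>j. j \<in> {1..n} \<Longrightarrow> r j > 0"
      "\<And>j. j \<in> {1..n} \<Longrightarrow> {z. eigenvalue (H_Dirichlet \<kappa>) z} \<inter> cball (of_real (E j)) (r j) = {of_real (E j)}"
    and disj: "disjoint_family_on (\<lambda>j. cball (of_real (E j) :: complex) (r j)) {1..n}"
    and \<epsilon>: "\<epsilon> > 0"
    using asm by blast+
  define p where "p = a - \<delta>"
  define q where "q = b + \<delta>"
  have pq: "p \<le> q" using ab by (simp add: p_def q_def)
  have chi01: "0 \<le> \<chi>\<^sub>0 s \<and> \<chi>\<^sub>0 s \<le> 1" for s
  proof -
    have "(0::real) \<le> indicator {a..b} s" "indicator {a-\<delta>..b+\<delta>} s \<le> (1::real)"
      by (rule indicator_pos_le, rule indicator_le_1)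
    then show ?thesis using ind(1)[of s] ind(2)[of s] by linarith
  qed
  have chi_out: "\<chi>\<^sub>0 s = 0" if "s \<notin> {p..q}" for s
  proof -
    have "indicator {a-\<delta>..b+\<delta>} s = (0::real)"
      by (rule indicator_simps(2)) (use that in \<open>simp add: p_def q_def\<close>)
    then show ?thesis using ind(2)[of s] chi01[of s] by linarith
  qed
  have chi_one: "\<chi>\<^sub>0 s = 1" if "s \<in> {a..b}" for s
  proof -
    have "indicator {a..b} s = (1::real)" by (rule indicator_simps(1)[OF that])
    then show ?thesis using ind(1)[of s] chi01[of s] by linarith
  qed
  have "{s. \<chi>\<^sub>0 s \<noteq> 0} \<subseteq> {p..q}" using chi_out by blast
  then have clos: "closure {s. \<chi>\<^sub>0 s \<noteq> 0} \<subseteq> {p..q}" by (rule closure_minimal) simp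
  \<comment> \<open>The support of \<chi> may reach the gaps, but no eigenvalue lies there, so every
    E j is strictly inside {a..b}.\<close>
  have Ej: "a < E j" "E j < b" if j: "j \<in> {1..n}" for j
  proof -
    have "E j \<in> {e. eigenvalue (H_Dirichlet \<kappa>) (of_real e) \<and> e \<in> closure {s. \<chi>\<^sub>0 s \<noteq> 0}}"
      using bij_betwE[OF bij] j by blast
    then have "eigenvalue (H_Dirichlet \<kappa>) (of_real (E j))" "E j \<in> {p..q}" using clos by auto
    then have "E j \<notin> {a-\<delta>..a} \<union> {b..b+\<delta>}" "E j \<in> {a-\<delta>..b+\<delta>}" using gap[of "E j"] by (auto simp: p_def q_def)
    then show "a < E j" "E j < b" by auto
  qed
  \<comment> \<open>Halving makes the interval lie strictly inside its disk and inside {a..b}, where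
    \<chi> = 1; as a is positive it also stays away from energy 0.\<close>
  define \<rho> where "\<rho> = (\<lambda>j. min (r j) (min (E j - a) (b - E j)) / 2)"
  have \<rho>: "0 < \<rho> j" "\<rho> j < r j" "\<rho> j < E j" "a \<le> E j - \<rho> j" "E j + \<rho> j \<le> b" if j: "j \<in> {1..n}" for j
  proof -
    have "0 < \<rho> j" "2 * \<rho> j \<le> r j" "2 * \<rho> j \<le> E j - a" "2 * \<rho> j \<le> b - E j"
      using r(1)[OF j] Ej[OF j] by (auto simp: \<rho>_def)
    then show "0 < \<rho> j" "\<rho> j < r j" "\<rho> j < E j" "a \<le> E j - \<rho> j" "E j + \<rho> j \<le> b"
      using ab(1) Ej[OF j] by linarith+
  qed
  define I where "I = (\<lambda>j. {E j - \<rho> j..E j + \<rho> j})"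
  have I_disj: "disjoint_family_on I {1..n}"
    unfolding disjoint_family_on_def
  proof (intro ballI impI)
    fix i j assume ij: "i \<in> {1..n}" "j \<in> {1..n}" "i \<noteq> j"
    have sub: "complex_of_real x \<in> cball (of_real (E j)) (r j)" if "x \<in> I j" "j \<in> {1..n}" for x j
    proof -
      have "dist (E j) x \<le> r j" using that(1) \<rho>(2)[OF that(2)] by (simp add: I_def dist_real_def abs_le_iff)
      then show ?thesis by simp
    qed
    have "cball (of_real (E i) :: complex) (r i) \<inter> cball (of_real (E j)) (r j) = {}"
      using disj ij unfolding disjoint_family_on_def by blast
    then show "I i \<inter> I j = {}" using sub ij by blast
  qed
  \<comment> \<open>A representative that vanishes pointwise outside the box, as
    \<open>box_state\<close> requires; the calculus and all coefficients transfer by equality almost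
    everywhere.\<close>
  define \<psi> where "\<psi> = (\<lambda>x. indicator {-\<kappa>..\<kappa>} x * \<phi> x)"
  have \<psi>_eq: "l2_eq \<phi> \<psi>"
    unfolding l2_eq_def \<psi>_def using supp by eventually_elim (auto simp: indicator_def)
  have \<psi>L: "\<psi> \<in> L2"
    by (rule L2_AE_cong[OF \<phi>L _ \<psi>_eq]) (use L2_measurable[OF \<phi>L] in \<open>simp add: \<psi>_def\<close>)
  interpret box_state \<kappa> \<psi>
    by standard (use \<kappa> \<psi>L in \<open>auto simp: \<psi>_def\<close>)
  define c where "c = (\<lambda>j. (cmod (l2_inner \<psi> (\<phi>\<^sub>D j)))\<^sup>2)"
  have "\<forall>j\<in>{1..n}. \<exists>zs. (zs \<longlongrightarrow> of_real (E j)) (at_right 0) \<and>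
      eventually (\<lambda>\<eta>. Im (zs \<eta>) < 0 \<and> zs \<eta> \<in> cball (of_real (E j)) (r j) \<and>
          (\<forall>z\<in>cball (of_real (E j)) (r j). resonance (H_delta \<kappa> \<eta>) z \<longleftrightarrow> z = zs \<eta>)) (at_right 0) \<and>
      (\<forall>\<delta>>0. eventually (\<lambda>\<eta>. \<forall>x\<in>I j.
      \<bar>Im (stieltjes \<eta> (of_real x)) / pi - c j * poisson (- Im (zs \<eta>)) (Re (zs \<eta>) - x)\<bar>
        \<le> \<delta> * poisson (- Im (zs \<eta>)) (Re (zs \<eta>) - x) + \<delta>) (at_right 0))"
  proof
    fix j assume j: "j \<in> {1..n}"
    show "\<exists>zs. (zs \<longlongrightarrow> of_real (E j)) (at_right 0) \<and>
      eventually (\<lambda>\<eta>. Im (zs \<eta>) < 0 \<and> zs \<eta> \<in> cball (of_real (E j)) (r j) \<and>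
          (\<forall>z\<in>cball (of_real (E j)) (r j). resonance (H_delta \<kappa> \<eta>) z \<longleftrightarrow> z = zs \<eta>)) (at_right 0) \<and>
      (\<forall>\<delta>>0. eventually (\<lambda>\<eta>. \<forall>x\<in>I j.
      \<bar>Im (stieltjes \<eta> (of_real x)) / pi - c j * poisson (- Im (zs \<eta>)) (Re (zs \<eta>) - x)\<bar>
        \<le> \<delta> * poisson (- Im (zs \<eta>)) (Re (zs \<eta>) - x) + \<delta>) (at_right 0))"
      unfolding I_def c_def
      by (rule eigenvalue_lorentzian[OF eig(1)[OF j] eig(2)[OF j] r(2)[OF j] \<rho>(1-3)[OF j]]) blast
  qed
  from bchoice[OF this] obtain zs where zs:
    "\<And>j. j \<in> {1..n} \<Longrightarrow> (zs j \<longlongrightarrow> of_real (E j)) (at_right 0)"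
    "\<And>j. j \<in> {1..n} \<Longrightarrow> eventually (\<lambda>\<eta>. Im (zs j \<eta>) < 0 \<and> zs j \<eta> \<in> cball (of_real (E j)) (r j) \<and>
          (\<forall>z\<in>cball (of_real (E j)) (r j). resonance (H_delta \<kappa> \<eta>) z \<longleftrightarrow> z = zs j \<eta>)) (at_right 0)"
    "\<And>j \<delta>. j \<in> {1..n} \<Longrightarrow> \<delta> > 0 \<Longrightarrow> eventually (\<lambda>\<eta>. \<forall>x\<in>I j.
      \<bar>Im (stieltjes \<eta> (of_real x)) / pi - c j * poisson (- Im (zs j \<eta>)) (Re (zs j \<eta>) - x)\<bar>
        \<le> \<delta> * poisson (- Im (zs j \<eta>)) (Re (zs j \<eta>) - x) + \<delta>) (at_right 0)"
    by blast
  \<comment> \<open>Open intervals are removed, so T is compact; it contains no Dirichlet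
    eigenvalue.\<close>
  define T where "T = {p..q} - (\<Union>j\<in>{1..n}. {E j - \<rho> j<..<E j + \<rho> j})"
  have "closed T" unfolding T_def by (intro closed_Diff open_UN ballI) auto
  moreover have "bounded T" unfolding T_def by (rule bounded_subset[of "{p..q}"]) auto
  ultimately have T: "compact T" using compact_eq_bounded_closed by blast
  have T_nz: "edge_wronskian \<kappa> 0 (csqrt (of_real x)) \<noteq> 0" if x: "x \<in> T" for x
  proof
    assume "edge_wronskian \<kappa> 0 (csqrt (of_real x)) = 0"
    from Dirichlet_zero_eigenvalue[OF this Re_csqrt_nonneg]
    have ev: "eigenvalue (H_Dirichlet \<kappa>) (of_real x)" unfolding power2_csqrt .
    have "x \<notin> {a-\<delta>..a} \<union> {b..b+\<delta>}"
    proof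
      assume "x \<in> {a-\<delta>..a} \<union> {b..b+\<delta>}"
      from gap[OF this] ev show False ..
    qed
    then have "x \<notin> {a-\<delta>..a}" "x \<notin> {b..b+\<delta>}" by blast+
    moreover have "a - \<delta> \<le> x" "x \<le> b + \<delta>" using x by (simp_all add: T_def p_def q_def)
    ultimately have "a < x" "x < b" unfolding atLeastAtMost_iff by linarith+
    then have "\<chi>\<^sub>0 x = 1" by (intro chi_one) simp
    then have "x \<in> {s. \<chi>\<^sub>0 s \<noteq> 0}" by simp
    then have "x \<in> closure {s. \<chi>\<^sub>0 s \<noteq> 0}" by (rule subsetD[OF closure_subset])
    with ev have "x \<in> E ` {1..n}" unfolding bij_betw_imp_surj_on[OF bij] by simp
    then obtain j where j: "j \<in> {1..n}" "x = E j" by (elim imageE)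
    then have "x \<in> {E j - \<rho> j<..<E j + \<rho> j}" using \<rho>(1)[of j] by simp
    then show False using x j(1) unfolding T_def by blast
  qed
  define C where "C = (\<Sum>j\<in>{1..n}. 1 + 2 * \<rho> j + c j) + (q - p)"
  have c0: "0 \<le> c j" for j by (simp add: c_def)
  have C0: "0 \<le> C" unfolding C_def using \<rho>(1) c0 pq by (intro add_nonneg_nonneg sum_nonneg) (auto simp: less_imp_le)
  \<comment> \<open>C is the constant of \<open>lorentzian_sum_estimate\<close>; this choice makes d
    times C at most \<epsilon>/2.\<close>
  define d where "d = \<epsilon> / (2 * (C + 1))"
  have d: "d > 0" using \<epsilon> C0 by (simp add: d_def)
  have dC: "d * C < \<epsilon>"
  proof -
    have "d * C \<le> d * (C + 1)" using d by simp
    also have "\<dots> = \<epsilon> / 2" using C0 by (simp add: d_def field_simps)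
    finally show ?thesis using \<epsilon> by simp
  qed
  have tail_ev: "eventually (\<lambda>\<eta>. \<forall>x. x \<notin> I j \<longrightarrow> poisson (- Im (zs j \<eta>)) (Re (zs j \<eta>) - x) \<le> d * cauchy_density (x - E j)) (at_right 0)"
    if j: "j \<in> {1..n}" for j
  proof -
    \<comment> \<open>The constant of \<open>poisson_tail\<close> without the width: once the width
      is below d / k the tail is at most d times the Cauchy density.\<close>
    define k where "k = 4 * (1 + 1 / (\<rho> j)\<^sup>2)"
    have k: "k > 0" using \<rho>(1)[OF j] by (simp add: k_def add_pos_pos)
    define m where "m = min (d / k) (\<rho> j / 2)"
    have "m > 0" using d k \<rho>(1)[OF j] by (simp add: m_def)
    from tendstoD[OF zs(1)[OF j] this] zs(2)[OF j]
    show ?thesis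
    proof eventually_elim
      case (elim \<eta>)
      have dm: "cmod (zs j \<eta> - of_real (E j)) < m" using elim(1) by (simp add: dist_norm)
      have im: "- Im (zs j \<eta>) < m" using abs_Im_le_cmod[of "zs j \<eta> - of_real (E j)"] dm by simp
      have re: "\<bar>Re (zs j \<eta>) - E j\<bar> < m" using abs_Re_le_cmod[of "zs j \<eta> - of_real (E j)"] dm by simp
      show ?case
      proof (intro allI impI)
        fix x assume x: "x \<notin> I j"
        have "poisson (- Im (zs j \<eta>)) (Re (zs j \<eta>) - x) \<le> 4 * (- Im (zs j \<eta>)) * (1 + 1 / (\<rho> j)\<^sup>2) * cauchy_density (x - E j)"
        proof (rule poisson_tail[OF \<rho>(1)[OF j]])
          show "\<rho> j \<le> \<bar>x - E j\<bar>" using x by (auto simp: I_def)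
          show "\<bar>Re (zs j \<eta>) - E j\<bar> \<le> \<rho> j / 2" using re by (simp add: m_def)
        qed (use elim in simp)
        also have "\<dots> = (- Im (zs j \<eta>) * k) * cauchy_density (x - E j)" by (simp add: k_def)
        also have "\<dots> \<le> d * cauchy_density (x - E j)"
        proof (rule mult_right_mono)
          have "- Im (zs j \<eta>) \<le> d / k" using im by (simp add: m_def)
          then show "- Im (zs j \<eta>) * k \<le> d" using k by (simp add: pos_le_divide_eq)
        qed (rule less_imp_le[OF cauchy_density_pos])
        finally show "poisson (- Im (zs j \<eta>)) (Re (zs j \<eta>) - x) \<le> d * cauchy_density (x - E j)" .
      qed
    qed
  qed
  have "eventually (\<lambda>\<eta>. (\<forall>j\<in>{1..n}. Im (zs j \<eta>) < 0 \<and> zs j \<eta> \<in> cball (of_real (E j)) (r j) \<and>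
          (\<forall>z\<in>cball (of_real (E j)) (r j). resonance (H_delta \<kappa> \<eta>) z \<longleftrightarrow> z = zs j \<eta>)) \<and>
      (\<forall>j\<in>{1..n}. \<forall>x\<in>I j. \<bar>Im (stieltjes \<eta> (of_real x)) / pi - c j * poisson (- Im (zs j \<eta>)) (Re (zs j \<eta>) - x)\<bar>
        \<le> d * poisson (- Im (zs j \<eta>)) (Re (zs j \<eta>) - x) + d) \<and>
      (\<forall>j\<in>{1..n}. \<forall>x. x \<notin> I j \<longrightarrow> poisson (- Im (zs j \<eta>)) (Re (zs j \<eta>) - x) \<le> d * cauchy_density (x - E j)) \<and>
      (\<forall>x\<in>T. \<bar>Im (stieltjes \<eta> (of_real x))\<bar> < d)) (at_right 0)"
    by (intro eventually_conj eventually_ball_finite ballI zs(2) zs(3) tail_ev stieltjes_off_spectrum[OF T T_nz] d finite_atLeastAtMost)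
  then obtain \<eta>\<^sub>0 where \<eta>\<^sub>0: "\<eta>\<^sub>0 > 0" and good: "\<And>\<eta>. 0 < \<eta> \<Longrightarrow> \<eta> < \<eta>\<^sub>0 \<Longrightarrow>
      (\<forall>j\<in>{1..n}. Im (zs j \<eta>) < 0 \<and> zs j \<eta> \<in> cball (of_real (E j)) (r j) \<and>
          (\<forall>z\<in>cball (of_real (E j)) (r j). resonance (H_delta \<kappa> \<eta>) z \<longleftrightarrow> z = zs j \<eta>)) \<and>
      (\<forall>j\<in>{1..n}. \<forall>x\<in>I j. \<bar>Im (stieltjes \<eta> (of_real x)) / pi - c j * poisson (- Im (zs j \<eta>)) (Re (zs j \<eta>) - x)\<bar>
        \<le> d * poisson (- Im (zs j \<eta>)) (Re (zs j \<eta>) - x) + d) \<and>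
      (\<forall>j\<in>{1..n}. \<forall>x. x \<notin> I j \<longrightarrow> poisson (- Im (zs j \<eta>)) (Re (zs j \<eta>) - x) \<le> d * cauchy_density (x - E j)) \<and>
      (\<forall>x\<in>T. \<bar>Im (stieltjes \<eta> (of_real x))\<bar> < d)"
    unfolding eventually_at_right_field by blast
  show ?thesis
  proof (rule exI[of _ \<eta>\<^sub>0], rule conjI[OF \<eta>\<^sub>0], intro allI impI)
    fix \<eta> assume "0 < \<eta> \<and> \<eta> < \<eta>\<^sub>0"
    then have \<eta>: "0 < \<eta>" "\<eta> < \<eta>\<^sub>0" by auto
    note G = good[OF \<eta>]
    have res: "z \<in> cball (of_real (E j)) (r j) \<and> resonance (H_delta \<kappa> \<eta>) z \<longleftrightarrow> z = zs j \<eta>" if "j \<in> {1..n}" for j z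
      using G that by blast
    have res_in: "resonance_in (H_delta \<kappa> \<eta>) (cball (of_real (E j)) (r j)) = zs j \<eta>" if "j \<in> {1..n}" for j
      unfolding resonance_in_def res[OF that] by (rule the_eq_trivial)
    let ?F = "\<lambda>x. Im (stieltjes \<eta> (of_real x)) / pi"
    have F_meas: "?F \<in> borel_measurable borel"
    proof (rule borel_measurable_continuous_onI)
      have "continuous_on UNIV (\<lambda>x. stieltjes \<eta> (of_real x))"
        by (rule continuous_on_compose2[OF continuous_on_stieltjes[OF \<eta>(1)]]) (auto intro!: continuous_intros)
      then show "continuous_on UNIV ?F" unfolding divide_inverse by (intro continuous_intros)
    qed
    have key: "cmod ((LINT x|lborel. exp (- \<i> * of_real t * of_real x) * of_real (\<chi>\<^sub>0 x) * of_real (?F x))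
      - (\<Sum>j\<in>{1..n}. of_real (c j) * exp (- \<i> * of_real t * Complex (Re (zs j \<eta>)) (- (- Im (zs j \<eta>)))))) \<le> d * C" if t: "t \<ge> 0" for t
      unfolding C_def
    proof (rule lorentzian_sum_estimate[OF _ less_imp_le[OF d] pq t F_meas _ chi01 chi_out c0])
      show "\<chi>\<^sub>0 \<in> borel_measurable borel" by (rule borel_measurable_continuous_onI[OF cont])
      show "disjoint_family_on (\<lambda>j. {E j - \<rho> j..E j + \<rho> j}) {1..n}" using I_disj by (simp add: I_def)
      show "\<chi>\<^sub>0 x = 1" if "j \<in> {1..n}" "x \<in> {E j - \<rho> j..E j + \<rho> j}" for j x
        by (rule chi_one) (use that \<rho>(4,5)[OF that(1)] in auto)
      show "\<bar>?F x\<bar> \<le> d" if x: "x \<in> {p..q}" "\<And>j. j \<in> {1..n} \<Longrightarrow> x \<notin> {E j - \<rho> j..E j + \<rho> j}" for x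
      proof -
        have "x \<in> T" unfolding T_def using x by fastforce
        then have "\<bar>Im (stieltjes \<eta> (of_real x))\<bar> < d" using G by blast
        moreover have "\<bar>Im (stieltjes \<eta> (of_real x))\<bar> / pi \<le> \<bar>Im (stieltjes \<eta> (of_real x))\<bar>"
          using pi_ge_two by (simp add: divide_le_eq mult_le_cancel_left1)
        ultimately show ?thesis by simp
      qed
    qed (use G \<rho>(1) in \<open>auto simp: I_def\<close>)
    show "(\<forall>j\<in>{1..n}. \<exists>!z. z \<in> cball (of_real (E j)) (r j) \<and> resonance (H_delta \<kappa> \<eta>) z) \<and>
      (\<forall>\<Phi>. borel_functional_calculus (H_delta \<kappa> \<eta>) \<Phi> \<longrightarrow>
        (\<forall>t\<ge>0.
          cmod (l2_inner \<phi>
                  (\<Phi> (\<lambda>s. exp (- \<i> * of_real t * of_real s)) (\<Phi> (\<lambda>s. of_real (\<chi>\<^sub>0 s)) \<phi>))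
                - (\<Sum>j=1..n. of_real ((cmod (l2_inner \<phi> (\<phi>\<^sub>D j)))\<^sup>2) *
                     exp (- \<i> * of_real t *
                       resonance_in (H_delta \<kappa> \<eta>) (cball (of_real (E j)) (r j)))))
          < \<epsilon>))"
    proof (intro conjI ballI allI impI)
      fix j assume "j \<in> {1..n}"
      then show "\<exists>!z. z \<in> cball (of_real (E j)) (r j) \<and> resonance (H_delta \<kappa> \<eta>) z"
        unfolding res[OF \<open>j \<in> {1..n}\<close>] by blast
    next
      fix \<Phi> and t :: real assume \<Phi>: "borel_functional_calculus (H_delta \<kappa> \<eta>) \<Phi>" and t: "0 \<le> t"
      interpret FC: borel_functional_calculus "H_delta \<kappa> \<eta>" \<Phi> by (rule \<Phi>)
      let ?e = "\<lambda>s. exp (- \<i> * of_real t * of_real s)"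
      let ?h = "\<lambda>s. complex_of_real (\<chi>\<^sub>0 s)"
      have ce: "continuous_on UNIV ?e" by (intro continuous_intros)
      have ch: "continuous_on UNIV ?h" by (intro continuous_intros cont)
      have e_bb: "?e \<in> bounded_borel"
        by (rule bounded_borelI[OF borel_measurable_continuous_onI[OF ce], of 1]) simp
      have h_bb: "?h \<in> bounded_borel"
        by (rule bounded_borelI[OF borel_measurable_continuous_onI[OF ch], of 1]) (use chi01 in simp)
      have ceh: "continuous_on UNIV (\<lambda>s. ?e s * ?h s)" by (intro continuous_on_mult ce ch)
      have eh_bb: "(\<lambda>s. ?e s * ?h s) \<in> bounded_borel"
        by (rule bounded_borelI[OF borel_measurable_continuous_onI[OF ceh], of 1]) (use chi01 in \<open>simp add: norm_mult\<close>)
      have L: "\<Phi> ?h \<phi> \<in> L2" "\<Phi> ?h \<psi> \<in> L2" using FC.in_L2 h_bb \<phi>L \<psi>L by blast+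
      have "l2_eq (\<Phi> ?e (\<Phi> ?h \<phi>)) (\<Phi> ?e (\<Phi> ?h \<psi>))"
        by (rule FC.cong[OF e_bb L FC.cong[OF h_bb \<phi>L \<psi>L \<psi>_eq]])
      moreover have "l2_eq (\<Phi> (\<lambda>s. ?e s * ?h s) \<psi>) (\<Phi> ?e (\<Phi> ?h \<psi>))"
        by (rule FC.hom_mult[OF e_bb h_bb \<psi>L])
      ultimately have "l2_eq (\<Phi> ?e (\<Phi> ?h \<phi>)) (\<Phi> (\<lambda>s. ?e s * ?h s) \<psi>)"
        unfolding l2_eq_def by eventually_elim simp
      then have "l2_inner \<phi> (\<Phi> ?e (\<Phi> ?h \<phi>)) = l2_inner \<psi> (\<Phi> (\<lambda>s. ?e s * ?h s) \<psi>)"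
        by (intro l2_inner_cong \<phi>L \<psi>L \<psi>_eq FC.in_L2 e_bb h_bb eh_bb)
      also have "\<dots> = (LINT x|lborel. ?e x * ?h x * of_real (?F x))"
        by (rule functional_calculus_density[OF \<eta>(1) \<Phi> ceh _ pq]) (simp add: chi_out)
      finally have lhs: "l2_inner \<phi> (\<Phi> ?e (\<Phi> ?h \<phi>)) = (LINT x|lborel. ?e x * ?h x * of_real (?F x))" .
      have coef: "(cmod (l2_inner \<phi> (\<phi>\<^sub>D j)))\<^sup>2 = c j" if "j \<in> {1..n}" for j
      proof -
        have "\<phi>\<^sub>D j \<in> L2" using eig(1)[OF that] by (simp add: eigenfunction_def)
        then have "l2_inner \<phi> (\<phi>\<^sub>D j) = l2_inner \<psi> (\<phi>\<^sub>D j)"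
          by (intro l2_inner_cong \<phi>L \<psi>L \<psi>_eq) simp_all
        then show ?thesis by (simp add: c_def)
      qed
      have rhs: "(\<Sum>j=1..n. of_real ((cmod (l2_inner \<phi> (\<phi>\<^sub>D j)))\<^sup>2) *
            exp (- \<i> * of_real t * resonance_in (H_delta \<kappa> \<eta>) (cball (of_real (E j)) (r j))))
          = (\<Sum>j\<in>{1..n}. of_real (c j) * exp (- \<i> * of_real t * Complex (Re (zs j \<eta>)) (- (- Im (zs j \<eta>)))))"
      proof (rule sum.cong[OF refl])
        fix j assume j: "j \<in> {1..n}"
        show "of_real ((cmod (l2_inner \<phi> (\<phi>\<^sub>D j)))\<^sup>2) *
            exp (- \<i> * of_real t * resonance_in (H_delta \<kappa> \<eta>) (cball (of_real (E j)) (r j)))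
          = of_real (c j) * exp (- \<i> * of_real t * Complex (Re (zs j \<eta>)) (- (- Im (zs j \<eta>))))"
          unfolding coef[OF j] res_in[OF j] by simp
      qed
      show "cmod (l2_inner \<phi> (\<Phi> ?e (\<Phi> ?h \<phi>))
                - (\<Sum>j=1..n. of_real ((cmod (l2_inner \<phi> (\<phi>\<^sub>D j)))\<^sup>2) *
                     exp (- \<i> * of_real t *
                       resonance_in (H_delta \<kappa> \<eta>) (cball (of_real (E j)) (r j)))))
          < \<epsilon>"
        unfolding lhs rhs by (rule le_less_trans[OF key[OF t] dC])
    qed
  qed
qed

end
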